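(* For all integers $k$ with $0 \le k \le 53$, the sequence $(A_{k+1}(\ell))_{1 \le \ell \le 2k+1}$ is log-concave; that is, $A_{k+1}(\ell)^2 \ge A_{k+1}(\ell-1)\,A_{k+1}(\ell+1)$ for all $\ell$ with $2 \le \ell \le 2k$.
   Context: Permutations of length $n$ are permutations of $\{1,\dots,n\}$ written in one-line notation $\pi = \pi_1 \pi_2 \cdots \pi_n$; the first element of $\pi$ is $\pi_1$. West's stack-sorting map $s$ is defined recursively on finite words with distinct positive integer letters: $s$ of the empty word is the empty word, and if a nonempty word is written as $L\, N\, R$ where $N$ is its largest letter, then $s(L\,N\,R) = s(L)\, s(R)\, N$ (concatenation). It maps permutations of length $n$ to permutations of length $n$. A permutation $\pi$ of length $n$ is called uniquely sorted if there is exactly one permutation $\sigma$ of length $n$ with $s(\sigma) = \pi$, i.e. $|s^{-1}(\pi)| = 1$. For integers $k \ge 0$ and $1 \le \ell \le 2k+1$, $A_{k+1}(\ell)$ denotes the number of uniquely sorted permutations of length $2k+1$ whose first element is $\ell$. *)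

theory Defs
  imports "HOL-Combinatorics.Multiset_Permutations"
begin

text \<open>
  West's stack-sorting map: $s(LNR) = s(L)\,s(R)\,N$ with $N$ the largest letter. Words are lists
  of naturals. On words with repeated letters, which play no role here, the first occurrence of
  the maximum is taken.
\<close>

function stack_sort :: "nat list \<Rightarrow> nat list" where
  "stack_sort w =
     (if w = [] then []
      else let N = Max (set w);
               L = takeWhile (\<lambda>x. x \<noteq> N) w;
               R = tl (dropWhile (\<lambda>x. x \<noteq> N) w)
           in stack_sort L @ stack_sort R @ [N])"
  by pat_completeness auto
termination
proof (relation "measure length", goal_cases)
  case 1
  show ?case by simp
next
  case (2 w N L)
  have "N \<in> set w"
    using 2 by simp
  hence "length (takeWhile (\<lambda>x. x \<noteq> N) w) < length w"
    by (induction w) auto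
  thus ?case using 2 by simp
next
  case (3 w N L R)
  have "length (dropWhile (\<lambda>x. x \<noteq> N) w) \<le> length w"
    by (rule length_dropWhile_le)
  moreover have "length w > 0"
    using 3 by simp
  ultimately have "length (tl (dropWhile (\<lambda>x. x \<noteq> N) w)) < length w"
    unfolding length_tl by linarith
  thus ?case using 3 by simp
qed

declare stack_sort.simps [simp del]

lemma stack_sort_Nil: "stack_sort [] = []"
  by (simp add: stack_sort.simps)

lemma stack_sort_append_Cons:
  assumes "\<forall>x\<in>set L. x < N" and "\<forall>x\<in>set R. x < N"
  shows "stack_sort (L @ N # R) = stack_sort L @ stack_sort R @ [N]"
proof -
  have "Max (set (L @ N # R)) = N"
    by (rule Max_eqI) (use assms in auto)
  moreover have "takeWhile (\<lambda>x. x \<noteq> N) (L @ N # R) = L"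
    using assms by (subst takeWhile_append2) auto
  moreover have "dropWhile (\<lambda>x. x \<noteq> N) (L @ N # R) = N # R"
    using assms by (subst dropWhile_append2) auto
  ultimately show ?thesis
    by (subst stack_sort.simps) (simp add: Let_def)
qed

text \<open>
  A permutation of length $n$ in one-line notation is an element of
  \<^term>\<open>permutations_of_set {1..n}\<close>.
\<close>

definition uniquely_sorted :: "nat \<Rightarrow> nat list \<Rightarrow> bool" where
  "uniquely_sorted n p \<longleftrightarrow>
     p \<in> permutations_of_set {1..n} \<and>
     card {q \<in> permutations_of_set {1..n}. stack_sort q = p} = 1"

text \<open>
  $A_m(\ell)$ for $m \ge 1$, indexed so that $A_{k+1}$ concerns permutations of
  length $2k+1$; the value at $m = 0$ is meaningless.
\<close>

definition uniq_sorted_count :: "nat \<Rightarrow> nat \<Rightarrow> nat" where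
  "uniq_sorted_count m l = card {p. uniquely_sorted (2 * m - 1) p \<and> hd p = l}"

end

theory Submission
  imports Defs "HOL-Computational_Algebra.Formal_Power_Series" "HOL-Computational_Algebra.Polynomial"
begin

text \<open>
  The preimages of \<open>w N\<close> under the stack-sorting map are the pairs of preimages of \<open>\<alpha>\<close> and \<open>\<beta>\<close>,
  where \<open>w = \<alpha> \<beta>\<close>. A word with a single preimage is therefore either a letter or \<open>\<alpha> \<beta> N\<close>, with
  \<open>\<alpha>\<close> and \<open>\<beta>\<close> again of this kind and the last letter of \<open>\<alpha>\<close> above the first letter of \<open>\<beta>\<close>.
  Let \<open>h p q\<close> count such words on \<open>p + q + 1\<close> letters whose first letter has \<open>p\<close> letters below
  and \<open>q\<close> letters above it. The decomposition gives a quadratic recursion for \<open>h\<close>, which is solved by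
  \[ \sum_{p,q} h(p,q) \frac{t^p s^q}{p!\,q!} = \frac{g(t)\, g(s)}{g(t + s)}, \qquad
     g(x) = \sum_a \frac{(-1)^a x^{2a}}{a!\,(a+1)!} = \frac{J_1(2x)}{x}. \]

  For \<open>p + q \<le> 26\<close> the numbers are computed. Beyond that, the smallest zero of \<open>g\<close> dominates:
  up to a constant factor the homogeneous part of degree \<open>2k\<close> is very close to \<open>(t + s)\<^sup>2\<close> times the one of
  degree \<open>2k - 2\<close>. Multiplication by \<open>t + s\<close> preserves log-concavity of the coefficients with respect to
  \<open>t\<^sup>p s\<^sup>q / (p! q!)\<close>. As the part of degree 26 is \<open>ts\<close> times a form that is already log-concave in
  this sense, there is enough room to absorb the error for all \<open>k \<le> 53\<close>.
\<close>

subsection \<open>Words with a single preimage\<close>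

text \<open>The quadratic recursion serves to identify the generating function. The obstacle in it
  is the condition between \<open>\<alpha>\<close> and \<open>\<beta>\<close>, which compares the
  first letter of \<open>\<beta>\<close> with the largest letter of \<open>\<alpha>\<close>.
  Counting by complement turns it into the condition that all of \<open>\<alpha>\<close> lies below
  that first letter; the sum that arises can be evaluated because the coefficients of
  \<open>g\<close>, multiplied by factorials, are signed Catalan numbers. The numbers themselves are
  computed from a linear recursion: the difference of the two partial derivatives annihilates
  \<open>1 / g(t + s)\<close>.

  For large \<open>k\<close> the comparison is with a single computed row. The ends of a row vanish,
  and the resulting factor \<open>p q\<close> is strictly log-concave; this is where the room comes
  from. After scaling by \<open>zeta ^ k\<close>, both the bound for the error and the room are
  independent of \<open>k\<close>, but the error counts with the factor \<open>2k (2k - 1)\<close>.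
  A fixed row therefore settles only a bounded range of \<open>k\<close>; at \<open>k = 53\<close>
  the factor is 11130.\<close>

inductive usorted :: "nat list \<Rightarrow> bool" where
  usorted_single: "usorted [N]"
| usorted_join: "usorted \<alpha> \<Longrightarrow> usorted \<beta> \<Longrightarrow> hd \<beta> < last \<alpha> \<Longrightarrow> set \<alpha> \<inter> set \<beta> = {} \<Longrightarrow>
    \<forall>x\<in>set \<alpha> \<union> set \<beta>. x < N \<Longrightarrow> usorted (\<alpha> @ \<beta> @ [N])"

lemma usorted_nonempty: "usorted w \<Longrightarrow> w \<noteq> []"
  by (induction rule: usorted.induct) auto

lemma usorted_distinct: "usorted w \<Longrightarrow> distinct w"
  by (induction rule: usorted.induct) auto

text \<open>Turns the descent condition \<open>hd \<beta> < last \<alpha>\<close> into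
  \<open>hd \<beta> < Max (set \<alpha>)\<close>, which sees only the set of letters of
  \<open>\<alpha>\<close>. This makes the words countable by a choice of that set.\<close>

lemma usorted_last: "usorted w \<Longrightarrow> last w = Max (set w)"
proof (induction rule: usorted.induct)
  case (usorted_join \<alpha> \<beta> N)
  have "Max (set (\<alpha> @ \<beta> @ [N])) = N"
    by (rule Max_eqI) (use usorted_join in \<open>auto simp: less_imp_le\<close>)
  then show ?case by simp
qed simp

fun height :: "nat list \<Rightarrow> int" where
  "height (x # y # zs) = (if y < x then 1 else - 1) + height (y # zs)"
| "height _ = 0"

lemma height_append:
  assumes "xs \<noteq> []" "ys \<noteq> []"
  shows "height (xs @ ys) = height xs + (if hd ys < last xs then 1 else - 1) + height ys"
  using assms
proof (induction xs rule: height.induct)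
  case ("2_2" v)
  then show ?case by (cases ys) auto
qed auto

lemma distinct_max_split:
  fixes w :: "nat list"
  assumes "distinct w" "w \<noteq> []"
  obtains L N R where "w = L @ N # R" "\<forall>x\<in>set L. x < N" "\<forall>x\<in>set R. x < N"
proof -
  have "Max (set w) \<in> set w" using assms by simp
  then obtain L R where w: "w = L @ Max (set w) # R" by (meson split_list)
  have "x < Max (set w)" if "x \<in> set L \<union> set R" for x
  proof -
    have "x \<in> set w" using that w by (metis UnCI UnE in_set_conv_decomp set_append set_ConsD list.set_intros(2))
    then have "x \<le> Max (set w)" by simp
    moreover have "x \<noteq> Max (set w)" using that assms(1) w
      by (metis UnE distinct_append distinct.simps(2) disjoint_iff list.set_intros(1))
    ultimately show ?thesis by simp
  qed
  then show ?thesis using that w by blast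
qed

lemma distinct_max_induct [consumes 1, case_names Nil split]:
  fixes w :: "nat list"
  assumes "distinct w" "P []"
    "\<And>L N R. distinct (L @ N # R) \<Longrightarrow> \<forall>x\<in>set L. x < N \<Longrightarrow> \<forall>x\<in>set R. x < N \<Longrightarrow> P L \<Longrightarrow> P R \<Longrightarrow> P (L @ N # R)"
  shows "P w"
  using assms(1)
proof (induction w rule: length_induct)
  case (1 w)
  show ?case
  proof (cases "w = []")
    case False
    then obtain L N R where "w = L @ N # R" "\<forall>x\<in>set L. x < N" "\<forall>x\<in>set R. x < N"
      using distinct_max_split 1 by metis
    then show ?thesis using 1 assms(3)[of L N R] by simp
  qed (use assms(2) in simp)
qed

lemma mset_stack_sort: "distinct q \<Longrightarrow> mset (stack_sort q) = mset q"
  by (induction rule: distinct_max_induct) (auto simp: stack_sort_Nil stack_sort_append_Cons)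

lemma set_stack_sort: "distinct q \<Longrightarrow> set (stack_sort q) = set q"
  using mset_stack_sort mset_eq_setD by blast

lemma stack_sort_eq_Nil: "distinct q \<Longrightarrow> stack_sort q = [] \<longleftrightarrow> q = []"
  by (metis mset_stack_sort mset_zero_iff stack_sort_Nil)

text \<open>
  Reading descents as up-steps and ascents as down-steps, a sorted word is a lattice path whose
  end point is its lowest point; the uniquely sorted words are those whose path returns to 0,
  and these are Dyck paths. This is what makes the decomposition unique.
\<close>

lemma height_stack_sort:
  assumes "distinct q" "q \<noteq> []"
  shows "height (stack_sort q) \<le> 0 \<and>
    (\<forall>p r. stack_sort q = p @ r \<longrightarrow> p \<noteq> [] \<longrightarrow> height (stack_sort q) \<le> height p)"
  using assms
proof (induction rule: distinct_max_induct)
  case (split L N R)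
  define a where "a = stack_sort L"
  define b where "b = stack_sort R"
  have s: "stack_sort (L @ N # R) = a @ b @ [N]"
    using split.hyps by (simp add: a_def b_def stack_sort_append_Cons)
  have dL: "distinct L" "distinct R" using split.hyps by auto
  have ltN: "\<forall>x\<in>set (a @ b). x < N"
    using split.hyps dL by (auto simp: a_def b_def set_stack_sort)
  have LR: "a \<noteq> [] \<Longrightarrow> L \<noteq> []" "b \<noteq> [] \<Longrightarrow> R \<noteq> []"
    by (auto simp: a_def b_def stack_sort_Nil)
  note a = split.IH(1)[OF LR(1), folded a_def, THEN conjunct1]
    split.IH(1)[OF LR(1), folded a_def, THEN conjunct2, rule_format]
  note b = split.IH(2)[OF LR(2), folded b_def, THEN conjunct1]
    split.IH(2)[OF LR(2), folded b_def, THEN conjunct2, rule_format]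
  have N: "height (x @ [N]) = height x - 1" if "x \<noteq> []" "set x \<subseteq> set (a @ b)" for x
  proof -
    have "last x < N" using that ltN last_in_set[of x] by blast
    then show ?thesis using that by (simp add: height_append)
  qed
  have main: "height (a @ b @ [N]) \<le> 0 \<and> (\<forall>p. p \<noteq> [] \<longrightarrow> (\<exists>r. a @ b = p @ r) \<longrightarrow> height (a @ b @ [N]) \<le> height p)"
  proof (cases "a = [] \<or> b = []")
    case True
    define c where "c = a @ b"
    have c: "height c \<le> 0" "\<And>p r. c = p @ r \<Longrightarrow> p \<noteq> [] \<Longrightarrow> height c \<le> height p" if "c \<noteq> []"
      using True a b that by (auto simp: c_def)
    have "height (c @ [N]) \<le> height c"
      using N[of c] by (cases "c = []") (auto simp: c_def)
    moreover have "height c \<le> 0" using c by (cases "c = []") auto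
    moreover have "height c \<le> height p" if "p \<noteq> []" "c = p @ r" for p r
      using c(2)[of p r] that by blast
    ultimately show ?thesis unfolding c_def append_assoc by (meson order.trans)
  next
    case False
    then have ne: "a \<noteq> []" "b \<noteq> []" by auto
    define d where "d = (if hd b < last a then 1 else - 1 :: int)"
    have d: "d \<le> 1" by (simp add: d_def)
    have ab: "height (a @ x) = height a + d + height x" if "x \<noteq> []" "hd x = hd b" for x
      using height_append[of a x] ne that by (simp add: d_def)
    \<comment> \<open>The step down into \<open>N\<close> cancels the most that the junction
      \<open>d\<close> can add.\<close>
    have h: "height (a @ b @ [N]) = height a + d + height b - 1"
      using N[of "a @ b"] ab[of b] ne by simp
    have "height (a @ b @ [N]) \<le> height p" if p: "p \<noteq> []" "a @ b = p @ r" for p r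
    proof (cases "length p \<le> length a")
      case True
      then obtain r' where "a = p @ r'" using p(2) by (auto simp: append_eq_append_conv2)
      then have "height a \<le> height p" using a(2)[OF ne(1)] p by blast
      then show ?thesis using h d b(1)[OF ne(2)] by simp
    next
      case False
      then obtain p' where p': "p = a @ p'" "b = p' @ r" "p' \<noteq> []"
        using p(2) by (auto simp: append_eq_append_conv2)
      then have "height b \<le> height p'" using b(2)[OF ne(2)] by blast
      moreover have "height p = height a + d + height p'"
        using ab[of p'] p' by simp
      ultimately show ?thesis using h by simp
    qed
    then show ?thesis using h d a(1)[OF ne(1)] b(1)[OF ne(2)] by auto
  qed
  have pre: "height (a @ b @ [N]) \<le> height p" if "a @ b @ [N] = p @ r" "p \<noteq> []" for p r
  proof (cases "r = []")
    case False
    then have "a @ b = p @ butlast r" using that(1)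
      by (metis append_assoc butlast_append butlast_snoc)
    then show ?thesis using main that by blast
  qed (use that in simp)
  show ?case unfolding s using main pre by blast
qed simp

lemma stack_sort_last_Max:
  assumes "distinct q" "q \<noteq> []" "x \<in> set (stack_sort q)"
  shows "x \<le> last (stack_sort q)"
proof -
  obtain L N R where "q = L @ N # R" "\<forall>x\<in>set L. x < N" "\<forall>x\<in>set R. x < N"
    using distinct_max_split assms by metis
  then show ?thesis using assms by (auto simp: stack_sort_append_Cons set_stack_sort less_imp_le)
qed

lemma usorted_height: "usorted w \<Longrightarrow> height w = 0"
proof (induction rule: usorted.induct)
  case (usorted_join \<alpha> \<beta> N)
  have "last \<beta> < N" "\<alpha> \<noteq> []" "\<beta> \<noteq> []" using usorted_join usorted_nonempty by auto
  then show ?case using usorted_join by (simp add: height_append not_less less_imp_le)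
qed simp

lemma stack_sort_joinI:
  assumes "distinct L" "distinct R" "set L \<inter> set R = {}" "\<forall>x\<in>set (stack_sort L @ stack_sort R). x < N"
  shows "distinct (L @ N # R)" "stack_sort (L @ N # R) = stack_sort L @ stack_sort R @ [N]"
proof -
  have "\<forall>x\<in>set L \<union> set R. x < N" using assms by (auto simp: set_stack_sort)
  then show "distinct (L @ N # R)" "stack_sort (L @ N # R) = stack_sort L @ stack_sort R @ [N]"
    using assms by (auto simp: stack_sort_append_Cons)
qed

lemma usorted_sorted: "usorted w \<Longrightarrow> \<exists>q. distinct q \<and> stack_sort q = w"
proof (induction rule: usorted.induct)
  case (usorted_single N)
  show ?case using stack_sort_append_Cons[of "[]" N "[]"] by (intro exI[of _ "[N]"]) (simp add: stack_sort_Nil)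
next
  case (usorted_join \<alpha> \<beta> N)
  then obtain L R where LR: "distinct L" "stack_sort L = \<alpha>" "distinct R" "stack_sort R = \<beta>" by blast
  have "set L \<inter> set R = {}" using usorted_join LR by (metis set_stack_sort)
  then show ?case using stack_sort_joinI[of L R N] LR usorted_join.hyps(5)
    by (intro exI[of _ "L @ N # R"]) auto
qed

text \<open>In a preimage, the position of \<open>N\<close> cuts \<open>\<alpha> @ \<beta>\<close>
  in two, and heights leave one place for the cut. As \<open>\<alpha> @ \<beta>\<close> has height
  1, it is not sorted itself, so neither side is empty. If the left side reached into
  \<open>\<beta>\<close>, it would end above 0; if the right side began inside
  \<open>\<alpha>\<close>, it would end above one of its own prefixes.\<close>

lemma usorted_unique:
  assumes "usorted w" "distinct q" "stack_sort q = w" "distinct q'" "stack_sort q' = w"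
  shows "q = q'"
  using assms
proof (induction arbitrary: q q' rule: usorted.induct)
  case (usorted_single N)
  have "\<exists>x. p = [x] \<and> x = N" if "distinct p" "stack_sort p = [N]" for p
  proof -
    have "mset p = {#N#}" using mset_stack_sort that by fastforce
    then show ?thesis by simp
  qed
  from this[OF usorted_single(1,2)] this[OF usorted_single(3,4)] show ?case by simp
next
  case (usorted_join \<alpha> \<beta> N)
  have ne: "\<alpha> \<noteq> []" "\<beta> \<noteq> []" using usorted_join usorted_nonempty by auto
  have h0: "height \<alpha> = 0" "height \<beta> = 0" using usorted_join usorted_height by auto
  have key: "\<exists>L R. p = L @ N # R \<and> stack_sort L = \<alpha> \<and> stack_sort R = \<beta> \<and> distinct L \<and> distinct R"
    if p: "distinct p" "stack_sort p = \<alpha> @ \<beta> @ [N]" for p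
  proof -
    have "p \<noteq> []" using p by (auto simp: stack_sort_Nil)
    then obtain L M R where LMR: "p = L @ M # R" "\<forall>x\<in>set L. x < M" "\<forall>x\<in>set R. x < M"
      using distinct_max_split p by metis
    have d: "distinct L" "distinct R" using p LMR by auto
    have eq: "stack_sort L @ stack_sort R = \<alpha> @ \<beta>" "M = N"
      using p(2) LMR by (auto simp: stack_sort_append_Cons)
    have hab: "height (\<alpha> @ \<beta>) = 1" using ne h0 usorted_join by (simp add: height_append)
    have Lne: "L \<noteq> []"
    proof
      assume "L = []"
      then have "R \<noteq> []" "stack_sort R = \<alpha> @ \<beta>" using eq ne by (auto simp: stack_sort_Nil)
      then show False using height_stack_sort[OF d(2), THEN conjunct1] hab by simp
    qed
    have Rne: "R \<noteq> []"
    proof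
      assume "R = []"
      then have "stack_sort L = \<alpha> @ \<beta>" using eq ne by (auto simp: stack_sort_Nil)
      then show False using height_stack_sort[OF d(1) Lne, THEN conjunct1] hab by simp
    qed
    have hL: "height (stack_sort L) \<le> 0" and hR: "height (stack_sort R) \<le> 0"
      using height_stack_sort[THEN conjunct1] d Lne Rne by blast+
    have nes: "stack_sort L \<noteq> []" "stack_sort R \<noteq> []" using Lne Rne d by (auto simp: stack_sort_eq_Nil)
    obtain c where c: "(stack_sort L = \<alpha> @ c \<and> c @ stack_sort R = \<beta>) \<or> (stack_sort L @ c = \<alpha> \<and> stack_sort R = c @ \<beta>)"
      using eq(1) by (auto simp: append_eq_append_conv2)
    have "c = []"
    proof (rule ccontr)
      assume cne: "c \<noteq> []"
      from c show False
      proof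
        assume c1: "stack_sort L = \<alpha> @ c \<and> c @ stack_sort R = \<beta>"
        then have "height (stack_sort L) = 1 + height c"
          using cne ne h0 usorted_join by (auto simp: height_append)
        \<comment> \<open>\<open>c\<close> is a prefix of the sorted word \<open>\<beta>\<close>,
          whose end at height 0 is its lowest point.\<close>
        moreover have "height c \<ge> 0"
        proof -
          obtain r where "distinct r" "stack_sort r = \<beta>" using usorted_join usorted_sorted by blast
          moreover from this ne have "r \<noteq> []" by (auto simp: stack_sort_Nil)
          ultimately show ?thesis
            using height_stack_sort[of r, THEN conjunct2, rule_format, of c "stack_sort R"] c1 cne h0 by simp
        qed
        ultimately show False using hL by simp
      next
        assume c2: "stack_sort L @ c = \<alpha> \<and> stack_sort R = c @ \<beta>"
        define d where "d = (if hd c < last (stack_sort L) then 1 else - 1 :: int)"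
        have "height \<alpha> = height (stack_sort L) + d + height c"
          using c2 nes cne height_append[of "stack_sort L" c] by (auto simp: d_def)
        moreover have "d \<le> 1" by (simp add: d_def)
        ultimately have "height c \<ge> - 1" using h0 hL by simp
        moreover have "last c = last \<alpha>" using c2 cne by auto
        then have "height (stack_sort R) = height c + 1"
          using c2 cne ne h0 usorted_join by (auto simp: height_append)
        moreover have "height (stack_sort R) \<le> height c"
          using height_stack_sort[OF d(2) Rne, THEN conjunct2, rule_format, of c \<beta>] c2 cne by simp
        ultimately show False by simp
      qed
    qed
    then show ?thesis using c LMR eq d by auto
  qed
  obtain L R where LR: "q = L @ N # R" "stack_sort L = \<alpha>" "stack_sort R = \<beta>" "distinct L" "distinct R"
    using key[OF usorted_join.prems(1,2)] by blast
  obtain L' R' where LR': "q' = L' @ N # R'" "stack_sort L' = \<alpha>" "stack_sort R' = \<beta>" "distinct L'" "distinct R'"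
    using key[OF usorted_join.prems(3,4)] by blast
  show ?case using usorted_join.IH(1)[of L L'] usorted_join.IH(2)[of R R'] LR LR' by simp
qed

text \<open>The reason for the descent in \<open>usorted_join\<close>: if \<open>\<beta>\<close>
  starts above the sorted word in front of it, that word can be merged into the leftmost branch of a
  preimage of \<open>\<beta>\<close>, and the concatenation is sorted as a whole. The induction
  follows this branch.\<close>

lemma sorted_append_usorted:
  assumes "usorted \<beta>" "distinct q" "q \<noteq> []" "set q \<inter> set \<beta> = {}" "last (stack_sort q) < hd \<beta>"
  shows "\<exists>r. distinct r \<and> stack_sort r = stack_sort q @ \<beta>"
  using assms
proof (induction arbitrary: q rule: usorted.induct)
  case (usorted_single N)
  then have "\<forall>x\<in>set (stack_sort q). x < N"
    using stack_sort_last_Max[of q] by fastforce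
  then show ?case using stack_sort_joinI[of q "[]" N] usorted_single
    by (intro exI[of _ "q @ [N]"]) (auto simp: stack_sort_Nil)
next
  case (usorted_join \<gamma> \<delta> M)
  have ne: "\<gamma> \<noteq> []" "\<delta> \<noteq> []" using usorted_join usorted_nonempty by auto
  have hd: "last (stack_sort q) < hd \<gamma>" using usorted_join.prems ne by simp
  then obtain r where r: "distinct r" "stack_sort r = stack_sort q @ \<gamma>"
    using usorted_join.IH(1)[of q] usorted_join.prems by auto
  obtain R where R: "distinct R" "stack_sort R = \<delta>" using usorted_join usorted_sorted by blast
  have "\<forall>x\<in>set (stack_sort q). x < M"
  proof
    fix x assume "x \<in> set (stack_sort q)"
    then have "x \<le> last (stack_sort q)" using stack_sort_last_Max usorted_join by auto
    also have "\<dots> < M" using hd usorted_join.hyps(5) hd_in_set[OF ne(1)] by (meson UnI1 order.strict_trans)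
    finally show "x < M" .
  qed
  moreover have "set r \<inter> set R = {}"
    using usorted_join.prems usorted_join.hyps r R set_stack_sort[of r] set_stack_sort[of R] set_stack_sort[of q] by auto
  ultimately show ?case using stack_sort_joinI[of r R M] r R usorted_join.hyps(5)
    by (intro exI[of _ "r @ M # R"]) auto
qed

text \<open>Another preimage of one side could be exchanged for it without touching the other side,
  so uniqueness is inherited by both.\<close>

lemma unique_imp_usorted:
  assumes "distinct q" "q \<noteq> []" "\<forall>q'. distinct q' \<longrightarrow> stack_sort q' = stack_sort q \<longrightarrow> q' = q"
  shows "usorted (stack_sort q)"
  using assms
proof (induction rule: distinct_max_induct)
  case (split L N R)
  have s: "stack_sort (L @ N # R) = stack_sort L @ stack_sort R @ [N]"
    using split.hyps by (simp add: stack_sort_append_Cons)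
  have d: "distinct L" "distinct R" "set L \<inter> set R = {}" "N \<notin> set L" "N \<notin> set R" using split.hyps by auto
  have uniq: "q' = L @ N # R" if "distinct q'" "stack_sort q' = stack_sort L @ stack_sort R @ [N]" for q'
    using split.prems(2) that s by simp
  have lt: "\<forall>x\<in>set (stack_sort L @ stack_sort R). x < N" using split.hyps d by (auto simp: set_stack_sort)
  \<comment> \<open>If a single word were mapped to everything before \<open>N\<close>, then
    \<open>N\<close> could be placed in front of it or behind it. This excludes that just one side
    is empty, and also a missing descent.\<close>
  have no: False if r: "distinct r" "stack_sort r = stack_sort L @ stack_sort R" "r \<noteq> []" for r
  proof -
    have a: "\<forall>x\<in>set r. x < N" using lt r set_stack_sort[of r] by auto
    have "stack_sort ([] @ N # r) = stack_sort L @ stack_sort R @ [N]" "stack_sort (r @ N # []) = stack_sort L @ stack_sort R @ [N]"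
      using a r stack_sort_append_Cons[of "[]" N r] stack_sort_append_Cons[of r N "[]"] by (auto simp: stack_sort_Nil)
    moreover have "distinct ([] @ N # r)" "distinct (r @ N # [])" using a r by auto
    ultimately have "[] @ N # r = r @ N # []" using uniq by metis
    then have "hd r = N" using r(3) by (metis append_Nil hd_append2 list.sel(1))
    then show False using a r(3) by auto
  qed
  show ?case
  proof (cases "L = [] \<and> R = []")
    case True
    then show ?thesis using s by (simp add: stack_sort_Nil usorted_single)
  next
    case False
    have L: "L \<noteq> []" using no[of R] d False by (auto simp: stack_sort_Nil)
    have R: "R \<noteq> []" using no[of L] d False by (auto simp: stack_sort_Nil)
    have swap: "distinct (L' @ N # R')" "stack_sort (L' @ N # R') = stack_sort L @ stack_sort R @ [N]"
      if "distinct L'" "stack_sort L' = stack_sort L" "distinct R'" "stack_sort R' = stack_sort R" for L' R'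
    proof -
      have "set L' = set L" "set R' = set R" using that d by (metis set_stack_sort)+
      then show "distinct (L' @ N # R')" "stack_sort (L' @ N # R') = stack_sort L @ stack_sort R @ [N]"
        using stack_sort_joinI[of L' R' N] that d lt by auto
    qed
    have "L' = L" if "distinct L'" "stack_sort L' = stack_sort L" for L'
    proof -
      have "set L' = set L" using that d by (metis set_stack_sort)
      moreover have "L' @ N # R = L @ N # R" using uniq swap[of L' R] that d by blast
      ultimately show ?thesis by simp
    qed
    then have UL: "usorted (stack_sort L)" using split.IH(1) L by blast
    have "R' = R" if "distinct R'" "stack_sort R' = stack_sort R" for R'
      using uniq swap[of L R'] that d by blast
    then have UR: "usorted (stack_sort R)" using split.IH(2) R by blast
    have dis: "set (stack_sort L) \<inter> set (stack_sort R) = {}" using d by (simp add: set_stack_sort)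
    have "hd (stack_sort R) < last (stack_sort L)"
    proof (rule ccontr)
      assume "\<not> ?thesis"
      moreover have "hd (stack_sort R) \<noteq> last (stack_sort L)"
        using dis UL UR usorted_nonempty by (metis disjoint_iff hd_in_set last_in_set)
      ultimately have "\<exists>r. distinct r \<and> stack_sort r = stack_sort L @ stack_sort R"
        using sorted_append_usorted[OF UR d(1) L] d by (auto simp: set_stack_sort)
      then show False using no UL usorted_nonempty by (metis append_is_Nil_conv stack_sort_Nil)
    qed
    then show ?thesis using usorted_join[OF UL UR _ dis] lt s by auto
  qed
qed simp

lemma uniquely_sorted_iff_usorted:
  assumes "n > 0"
  shows "uniquely_sorted n p \<longleftrightarrow> usorted p \<and> set p = {1..n}"
proof -
  define Q where "Q = {q \<in> permutations_of_set {1..n}. stack_sort q = p}"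
  have mem: "q \<in> Q \<longleftrightarrow> distinct q \<and> set q = {1..n} \<and> stack_sort q = p" for q
    unfolding Q_def permutations_of_set_def by blast
  have us: "uniquely_sorted n p \<longleftrightarrow> (distinct p \<and> set p = {1..n}) \<and> card Q = 1"
    unfolding uniquely_sorted_def Q_def permutations_of_set_def by blast
  show ?thesis
  proof
    assume u: "uniquely_sorted n p"
    then obtain q where Q: "Q = {q}" using us by (auto simp: card_1_singleton_iff)
    then have q: "distinct q" "set q = {1..n}" "stack_sort q = p" using mem by blast+
    have "q \<noteq> []" using q(2) assms by auto
    moreover have "q' = q" if "distinct q'" "stack_sort q' = p" for q'
    proof -
      have "set q' = {1..n}" using that us u set_stack_sort by blast
      then show ?thesis using mem[of q'] that Q by blast
    qed
    ultimately show "usorted p \<and> set p = {1..n}" using unique_imp_usorted[of q] q us u by blast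
  next
    assume p: "usorted p \<and> set p = {1..n}"
    then obtain q where q: "distinct q" "stack_sort q = p" using usorted_sorted by blast
    then have "set q = {1..n}" using p set_stack_sort by blast
    then have "q \<in> Q" using mem q by blast
    moreover have "q' = q" if "q' \<in> Q" for q'
      using that mem usorted_unique p q by blast
    ultimately have "Q = {q}" by blast
    then show "uniquely_sorted n p" using us p usorted_distinct by simp
  qed
qed

subsection \<open>Counting by the first letter\<close>

definition usorted_words :: "nat set \<Rightarrow> nat \<Rightarrow> nat list set" where
  "usorted_words S l = {w. usorted w \<and> set w = S \<and> hd w = l}"

text \<open>The letters start at 0, so that the first letter equals the number of letters below
  it.\<close>

definition usorted_count :: "nat \<Rightarrow> nat \<Rightarrow> nat" where
  "usorted_count p q = card (usorted_words {..p + q} p)"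

definition usorted_total :: "nat \<Rightarrow> nat" where
  "usorted_total n = (\<Sum>i<n. usorted_count i (n - 1 - i))"

lemma finite_usorted_words: "finite S \<Longrightarrow> finite (usorted_words S l)"
  by (rule finite_subset[OF _ finite_permutations_of_set[of S]])
     (auto simp: usorted_words_def permutations_of_set_def usorted_distinct)

lemma usorted_map: "usorted w \<Longrightarrow> strict_mono_on (set w) f \<Longrightarrow> usorted (map f w)"
proof (induction rule: usorted.induct)
  case (usorted_join \<alpha> \<beta> N)
  have ne: "\<alpha> \<noteq> []" "\<beta> \<noteq> []" using usorted_join usorted_nonempty by auto
  have inj: "inj_on f (set (\<alpha> @ \<beta> @ [N]))" using usorted_join.prems strict_mono_on_imp_inj_on by blast
  have mono: "f x < f y" if "x < y" "x \<in> set (\<alpha> @ \<beta> @ [N])" "y \<in> set (\<alpha> @ \<beta> @ [N])" for x y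
    using usorted_join.prems that by (meson strict_mono_onD)
  have "usorted (map f \<alpha> @ map f \<beta> @ [f N])"
  proof (rule usorted.usorted_join)
    show "usorted (map f \<alpha>)" "usorted (map f \<beta>)"
      using usorted_join by (auto intro!: usorted_join.IH simp: strict_mono_on_def)
    show "hd (map f \<beta>) < last (map f \<alpha>)"
      using ne usorted_join.hyps by (auto simp: hd_map last_map intro!: mono)
    have "f ` set \<alpha> \<inter> f ` set \<beta> = f ` (set \<alpha> \<inter> set \<beta>)"
      using inj by (intro inj_on_image_Int[symmetric]) auto
    then show "set (map f \<alpha>) \<inter> set (map f \<beta>) = {}"
      using usorted_join.hyps by simp
    show "\<forall>x\<in>set (map f \<alpha>) \<union> set (map f \<beta>). x < f N"
      using usorted_join.hyps mono by auto
  qed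
  then show ?case by simp
qed (auto intro: usorted_single)

lemma card_usorted_words_image:
  assumes f: "strict_mono_on S f" and l: "l \<in> S"
  shows "card (usorted_words (f ` S) (f l)) = card (usorted_words S l)"
proof -
  define g where "g = inv_into S f"
  have inj: "inj_on f S" using f strict_mono_on_imp_inj_on by blast
  have gf: "g (f x) = x" if "x \<in> S" for x using inj that by (simp add: g_def)
  have g: "strict_mono_on (f ` S) g"
  proof (rule strict_mono_onI)
    fix x y assume "x \<in> f ` S" "y \<in> f ` S" "x < y"
    then obtain a b where ab: "a \<in> S" "b \<in> S" "x = f a" "y = f b" "f a < f b" by auto
    then have "a < b" using f by (metis linorder_less_linear order_less_asym strict_mono_onD)
    then show "g x < g y" using ab gf by simp
  qed
  have "bij_betw (map f) (usorted_words S l) (usorted_words (f ` S) (f l))"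
  proof (rule bij_betw_byWitness[where f' = "map g"])
    show "\<forall>w\<in>usorted_words S l. map g (map f w) = w"
      by (auto simp: usorted_words_def gf intro!: map_idI)
    show "\<forall>w\<in>usorted_words (f ` S) (f l). map f (map g w) = w"
      by (auto simp: usorted_words_def gf intro!: map_idI)
    show "map f ` usorted_words S l \<subseteq> usorted_words (f ` S) (f l)"
      using f by (auto simp: usorted_words_def usorted_map hd_map usorted_nonempty)
    show "map g ` usorted_words (f ` S) (f l) \<subseteq> usorted_words S l"
      using g l by (auto simp: usorted_words_def usorted_map hd_map usorted_nonempty gf image_image)
  qed
  then show ?thesis by (simp add: bij_betw_same_card)
qed

lemma card_split_at:
  fixes l :: "'a :: linorder"
  assumes "finite S" "l \<in> S"
  shows "card S = Suc (card {x\<in>S. x < l} + card {x\<in>S. l < x})"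
proof -
  have "S = insert l ({x\<in>S. x < l} \<union> {x\<in>S. l < x})" using assms by auto
  then have "card S = card (insert l ({x\<in>S. x < l} \<union> {x\<in>S. l < x}))" by simp
  also have "\<dots> = Suc (card ({x\<in>S. x < l} \<union> {x\<in>S. l < x}))"
    using assms by (intro card_insert_disjoint) auto
  also have "card ({x\<in>S. x < l} \<union> {x\<in>S. l < x}) = card {x\<in>S. x < l} + card {x\<in>S. l < x}"
    using assms by (intro card_Un_disjoint) auto
  finally show ?thesis .
qed

text \<open>The cut is unique because the preimage is: two cuts would give preimages with different
  words to the left of \<open>N\<close>.\<close>

lemma usorted_join_cancel:
  assumes "usorted \<alpha>" "usorted \<beta>" "usorted \<alpha>'" "usorted \<beta>'" "usorted (\<alpha> @ \<beta> @ [N])"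
    "\<forall>x\<in>set (\<alpha> @ \<beta>). x < N" "\<alpha> @ \<beta> @ [N] = \<alpha>' @ \<beta>' @ [N]"
  shows "\<alpha> = \<alpha>'"
proof -
  have ex: "\<exists>L R. stack_sort L = a \<and> stack_sort (L @ N # R) = \<alpha> @ \<beta> @ [N] \<and> distinct (L @ N # R)"
    if ab: "usorted a" "usorted b" "a @ b @ [N] = \<alpha> @ \<beta> @ [N]" for a b
  proof -
    obtain L R where LR: "distinct L" "stack_sort L = a" "distinct R" "stack_sort R = b"
      using usorted_sorted[OF ab(1)] usorted_sorted[OF ab(2)] by blast
    have "a @ b = \<alpha> @ \<beta>" using ab(3) by simp
    then have "\<forall>x\<in>set (a @ b). x < N" "distinct (a @ b)" using assms(6) usorted_distinct[OF assms(5)] by simp_all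
    moreover have "set L \<inter> set R = {}" using LR calculation(2) set_stack_sort by auto
    ultimately show ?thesis using stack_sort_joinI[of L R N] LR ab(3) by auto
  qed
  obtain L R where LR: "stack_sort L = \<alpha>" "stack_sort (L @ N # R) = \<alpha> @ \<beta> @ [N]" "distinct (L @ N # R)"
    using ex[of \<alpha> \<beta>] assms by blast
  obtain L' R' where LR': "stack_sort L' = \<alpha>'" "stack_sort (L' @ N # R') = \<alpha> @ \<beta> @ [N]" "distinct (L' @ N # R')"
    using ex[of \<alpha>' \<beta>'] assms by metis
  have "L @ N # R = L' @ N # R'" using usorted_unique[OF assms(5)] LR LR' by blast
  then have "L = L'" using LR(3) by (subst (asm) append_Cons_eq_iff) auto
  then show ?thesis using LR LR' by simp
qed

lemma card_usorted_words:
  assumes "finite S" "l \<in> S"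
  shows "card (usorted_words S l) = usorted_count (card {x\<in>S. x < l}) (card {x\<in>S. l < x})"
proof -
  define f where "f x = card {y\<in>S. y < x}" for x
  have f: "strict_mono_on S f"
  proof (rule strict_mono_onI)
    fix x y assume "x \<in> S" "y \<in> S" "x < y"
    then show "f x < f y" unfolding f_def using assms(1) by (intro psubset_card_mono) auto
  qed
  have "f ` S \<subseteq> {..<card S}"
    unfolding f_def using assms(1) by (auto intro!: psubset_card_mono)
  moreover have "card (f ` S) = card S" using f strict_mono_on_imp_inj_on card_image by blast
  ultimately have "f ` S = {..<card S}" by (simp add: card_subset_eq)
  then show ?thesis
    using card_usorted_words_image[OF f assms(2)] card_split_at[OF assms]
    by (simp add: usorted_count_def f_def lessThan_Suc_atMost)
qed

section \<open>The quadratic recursion for the counts\<close>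

lemma sum_Pow_card:
  fixes F :: "nat \<Rightarrow> 'a :: comm_semiring_1"
  assumes "finite S"
  shows "(\<Sum>X\<in>Pow S. F (card X)) = (\<Sum>i\<le>card S. of_nat (card S choose i) * F i)"
proof -
  have "(\<Sum>X\<in>Pow S. F (card X)) = (\<Sum>i\<le>card S. \<Sum>X\<in>{X\<in>Pow S. card X = i}. F (card X))"
    using assms by (intro sum.group[symmetric]) (auto intro: card_mono)
  also have "\<dots> = (\<Sum>i\<le>card S. of_nat (card S choose i) * F i)"
    using assms by (intro sum.cong) (auto simp: n_subsets[symmetric])
  finally show ?thesis .
qed

lemma sum_subsets_containing:
  fixes F :: "nat \<Rightarrow> nat \<Rightarrow> 'a :: comm_semiring_1"
  assumes "p < m"
  shows "(\<Sum>A | A \<subseteq> {..<m} \<and> p \<in> A. F (card {x\<in>A. x < p}) (card {x\<in>A. p < x})) =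
    (\<Sum>i\<le>p. \<Sum>j\<le>m - Suc p. of_nat (p choose i) * of_nat (m - Suc p choose j) * F i j)"
proof -
  have "(\<Sum>A | A \<subseteq> {..<m} \<and> p \<in> A. F (card {x\<in>A. x < p}) (card {x\<in>A. p < x})) =
    (\<Sum>(X, Y)\<in>Pow {..<p} \<times> Pow {p<..<m}. F (card X) (card Y))"
    by (rule sum.reindex_bij_witness[of _ "\<lambda>(X, Y). X \<union> {p} \<union> Y" "\<lambda>A. ({x\<in>A. x < p}, {x\<in>A. p < x})"])
       (use assms in \<open>auto intro!: arg_cong[of _ _ card]\<close>)
  also have "\<dots> = (\<Sum>X\<in>Pow {..<p}. \<Sum>Y\<in>Pow {p<..<m}. F (card X) (card Y))"
    by (simp add: sum.cartesian_product)
  also have "\<dots> = (\<Sum>i\<le>p. of_nat (p choose i) * (\<Sum>j\<le>m - Suc p. of_nat (m - Suc p choose j) * F i j))"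
    using sum_Pow_card[of "{p<..<m}" "F _"] sum_Pow_card[of "{..<p}" "\<lambda>i. \<Sum>Y\<in>Pow {p<..<m}. F i (card Y)"]
    by simp
  finally show ?thesis by (simp add: sum_distrib_left mult_ac)
qed

text \<open>With no letter above it, the first letter is the largest and hence also the
  last.\<close>

lemma usorted_count_0: "usorted_count p 0 = (if p = 0 then 1 else 0)"
proof -
  have sub: "w = [p] \<and> p = 0" if "w \<in> usorted_words {..p} p" for w
  proof -
    have w: "usorted w" "set w = {..p}" "hd w = p" using that by (simp_all add: usorted_words_def)
    have "last w = p" using usorted_last[OF w(1)] Max_eqI[of "{..p}" p] by (simp add: w(2))
    moreover obtain x xs where xs: "w = x # xs" using usorted_nonempty[OF w(1)] by (cases w) auto
    moreover have "x = p" using w(3) xs by simp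
    moreover have "xs = []"
    proof (rule ccontr)
      assume "xs \<noteq> []"
      then have "p \<in> set xs" using \<open>last w = p\<close> xs last_in_set by fastforce
      then show False using usorted_distinct[OF w(1)] xs \<open>x = p\<close> by simp
    qed
    ultimately have "w = [p]" by simp
    moreover from this have "{..p} = {p}" using w(2) by simp
    then have "p = 0" by (metis atMost_iff le0 singletonD)
    ultimately show ?thesis by blast
  qed
  show ?thesis
  proof (cases "p = 0")
    case True
    have "[0] \<in> usorted_words {..0} 0" by (simp add: usorted_words_def usorted_single)
    then have "usorted_words {..0} 0 = {[0]}" using sub True by blast
    then show ?thesis using True by (simp add: usorted_count_def)
  next
    case False
    then have "usorted_words {..p} p = {}" using sub by blast
    then show ?thesis using False by (simp add: usorted_count_def)
  qed
qed

text \<open>The descent condition depends only on the letters \<open>A\<close> of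
  \<open>\<alpha>\<close> and the first letter \<open>l\<close> of \<open>\<beta>\<close>. Once
  these are fixed, \<open>\<alpha>\<close> and \<open>\<beta>\<close> vary independently. As
  \<open>p < m\<close>, the word is not a single letter.\<close>

lemma card_usorted_words_join:
  "card (usorted_words {..<Suc m} p) =
     (\<Sum>A | A \<subseteq> {..<m} \<and> p \<in> A. \<Sum>l | l \<in> {..<m} - A \<and> l < Max A.
        card (usorted_words A p) * card (usorted_words ({..<m} - A) l))"
  if "p < m"
proof -
  define I where "I = Sigma {A. A \<subseteq> {..<m} \<and> p \<in> A} (\<lambda>A. {l. l \<in> {..<m} - A \<and> l < Max A})"
  define B where "B = (\<lambda>(A, l). usorted_words A p \<times> usorted_words ({..<m} - A) l)"
  have key: "x = (set (fst z), hd (snd z))" if "z \<in> B x" for x z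
  proof -
    obtain A l \<alpha> \<beta> where "x = (A, l)" "z = (\<alpha>, \<beta>)" by (cases x, cases z)
    then show ?thesis using that unfolding B_def usorted_words_def by simp
  qed
  have elim: "usorted \<alpha> \<and> usorted \<beta> \<and> hd \<alpha> = p \<and> set \<alpha> \<union> set \<beta> = {..<m} \<and>
      usorted (\<alpha> @ \<beta> @ [m]) \<and> (\<forall>x\<in>set (\<alpha> @ \<beta>). x < m)"
    if mem: "(\<alpha>, \<beta>) \<in> (\<Union>x\<in>I. B x)" for \<alpha> \<beta>
  proof -
    obtain x where "x \<in> I" "(\<alpha>, \<beta>) \<in> B x" using mem by blast
    moreover obtain A l where "x = (A, l)" by (cases x)
    ultimately have x: "A \<subseteq> {..<m}" "l < Max A" "usorted \<alpha>" "usorted \<beta>" "set \<alpha> = A" "set \<beta> = {..<m} - A" "hd \<alpha> = p" "hd \<beta> = l"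
      unfolding I_def B_def usorted_words_def by simp_all
    have "set \<alpha> \<inter> set \<beta> = {}" using x(5,6) by blast
    moreover have u: "set \<alpha> \<union> set \<beta> = {..<m}" using x(1,5,6) by blast
    moreover have "\<forall>x\<in>set \<alpha> \<union> set \<beta>. x < m" unfolding u by simp
    moreover have "hd \<beta> < last \<alpha>" using x(2,5,8) usorted_last[OF x(3)] by simp
    ultimately show ?thesis using usorted_join[OF x(3,4)] x(3,4,7) by simp
  qed
  have finI: "finite I" unfolding I_def by (intro finite_SigmaI) auto
  have fin: "finite (B x)" if "x \<in> I" for x
    using that by (auto simp: I_def B_def intro!: finite_usorted_words dest: finite_subset)
  have "bij_betw (\<lambda>(\<alpha>, \<beta>). \<alpha> @ \<beta> @ [m]) (\<Union>x\<in>I. B x) (usorted_words {..<Suc m} p)"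
  proof (rule bij_betwI')
    fix x y assume xy: "x \<in> (\<Union>x\<in>I. B x)" "y \<in> (\<Union>x\<in>I. B x)"
    obtain \<alpha> \<beta> \<alpha>' \<beta>' where x: "x = (\<alpha>, \<beta>)" "y = (\<alpha>', \<beta>')" by (cases x, cases y)
    have e: "usorted \<alpha>" "usorted \<beta>" "usorted (\<alpha> @ \<beta> @ [m])" "\<forall>x\<in>set (\<alpha> @ \<beta>). x < m" "usorted \<alpha>'" "usorted \<beta>'"
      using elim[of \<alpha> \<beta>] elim[of \<alpha>' \<beta>'] xy x by blast+
    have "\<alpha> = \<alpha>' \<and> \<beta> = \<beta>'" if eq: "\<alpha> @ \<beta> @ [m] = \<alpha>' @ \<beta>' @ [m]"
    proof -
      have "\<alpha> = \<alpha>'" by (rule usorted_join_cancel[OF e(1,2,5,6,3,4) eq])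
      then show ?thesis using eq by simp
    qed
    then show "((case x of (\<alpha>, \<beta>) \<Rightarrow> \<alpha> @ \<beta> @ [m]) = (case y of (\<alpha>, \<beta>) \<Rightarrow> \<alpha> @ \<beta> @ [m])) = (x = y)"
      using x by auto
  next
    fix x assume x: "x \<in> (\<Union>x\<in>I. B x)"
    obtain \<alpha> \<beta> where xe: "x = (\<alpha>, \<beta>)" by (cases x)
    have e: "usorted \<alpha>" "hd \<alpha> = p" "set \<alpha> \<union> set \<beta> = {..<m}" "usorted (\<alpha> @ \<beta> @ [m])"
      using elim[of \<alpha> \<beta>] x xe by blast+
    have "set (\<alpha> @ \<beta> @ [m]) = {..<Suc m}" using e(3) by (auto simp: lessThan_Suc)
    then show "(case x of (\<alpha>, \<beta>) \<Rightarrow> \<alpha> @ \<beta> @ [m]) \<in> usorted_words {..<Suc m} p"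
      using e usorted_nonempty[of \<alpha>] xe unfolding usorted_words_def by simp
  next
    fix w assume w: "w \<in> usorted_words {..<Suc m} p"
    then have "usorted w" by (simp add: usorted_words_def)
    then show "\<exists>x\<in>\<Union>x\<in>I. B x. w = (case x of (\<alpha>, \<beta>) \<Rightarrow> \<alpha> @ \<beta> @ [m])"
    proof cases
      case (usorted_single N)
      then have "{N} = {..<Suc m}" "N = p" using w by (auto simp: usorted_words_def)
      then have "m = p" by (metis lessThan_iff lessI singletonD)
      then show ?thesis using that by simp
    next
      case (usorted_join \<alpha> \<beta> N)
      have s: "insert N (set \<alpha> \<union> set \<beta>) = {..<Suc m}" using usorted_join w by (auto simp: usorted_words_def)
      then have "N < Suc m" "m = N \<or> m \<in> set \<alpha> \<union> set \<beta>" by blast+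
      moreover have "m < N" if "m \<in> set \<alpha> \<union> set \<beta>" using usorted_join(6) that by blast
      ultimately have "N = m" by linarith
      have "N \<notin> set \<alpha> \<union> set \<beta>" using usorted_join(6) by (meson less_irrefl)
      then have "set \<alpha> \<union> set \<beta> = {..<Suc m} - {N}" unfolding s[symmetric] by simp
      then have u: "set \<alpha> \<union> set \<beta> = {..<m}" unfolding \<open>N = m\<close> lessThan_Suc by simp
      then have \<alpha>: "set \<alpha> \<subseteq> {..<m}" and \<beta>: "set \<beta> = {..<m} - set \<alpha>" using usorted_join(5) by blast+
      have ne: "\<alpha> \<noteq> []" "\<beta> \<noteq> []" using usorted_join(2,3) usorted_nonempty by blast+
      have p: "hd \<alpha> = p" using w ne usorted_join(1) by (simp add: usorted_words_def)
      have "hd \<beta> < Max (set \<alpha>)" using usorted_join(2,4) by (simp add: usorted_last)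
      moreover have "hd \<beta> \<in> {..<m} - set \<alpha>" using \<beta> hd_in_set[OF ne(2)] by simp
      moreover have "p \<in> set \<alpha>" using p hd_in_set[OF ne(1)] by simp
      ultimately have "(set \<alpha>, hd \<beta>) \<in> I" using \<alpha> by (simp add: I_def)
      moreover have "(\<alpha>, \<beta>) \<in> B (set \<alpha>, hd \<beta>)"
        using usorted_join(2,3) p \<beta> by (simp add: B_def usorted_words_def)
      ultimately have "(\<alpha>, \<beta>) \<in> (\<Union>x\<in>I. B x)" by blast
      then show ?thesis using usorted_join(1) \<open>N = m\<close> by (intro bexI[of _ "(\<alpha>, \<beta>)"]) simp
    qed
  qed
  then have "card (usorted_words {..<Suc m} p) = card (\<Union>x\<in>I. B x)" by (simp add: bij_betw_same_card)
  also have "\<dots> = (\<Sum>x\<in>I. card (B x))"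
    using finI fin key by (intro card_UN_disjoint) blast+
  also have "\<dots> = (\<Sum>(A, l)\<in>I. card (usorted_words A p) * card (usorted_words ({..<m} - A) l))"
    by (intro sum.cong) (auto simp: B_def card_cartesian_product)
  also have "\<dots> = (\<Sum>A | A \<subseteq> {..<m} \<and> p \<in> A. \<Sum>l | l \<in> {..<m} - A \<and> l < Max A.
        card (usorted_words A p) * card (usorted_words ({..<m} - A) l))"
    unfolding I_def by (intro sum.Sigma[symmetric]) auto
  finally show ?thesis .
qed

lemma usorted_count_total:
  assumes "finite S"
  shows "(\<Sum>l\<in>S. card (usorted_words S l)) = usorted_total (card S)"
proof -
  define f where "f x = card {y\<in>S. y < x}" for x
  have f: "strict_mono_on S f"
  proof (rule strict_mono_onI)
    fix x y assume "x \<in> S" "y \<in> S" "x < y"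
    then show "f x < f y" unfolding f_def using assms(1) by (intro psubset_card_mono) auto
  qed
  have img: "f ` S = {..<card S}"
  proof -
    have "f ` S \<subseteq> {..<card S}"
      unfolding f_def using assms(1) by (auto intro!: psubset_card_mono)
    moreover have "card (f ` S) = card S" using f strict_mono_on_imp_inj_on card_image by blast
    ultimately show ?thesis by (simp add: card_subset_eq)
  qed
  have "usorted_total (card S) = (\<Sum>i\<in>f ` S. usorted_count i (card S - 1 - i))"
    by (simp add: usorted_total_def img)
  also have "\<dots> = (\<Sum>l\<in>S. usorted_count (f l) (card S - 1 - f l))"
    using f strict_mono_on_imp_inj_on by (subst sum.reindex) auto
  also have "\<dots> = (\<Sum>l\<in>S. card (usorted_words S l))"
  proof (intro sum.cong refl)
    fix l assume l: "l \<in> S"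
    have "card (usorted_words S l) = card (usorted_words {..<card S} (f l))"
      using card_usorted_words_image[OF f l] img by simp
    moreover have "f l < card S" using l img by auto
    then have "{..<card S} = {..f l + (card S - 1 - f l)}" by auto
    ultimately show "usorted_count (f l) (card S - 1 - f l) = card (usorted_words S l)"
      by (simp add: usorted_count_def)
  qed
  finally show ?thesis by simp
qed

text \<open>The sum over every possible first letter \<open>l\<close> of \<open>\<beta>\<close> is a
  total; from it the choices with \<open>l\<close> above all of \<open>\<alpha>\<close> are
  subtracted. In the second sum \<open>l = p + a + 1\<close>: there are \<open>a\<close> letters
  strictly between \<open>p\<close> and \<open>l\<close>, and the \<open>q - 1 - a\<close> letters
  above \<open>l\<close> all belong to \<open>\<beta>\<close>.\<close>

lemma usorted_count_Suc:
  "int (usorted_count p (Suc q)) =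
     (\<Sum>i\<le>p. \<Sum>j\<le>q. int (p choose i) * int (q choose j) * int (usorted_count i j) * int (usorted_total (p + q - i - j)))
   - (\<Sum>a<q. \<Sum>i\<le>p. \<Sum>j\<le>a. int (p choose i) * int (a choose j) * int (usorted_count i j) *
        int (usorted_count (p + a - i - j) (q - 1 - a)))"
proof -
  define m where "m = Suc (p + q)"
  define \<A> where "\<A> = {A. A \<subseteq> {..<m} \<and> p \<in> A}"
  define F where "F A l = int (card (usorted_words A p)) * int (card (usorted_words ({..<m} - A) l))" for A l
  have pm: "p < m" by (simp add: m_def)
  have finA: "finite A" if "A \<in> \<A>" for A using that by (auto simp: \<A>_def dest: finite_subset)
  have cardA: "card (usorted_words A p) = usorted_count (card {x\<in>A. x < p}) (card {x\<in>A. p < x})" if "A \<in> \<A>" for A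
    using that finA[OF that] by (intro card_usorted_words) (auto simp: \<A>_def)
  have card_eq: "card A = Suc (card {x\<in>A. x < p} + card {x\<in>A. p < x})" if "A \<in> \<A>" for A
    using card_split_at finA that by (auto simp: \<A>_def)
  have "{..p + Suc q} = {..<Suc m}" by (auto simp: m_def)
  then have "int (usorted_count p (Suc q)) = (\<Sum>A\<in>\<A>. \<Sum>l | l \<in> {..<m} - A \<and> l < Max A. F A l)"
    using card_usorted_words_join[OF pm] by (simp add: usorted_count_def F_def \<A>_def)
  also have "\<dots> = (\<Sum>A\<in>\<A>. (\<Sum>l\<in>{..<m} - A. F A l) - (\<Sum>l | l \<in> {..<m} - A \<and> Max A < l. F A l))"
  proof (intro sum.cong refl)
    fix A assume A: "A \<in> \<A>"
    then have "Max A \<in> A" using finA by (intro Max_in) (auto simp: \<A>_def)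
    then have "{..<m} - A = {l. l \<in> {..<m} - A \<and> l < Max A} \<union> {l. l \<in> {..<m} - A \<and> Max A < l}"
      by (auto simp: not_less dest: le_neq_implies_less)
    then have "(\<Sum>l\<in>{..<m} - A. F A l) =
      (\<Sum>l\<in>{l. l \<in> {..<m} - A \<and> l < Max A} \<union> {l. l \<in> {..<m} - A \<and> Max A < l}. F A l)"
      by (rule arg_cong)
    also have "\<dots> = (\<Sum>l | l \<in> {..<m} - A \<and> l < Max A. F A l) + (\<Sum>l | l \<in> {..<m} - A \<and> Max A < l. F A l)"
      by (rule sum.union_disjoint) auto
    finally show "(\<Sum>l | l \<in> {..<m} - A \<and> l < Max A. F A l) =
      (\<Sum>l\<in>{..<m} - A. F A l) - (\<Sum>l | l \<in> {..<m} - A \<and> Max A < l. F A l)" by simp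
  qed
  also have "\<dots> = (\<Sum>A\<in>\<A>. \<Sum>l\<in>{..<m} - A. F A l) - (\<Sum>A\<in>\<A>. \<Sum>l | l \<in> {..<m} - A \<and> Max A < l. F A l)"
    by (rule sum_subtractf)
  also have "(\<Sum>A\<in>\<A>. \<Sum>l\<in>{..<m} - A. F A l) =
    (\<Sum>A\<in>\<A>. int (usorted_count (card {x\<in>A. x < p}) (card {x\<in>A. p < x})) *
       int (usorted_total (p + q - card {x\<in>A. x < p} - card {x\<in>A. p < x})))"
  proof (intro sum.cong refl)
    fix A assume A: "A \<in> \<A>"
    have "card ({..<m} - A) = m - card A" using A finA by (subst card_Diff_subset) (auto simp: \<A>_def)
    then have "card ({..<m} - A) = p + q - card {x\<in>A. x < p} - card {x\<in>A. p < x}"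
      using card_eq[OF A] by (simp add: m_def)
    moreover have "(\<Sum>l\<in>{..<m} - A. F A l) = int (card (usorted_words A p)) * int (usorted_total (card ({..<m} - A)))"
      by (simp add: F_def sum_distrib_left[symmetric] usorted_count_total[symmetric] del: of_nat_sum flip: of_nat_sum)
    ultimately show "(\<Sum>l\<in>{..<m} - A. F A l) = int (usorted_count (card {x\<in>A. x < p}) (card {x\<in>A. p < x})) *
       int (usorted_total (p + q - card {x\<in>A. x < p} - card {x\<in>A. p < x}))"
      using cardA[OF A] by simp
  qed
  also have "\<dots> = (\<Sum>i\<le>p. \<Sum>j\<le>q. int (p choose i) * int (q choose j) *
      (int (usorted_count i j) * int (usorted_total (p + q - i - j))))"
    unfolding \<A>_def using sum_subsets_containing[OF pm, of "\<lambda>i j. int (usorted_count i j) * int (usorted_total (p + q - i - j))"]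
    by (simp add: m_def)
  also have "(\<Sum>A\<in>\<A>. \<Sum>l | l \<in> {..<m} - A \<and> Max A < l. F A l) =
    (\<Sum>l\<in>{p<..<m}. \<Sum>A | A \<subseteq> {..<l} \<and> p \<in> A. F A l)"
  proof -
    \<comment> \<open>In this form \<open>l\<close> can be chosen before \<open>A\<close>.\<close>
    have Max: "Max A < l \<longleftrightarrow> A \<subseteq> {..<l}" if "A \<in> \<A>" for A l
      using finA[OF that] that by (subst Max_less_iff) (auto simp: \<A>_def)
    have "(\<Sum>A\<in>\<A>. \<Sum>l | l \<in> {..<m} - A \<and> Max A < l. F A l) =
      (\<Sum>(A, l)\<in>Sigma \<A> (\<lambda>A. {l. l \<in> {..<m} - A \<and> Max A < l}). F A l)"
      by (intro sum.Sigma) (auto simp: \<A>_def)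
    also have "\<dots> = (\<Sum>(l, A)\<in>Sigma {p<..<m} (\<lambda>l. {A. A \<subseteq> {..<l} \<and> p \<in> A}). F A l)"
    proof (rule sum.reindex_bij_witness[of _ "\<lambda>(l, A). (A, l)" "\<lambda>(A, l). (l, A)"], goal_cases)
      case (2 x)
      then show ?case using Max by (auto simp: \<A>_def)
    next
      case (4 x)
      then obtain l A where x: "x = (l, A)" "p < l" "l < m" "A \<subseteq> {..<l}" "p \<in> A" by auto
      then have "A \<in> \<A>" by (auto simp: \<A>_def)
      then show ?case using Max[of A l] x by auto
    qed auto
    also have "\<dots> = (\<Sum>l\<in>{p<..<m}. \<Sum>A | A \<subseteq> {..<l} \<and> p \<in> A. F A l)"
      by (intro sum.Sigma[symmetric]) auto
    finally show ?thesis .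
  qed
  also have "\<dots> = (\<Sum>a<q. \<Sum>A | A \<subseteq> {..<Suc (p + a)} \<and> p \<in> A. F A (Suc (p + a)))"
    by (rule sum.reindex_bij_witness[of _ "\<lambda>a. Suc (p + a)" "\<lambda>l. l - Suc p"]) (auto simp: m_def)
  also have "\<dots> = (\<Sum>a<q. \<Sum>i\<le>p. \<Sum>j\<le>a. int (p choose i) * int (a choose j) * (int (usorted_count i j) *
        int (usorted_count (p + a - i - j) (q - 1 - a))))"
  proof (intro sum.cong refl)
    fix a assume a: "a \<in> {..<q}"
    define l where "l = Suc (p + a)"
    have "(\<Sum>A | A \<subseteq> {..<l} \<and> p \<in> A. F A l) = (\<Sum>A | A \<subseteq> {..<l} \<and> p \<in> A.
       int (usorted_count (card {x\<in>A. x < p}) (card {x\<in>A. p < x})) *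
       int (usorted_count (p + a - card {x\<in>A. x < p} - card {x\<in>A. p < x}) (q - 1 - a)))"
    proof (intro sum.cong refl)
      fix A assume "A \<in> {A. A \<subseteq> {..<l} \<and> p \<in> A}"
      then have A: "A \<subseteq> {..<l}" "p \<in> A" by auto
      have A': "A \<in> \<A>" using A a by (auto simp: \<A>_def l_def m_def)
      have lm: "l < m" using a by (simp add: l_def m_def)
      have "l \<notin> A" using A by auto
      have "{x \<in> {..<m} - A. x < l} = {..<l} - A" using lm by auto
      then have "card {x \<in> {..<m} - A. x < l} = l - card A"
        using A finA[OF A'] by (simp add: card_Diff_subset)
      moreover have "{x \<in> {..<m} - A. l < x} = {l<..<m}" using A by auto
      ultimately have "card (usorted_words ({..<m} - A) l) = usorted_count (l - card A) (m - Suc l)"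
        using card_usorted_words[of "{..<m} - A" l] lm \<open>l \<notin> A\<close> by simp
      moreover have "l - card A = p + a - card {x\<in>A. x < p} - card {x\<in>A. p < x}" "m - Suc l = q - 1 - a"
        using card_eq[OF A'] a by (auto simp: l_def m_def)
      ultimately show "F A l = int (usorted_count (card {x\<in>A. x < p}) (card {x\<in>A. p < x})) *
       int (usorted_count (p + a - card {x\<in>A. x < p} - card {x\<in>A. p < x}) (q - 1 - a))"
        using cardA[OF A'] by (simp add: F_def)
    qed
    also have "\<dots> = (\<Sum>i\<le>p. \<Sum>j\<le>a. int (p choose i) * int (a choose j) * (int (usorted_count i j) *
        int (usorted_count (p + a - i - j) (q - 1 - a))))"
      using sum_subsets_containing[of p l "\<lambda>i j. int (usorted_count i j) * int (usorted_count (p + a - i - j) (q - 1 - a))"]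
      by (simp add: l_def)
    finally show "(\<Sum>A | A \<subseteq> {..<Suc (p + a)} \<and> p \<in> A. F A (Suc (p + a))) = (\<Sum>i\<le>p. \<Sum>j\<le>a. int (p choose i) * int (a choose j) * (int (usorted_count i j) *
        int (usorted_count (p + a - i - j) (q - 1 - a))))" by (simp add: l_def)
  qed
  finally show ?thesis by (simp add: mult.assoc)
qed

lemma uniq_sorted_count_eq:
  assumes "1 \<le> l" "l \<le> 2 * k + 1"
  shows "uniq_sorted_count (k + 1) l = usorted_count (l - 1) (2 * k + 1 - l)"
proof -
  have "{p. uniquely_sorted (2 * (k + 1) - 1) p \<and> hd p = l} = usorted_words {1..2 * k + 1} l"
    by (auto simp: uniquely_sorted_iff_usorted usorted_words_def)
  then have "uniq_sorted_count (k + 1) l = usorted_count (card {x\<in>{1..2 * k + 1}. x < l}) (card {x\<in>{1..2 * k + 1}. l < x})"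
    unfolding uniq_sorted_count_def using assms by (subst card_usorted_words[symmetric]) auto
  moreover have "{x\<in>{1..2 * k + 1}. x < l} = {1..<l}" "{x\<in>{1..2 * k + 1}. l < x} = {l<..2 * k + 1}"
    using assms by auto
  ultimately show ?thesis by simp
qed

unbundle fps_syntax

subsection \<open>Power series in two variables\<close>

text \<open>
  A series in \<open>t\<close> and \<open>s\<close> is a power series in \<open>t\<close> whose coefficients are power series in \<open>s\<close>;
  \<open>lift_sum f\<close> stands for \<open>f(t + s)\<close>.
\<close>

definition lift_sum :: "'a :: comm_ring_1 fps \<Rightarrow> 'a fps fps" where
  "lift_sum f = Abs_fps (\<lambda>p. Abs_fps (\<lambda>q. of_nat (p + q choose p) * fps_nth f (p + q)))"

definition lift_t :: "'a :: comm_ring_1 fps \<Rightarrow> 'a fps fps" where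
  "lift_t f = Abs_fps (\<lambda>p. fps_const (fps_nth f p))"

abbreviation lift_s :: "'a :: comm_ring_1 fps \<Rightarrow> 'a fps fps" where
  "lift_s \<equiv> fps_const"

definition deriv_s :: "'a :: comm_ring_1 fps fps \<Rightarrow> 'a fps fps" where
  "deriv_s F = Abs_fps (\<lambda>p. fps_deriv (fps_nth F p))"

lemma lift_sum_nth [simp]: "lift_sum f $ p $ q = of_nat (p + q choose p) * f $ (p + q)"
  by (simp add: lift_sum_def)

lemma lift_sum_nth_0 [simp]: "lift_sum f $ 0 = f"
  by (rule fps_ext) simp

lemma lift_t_nth [simp]: "lift_t f $ p = fps_const (f $ p)"
  by (simp add: lift_t_def)

lemma deriv_s_nth [simp]: "deriv_s F $ p = fps_deriv (F $ p)"
  by (simp add: deriv_s_def)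

lemma fps2_mult_nth: "(F * G) $ p $ q = (\<Sum>i\<le>p. \<Sum>j\<le>q. F $ i $ j * G $ (p - i) $ (q - j))"
  by (simp add: fps_mult_nth fps_sum_nth atLeast0AtMost)

lemma lift_t_mult_nth: "(lift_t f * F) $ p $ q = (\<Sum>i\<le>p. f $ i * F $ (p - i) $ q)"
  by (simp add: fps_mult_nth[of "lift_t f"] fps_sum_nth atLeast0AtMost)

lemma lift_s_mult_nth: "(lift_s f * F) $ p $ q = (\<Sum>j\<le>q. f $ j * F $ p $ (q - j))"
proof -
  have "(lift_s f * F) $ p = f * F $ p" by simp
  then show ?thesis by (simp only: fps_mult_nth atLeast0AtMost)
qed

lemma lift_sum_mult: "lift_sum (f * g) = lift_sum f * lift_sum g"
proof (intro fps_ext)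
  fix p q
  define T where "T i j = of_nat (i + j choose i) * of_nat (p + q - (i + j) choose (p - i)) *
    (f $ (i + j) * g $ (p + q - (i + j)))" for i j
  \<comment> \<open>Vandermonde's identity; the side conditions only drop terms in which a binomial
    coefficient vanishes.\<close>
  have V: "(\<Sum>i | i \<le> p \<and> i \<le> n \<and> n - i \<le> q. (n choose i) * (p + q - n choose (p - i))) = (p + q choose p)"
    if "n \<le> p + q" for n
  proof -
    have "(\<Sum>i | i \<le> p \<and> i \<le> n \<and> n - i \<le> q. (n choose i) * (p + q - n choose (p - i))) =
      (\<Sum>i\<le>p. (n choose i) * (p + q - n choose (p - i)))"
      by (rule sum.mono_neutral_left) (use that in \<open>auto simp: not_le\<close>)
    also have "\<dots> = (n + (p + q - n) choose p)" by (rule vandermonde)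
    finally show ?thesis using that by simp
  qed
  have "(lift_sum f * lift_sum g) $ p $ q = (\<Sum>(i, j)\<in>{..p} \<times> {..q}. T i j)"
    unfolding fps2_mult_nth sum.cartesian_product T_def
    by (intro sum.cong) (auto simp: mult_ac)
  also have "\<dots> = (\<Sum>(n, i)\<in>Sigma {..p + q} (\<lambda>n. {i. i \<le> p \<and> i \<le> n \<and> n - i \<le> q}). T i (n - i))"
    by (rule sum.reindex_bij_witness[of _ "\<lambda>(n, i). (i, n - i)" "\<lambda>(i, j). (i + j, i)"]) auto
  also have "\<dots> = (\<Sum>n\<le>p + q. \<Sum>i | i \<le> p \<and> i \<le> n \<and> n - i \<le> q. T i (n - i))"
    by (intro sum.Sigma[symmetric]) auto
  also have "\<dots> = (\<Sum>n\<le>p + q. of_nat (p + q choose p) * (f $ n * g $ (p + q - n)))"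
  proof (intro sum.cong refl)
    fix n assume "n \<in> {..p + q}"
    then have n: "n \<le> p + q" by simp
    have "(\<Sum>i | i \<le> p \<and> i \<le> n \<and> n - i \<le> q. T i (n - i)) =
      of_nat (\<Sum>i | i \<le> p \<and> i \<le> n \<and> n - i \<le> q. (n choose i) * (p + q - n choose (p - i))) * (f $ n * g $ (p + q - n))"
      unfolding of_nat_sum sum_distrib_right T_def by (intro sum.cong) auto
    then show "(\<Sum>i | i \<le> p \<and> i \<le> n \<and> n - i \<le> q. T i (n - i)) = of_nat (p + q choose p) * (f $ n * g $ (p + q - n))"
      by (simp only: V[OF n])
  qed
  also have "\<dots> = lift_sum (f * g) $ p $ q"
    by (simp add: fps_mult_nth sum_distrib_left atLeast0AtMost)
  finally show "lift_sum (f * g) $ p $ q = (lift_sum f * lift_sum g) $ p $ q" ..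
qed

lemma lift_sum_1 [simp]: "lift_sum 1 = 1"
  by (intro fps_ext) simp

lemma lift_t_mult: "lift_t (f * g) = lift_t f * lift_t g"
  by (rule fps_ext, rule fps_ext) (simp add: fps_mult_nth fps_sum_nth)

lemma lift_t_minus: "lift_t (- f) = - lift_t f"
  by (rule fps_ext, rule fps_ext) simp

lemma fps_deriv_lift_t: "fps_deriv (lift_t f) = lift_t (fps_deriv f)"
  by (rule fps_ext, rule fps_ext) (simp flip: of_nat_Suc fps_const_mult add: fps_of_nat[symmetric])

lemma Suc_times_choose_add: "Suc p * (Suc p + q choose Suc p) = Suc (p + q) * (p + q choose p)"
  using Suc_times_binomial_eq[of "p + q" p] by (simp add: mult.commute)

lemma fps_deriv_lift_sum: "fps_deriv (lift_sum f) = lift_sum (fps_deriv f)"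
proof (intro fps_ext)
  fix p q
  have "fps_deriv (lift_sum f) $ p $ q = of_nat (Suc p) * (of_nat (Suc p + q choose Suc p) * f $ (Suc (p + q)))"
    by (simp add: fps_of_nat[symmetric] del: of_nat_Suc binomial_Suc_Suc)
  also have "\<dots> = of_nat (Suc p * (Suc p + q choose Suc p)) * f $ (Suc (p + q))"
    by (simp only: of_nat_mult mult.assoc)
  also have "\<dots> = lift_sum (fps_deriv f) $ p $ q"
    unfolding Suc_times_choose_add by (simp add: algebra_simps)
  finally show "fps_deriv (lift_sum f) $ p $ q = lift_sum (fps_deriv f) $ p $ q" .
qed

lemma deriv_s_lift_sum: "deriv_s (lift_sum f) = lift_sum (fps_deriv f)"
proof (intro fps_ext)
  fix p q
  have "Suc q * (p + Suc q choose p) = Suc (p + q) * (p + q choose p)"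
    using Suc_times_choose_add[of q p] binomial_symmetric[of p "p + q"] binomial_symmetric[of p "p + Suc q"]
    by (simp add: add.commute del: binomial_Suc_Suc mult_Suc)
  note binom = this
  have "deriv_s (lift_sum f) $ p $ q = of_nat (Suc q) * (of_nat (p + Suc q choose p) * f $ (Suc (p + q)))"
    by (simp del: of_nat_Suc binomial_Suc_Suc)
  also have "\<dots> = of_nat (Suc q * (p + Suc q choose p)) * f $ (Suc (p + q))"
    by (simp only: of_nat_mult mult.assoc)
  also have "\<dots> = lift_sum (fps_deriv f) $ p $ q"
    unfolding binom by (simp add: algebra_simps)
  finally show "deriv_s (lift_sum f) $ p $ q = lift_sum (fps_deriv f) $ p $ q" .
qed

lemma deriv_s_mult: "deriv_s (F * G) = deriv_s F * G + F * deriv_s G"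
  by (rule fps_ext) (simp add: fps_mult_nth fps_deriv_sum sum.distrib add.commute)

lemma deriv_s_lift_t [simp]: "deriv_s (lift_t f) = 0"
  by (rule fps_ext) simp

lemma deriv_s_lift_s: "deriv_s (lift_s f) = lift_s (fps_deriv f)"
  by (rule fps_ext) simp

subsection \<open>Catalan numbers\<close>

text \<open>The series \<open>f\<close> is the square root of \<open>1 - 4 X\<close>. To avoid
  roots, the differential equation \<open>(1 - 4 X) f' = - 2 f\<close> is read off from the
  quotients of consecutive Catalan numbers. It gives \<open>(1 - 4 X) F' = - 4 F\<close> for
  \<open>F = f * f\<close>, so that \<open>F\<close> has no coefficients beyond degree 1, and
  expanding the square yields the recursion.\<close>

lemma catalan_convolution:
  fixes c :: "nat \<Rightarrow> 'a :: field_char_0"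
  defines "c \<equiv> \<lambda>n. fact (2 * n) / (fact n * fact (Suc n))"
  shows "(\<Sum>j\<le>m. c j * c (m - j)) = c (Suc m)"
proof -
  define C where "C = Abs_fps c"
  define f where "f = 1 - 2 * fps_X * C"
  have c0: "c 0 = 1" by (simp add: c_def)
  have cS: "of_nat (Suc (Suc n)) * c (Suc n) = 2 * of_nat (Suc (2 * n)) * c n" for n
  proof -
    define x y z :: 'a where "x = of_nat (Suc n)" and "y = of_nat (Suc (Suc n))" and "z = of_nat (Suc (2 * n))"
    have nz: "x \<noteq> 0" "y \<noteq> 0" unfolding x_def y_def of_nat_eq_0_iff by simp_all
    have "2 * Suc n = Suc (Suc (2 * n))" by simp
    moreover have "of_nat (Suc (Suc (2 * n))) = 2 * x" by (simp add: x_def)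
    ultimately have f1: "fact (2 * Suc n) = 2 * x * (z * (fact (2 * n) :: 'a))"
      by (simp only: fact_Suc z_def)
    have f2: "fact (Suc (Suc n)) = y * (fact (Suc n) :: 'a)" "fact (Suc n) = x * (fact n :: 'a)"
      by (simp_all only: fact_Suc x_def y_def)
    show ?thesis unfolding c_def x_def[symmetric] y_def[symmetric] z_def[symmetric] f1 f2
      using nz by (simp add: divide_simps)
  qed
  have fn: "f $ 0 = 1" "f $ Suc n = - 2 * c n" for n
    by (simp_all add: f_def C_def mult.assoc numeral_fps_const)
  have "fps_deriv f - 4 * fps_X * fps_deriv f = - 2 * f"
  proof (rule fps_ext)
    fix n
    show "(fps_deriv f - 4 * fps_X * fps_deriv f) $ n = (- 2 * f) $ n"
    proof (cases n)
      case 0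
      then show ?thesis by (simp add: fn c0 mult.assoc numeral_fps_const)
    next
      case (Suc k)
      have "(fps_deriv f - 4 * fps_X * fps_deriv f) $ n = - 2 * (of_nat (Suc (Suc k)) * c (Suc k)) + 8 * of_nat (Suc k) * c k"
        by (simp add: Suc fn mult.assoc numeral_fps_const del: of_nat_Suc)
      also have "\<dots> = 4 * c k" unfolding cS by (simp add: algebra_simps)
      also have "\<dots> = (- 2 * f) $ n" by (simp add: Suc fn mult.assoc numeral_fps_const)
      finally show ?thesis .
    qed
  qed
  note ode_f = this
  define F where "F = f * f"
  have "fps_deriv F - 4 * fps_X * fps_deriv F = 2 * f * (fps_deriv f - 4 * fps_X * fps_deriv f)"
    by (simp add: F_def algebra_simps)
  also have "\<dots> = - 4 * F" unfolding ode_f F_def by simp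
  finally have ode: "fps_deriv F - 4 * (fps_X * fps_deriv F) = - 4 * F" by (simp only: mult.assoc)
  define e where "e n = F $ n" for n
  \<comment> \<open>The factor \<open>n - 1\<close> makes \<open>e 2\<close> vanish, and with it all
    later coefficients.\<close>
  have eS: "of_nat (Suc n) * e (Suc n) = 4 * (of_nat n - 1) * e n" for n
  proof -
    have "(fps_deriv F - 4 * (fps_X * fps_deriv F)) $ n = (- 4 * F) $ n" by (simp only: ode)
    moreover have "(- 4 * F) $ n = - 4 * e n" by (simp add: e_def numeral_fps_const)
    moreover have "(fps_deriv F - 4 * (fps_X * fps_deriv F)) $ n = of_nat (Suc n) * e (Suc n) - 4 * (of_nat n * e n)"
      by (cases n) (simp_all add: e_def numeral_fps_const del: of_nat_Suc)
    ultimately have "of_nat (Suc n) * e (Suc n) - 4 * (of_nat n * e n) = - 4 * e n" by (simp only:)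
    then have "of_nat (Suc n) * e (Suc n) = 4 * (of_nat n * e n) - 4 * e n"
      by (simp only: diff_eq_eq) (simp add: algebra_simps)
    then show ?thesis by (simp only: left_diff_distrib right_diff_distrib mult_1 mult.assoc)
  qed
  have e2: "e (Suc (Suc n)) = 0" for n
  proof (induction n)
    case 0
    show ?case using eS[of 1] by simp
  next
    case (Suc n)
    then show ?case using eS[of "Suc (Suc n)"] by (simp del: of_nat_Suc)
  qed
  have "F = 1 - 4 * fps_X * C + 4 * fps_X * (fps_X * (C * C))"
    by (simp add: F_def f_def algebra_simps)
  then have "e (Suc (Suc m)) = - 4 * c (Suc m) + 4 * (C * C) $ m"
    by (simp add: e_def mult.assoc numeral_fps_const C_def)
  then show ?thesis by (simp add: e2 C_def fps_mult_nth atLeast0AtMost)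
qed

subsection \<open>The generating function\<close>

definition bessel_coeff :: "nat \<Rightarrow> real" where
  "bessel_coeff a = (- 1) ^ a / (fact a * fact (Suc a))"

definition bessel :: "real fps" where
  "bessel = Abs_fps (\<lambda>n. if even n then bessel_coeff (n div 2) else 0)"

definition bessel_inv :: "real fps" where
  "bessel_inv = inverse bessel"

definition gf :: "real fps fps" where
  "gf = lift_t bessel * lift_s bessel * lift_sum bessel_inv"

definition gf_count :: "nat \<Rightarrow> nat \<Rightarrow> real" where
  "gf_count p q = fact p * fact q * gf $ p $ q"

text \<open>The negative logarithmic derivative of \<open>bessel\<close>. By
  \<open>gf_count_total\<close> its coefficients times factorials are the totals over all first
  letters, Lassalle's sequence 1, 1, 5, 56, ... at odd indices.\<close>

definition gf_log :: "real fps" where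
  "gf_log = - fps_deriv bessel * bessel_inv"

section \<open>Identities for the Bessel series\<close>

lemma bessel_0 [simp]: "bessel $ 0 = 1" and bessel_1 [simp]: "bessel $ Suc 0 = 0"
  by (simp_all add: bessel_def bessel_coeff_def)

lemma bessel_inv_mult: "bessel * bessel_inv = 1" "bessel_inv * bessel = 1"
  by (simp_all add: bessel_inv_def inverse_mult_eq_1 inverse_mult_eq_1')

lemma bessel_cancel [simp]: "bessel * (bessel_inv * f) = f" "bessel_inv * (bessel * f) = f"
  by (simp_all only: mult.assoc[symmetric] bessel_inv_mult mult_1)

lemma deriv_bessel: "fps_deriv bessel = - gf_log * bessel"
  by (simp add: gf_log_def mult.assoc bessel_inv_mult)

lemma deriv_bessel_inv: "fps_deriv bessel_inv = gf_log * bessel_inv"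
  by (simp add: bessel_inv_def gf_log_def fps_inverse_deriv power2_eq_square mult.assoc)

text \<open>At even \<open>j\<close>, \<open>fact j * bessel $ j\<close> is a Catalan number up to
  sign, so this is the Catalan recursion. The sign alternates with \<open>j div 2\<close>, and the
  shift of the Catalan index by one becomes a shift by 2 with a change of sign.\<close>

lemma bessel_convolution:
  "(\<Sum>j\<le>r. fact j * bessel $ j * (fact (r - j) * bessel $ (r - j))) = - (fact (r + 2) * bessel $ (r + 2))"
proof -
  define c :: "nat \<Rightarrow> real" where "c = (\<lambda>n. fact (2 * n) / (fact n * fact (Suc n)))"
  have e: "fact (2 * a) * bessel $ (2 * a) = (- 1) ^ a * c a" for a
    by (simp add: bessel_def bessel_coeff_def c_def)
  have o: "bessel $ n = 0" if "odd n" for n using that by (simp add: bessel_def)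
  show ?thesis
  proof (cases "even r")
    case True
    then obtain m where r: "r = 2 * m" by auto
    have "(\<Sum>j\<le>r. fact j * bessel $ j * (fact (r - j) * bessel $ (r - j))) =
      (\<Sum>j\<in>(*) 2 ` {..m}. fact j * bessel $ j * (fact (r - j) * bessel $ (r - j)))"
      by (rule sum.mono_neutral_right) (auto simp: r o image_iff elim!: evenE intro!: o)
    also have "\<dots> = (\<Sum>a\<le>m. (- 1) ^ a * c a * ((- 1) ^ (m - a) * c (m - a)))"
      by (subst sum.reindex) (auto simp: inj_on_def r e right_diff_distrib'[symmetric] intro!: sum.cong)
    also have "\<dots> = (- 1) ^ m * (\<Sum>a\<le>m. c a * c (m - a))"
      unfolding sum_distrib_left
    proof (intro sum.cong refl)
      fix a assume "a \<in> {..m}"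
      then have "(- 1 :: real) ^ m = (- 1) ^ a * (- 1) ^ (m - a)" by (simp flip: power_add)
      then show "(- 1) ^ a * c a * ((- 1) ^ (m - a) * c (m - a)) = (- 1) ^ m * (c a * c (m - a))"
        by simp
    qed
    also have "\<dots> = (- 1) ^ m * c (Suc m)"
      using catalan_convolution[of m, where 'a = real] by (simp only: c_def)
    also have "\<dots> = - (fact (r + 2) * bessel $ (r + 2))"
      using e[of "Suc m"] by (simp add: r del: fact_Suc)
    finally show ?thesis .
  next
    case False
    have "bessel $ j = 0 \<or> bessel $ (r - j) = 0" if "j \<le> r" for j
      using o False that by (cases "odd j") auto
    then have "(\<Sum>j\<le>r. fact j * bessel $ j * (fact (r - j) * bessel $ (r - j))) = 0"
      by (intro sum.neutral) force
    then show ?thesis using o[of "r + 2"] False by simp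
  qed
qed

text \<open>Both sides count the subsets with \<open>j + l + 1\<close> elements of a chain of
  \<open>n + 1\<close> points: on the left, \<open>a\<close> is the number of points below the
  element that has exactly \<open>j\<close> chosen ones below it.\<close>

lemma sum_choose_mult_choose:
  "(\<Sum>a\<le>n. (a choose j) * (n - a choose l)) = (Suc n choose Suc (j + l))"
proof (induction n arbitrary: l)
  case 0
  then show ?case by (cases j; cases l) auto
next
  case (Suc n)
  show ?case
  proof (cases l)
    case 0
    then show ?thesis using sum_choose_upper[of j "Suc n"] by simp
  next
    case (Suc l')
    have "(\<Sum>a\<le>Suc n. (a choose j) * (Suc n - a choose l)) = (\<Sum>a\<le>n. (a choose j) * (Suc (n - a) choose Suc l'))"
      by (simp add: Suc Suc_diff_le)
    also have "\<dots> = (\<Sum>a\<le>n. (a choose j) * (n - a choose l')) + (\<Sum>a\<le>n. (a choose j) * (n - a choose Suc l'))"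
      by (simp add: algebra_simps sum.distrib)
    finally show ?thesis by (simp add: Suc.IH Suc)
  qed
qed

lemma gf_nth:
  "gf $ p $ q = (\<Sum>i\<le>p. \<Sum>j\<le>q. bessel $ i * bessel $ j *
    (of_nat (p + q - (i + j) choose (p - i)) * bessel_inv $ (p + q - (i + j))))"
proof -
  have "gf $ p $ q = (\<Sum>i\<le>p. bessel $ i * (lift_s bessel * lift_sum bessel_inv) $ (p - i) $ q)"
    unfolding gf_def mult.assoc lift_t_mult_nth ..
  also have "\<dots> = (\<Sum>i\<le>p. \<Sum>j\<le>q. bessel $ i * bessel $ j *
    (of_nat (p + q - (i + j) choose (p - i)) * bessel_inv $ (p + q - (i + j))))"
    unfolding lift_s_mult_nth sum_distrib_left by (intro sum.cong) (simp_all add: mult.assoc)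
  finally show ?thesis .
qed

lemma gf_sym: "gf $ p $ q = gf $ q $ p"
proof -
  have "(p + q - (i + j) choose (p - i)) = (q + p - (j + i) choose (q - j))" if "i \<le> p" "j \<le> q" for i j
    using binomial_symmetric[of "p - i" "p + q - (i + j)"] that by (simp add: add.commute)
  then show ?thesis
    unfolding gf_nth by (subst sum.swap, intro sum.cong refl) (simp add: add.commute mult_ac)
qed

text \<open>
  For letters in an interval, this would be the convolution \<open>bessel * bessel = - bessel'\<close> that arises on
  integrating over the first letter of \<open>\<beta>\<close>.
\<close>

lemma beta_sum:
  fixes p q :: nat
  defines "k \<equiv> \<lambda>b. bessel_inv * gf $ b"
  shows "(\<Sum>a<q. fact a * fact (q - 1 - a) / fact q * (lift_s bessel * lift_sum (k (q - 1 - a))) $ p $ a) =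
    - (lift_s (fps_deriv bessel) * lift_sum bessel_inv) $ p $ q"
proof -
  define e where "e n = fact n * bessel $ n" for n
  \<comment> \<open>Collects all factors that depend on \<open>j\<close> and \<open>l\<close> only
    through \<open>r = j + l\<close>. The remaining binomial coefficients are summed over
    \<open>a\<close>, and then \<open>e j * e l\<close> over \<open>j\<close> for fixed
    \<open>r\<close>, where \<open>bessel_convolution\<close> applies.\<close>
  define Q where "Q r = fact (p + q - 1 - r) / (fact p * fact q) * bessel_inv $ (p + q - 1 - r)" for r
  \<comment> \<open>The factor \<open>g(s)\<close> cancels, which leaves the coefficient of
    \<open>t^b\<close> in \<open>g(t) / g(t + s)\<close>.\<close>
  have kb: "k b $ n = (\<Sum>l\<le>b. bessel $ l * (of_nat (b - l + n choose n) * bessel_inv $ (b - l + n)))" for b n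
  proof -
    have gf: "gf = lift_s bessel * (lift_t bessel * lift_sum bessel_inv)" by (simp add: gf_def mult_ac)
    have "k b = bessel_inv * (bessel * (lift_t bessel * lift_sum bessel_inv) $ b)"
      unfolding k_def gf fps_mult_left_const_nth ..
    also have "\<dots> = (lift_t bessel * lift_sum bessel_inv) $ b" by simp
    finally have "k b $ n = (\<Sum>l\<le>b. bessel $ l * lift_sum bessel_inv $ (b - l) $ n)"
      by (simp only: lift_t_mult_nth)
    moreover have "(b - l + n choose (b - l)) = (b - l + n choose n)" for l
      using binomial_symmetric[of n "b - l + n"] by simp
    ultimately show ?thesis by (simp only: lift_sum_nth)
  qed
  have T: "fact a * fact b / fact q * (lift_s bessel * lift_sum (k b)) $ p $ a =
      (\<Sum>(j, l) | j + l < q. e j * e l * Q (j + l) * real ((a choose j) * (b choose l)))"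
    if ab: "a + b = q - 1" "0 < q" for a b
  proof -
    have "fact a * fact b / fact q * (lift_s bessel * lift_sum (k b)) $ p $ a =
      (\<Sum>j\<le>a. \<Sum>l\<le>b. e j * e l * Q (j + l) * real ((a choose j) * (b choose l)))"
      unfolding lift_s_mult_nth lift_sum_nth kb sum_distrib_left
    proof (intro sum.cong refl)
      fix j l assume "j \<in> {..a}" "l \<in> {..b}"
      then have jl: "j \<le> a" "l \<le> b" by auto
      define x y where "x = a - j" and "y = b - l"
      have xy: "a = j + x" "b = l + y" using jl by (auto simp: x_def y_def)
      have n: "p + q - 1 - (j + l) = p + x + y" "b - l + (p + x) = p + x + y" "p + (a - j) = p + x"
        using ab xy by auto
      have b1: "real (p + x choose p) = fact (p + x) / (fact p * fact x)"
        by (simp add: binomial_fact)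
      have b2: "real (p + x + y choose (p + x)) = fact (p + x + y) / (fact (p + x) * fact y)"
        by (simp add: binomial_fact)
      have b3: "real (a choose j) = fact a / (fact j * fact x)" "real (b choose l) = fact b / (fact l * fact y)"
        using jl by (simp_all add: binomial_fact x_def y_def)
      show "fact a * fact b / fact q * (bessel $ j * (of_nat (p + (a - j) choose p) *
          (bessel $ l * (of_nat (b - l + (p + (a - j)) choose (p + (a - j))) * bessel_inv $ (b - l + (p + (a - j))))))) =
        e j * e l * Q (j + l) * real ((a choose j) * (b choose l))"
        unfolding n e_def Q_def of_nat_mult b1 b2 b3 by (simp add: field_simps)
    qed
    also have "\<dots> = (\<Sum>(j, l)\<in>{..a} \<times> {..b}. e j * e l * Q (j + l) * real ((a choose j) * (b choose l)))"
      by (rule sum.cartesian_product)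
    also have "\<dots> = (\<Sum>(j, l) | j + l < q. e j * e l * Q (j + l) * real ((a choose j) * (b choose l)))"
    proof (rule sum.mono_neutral_left)
      show "finite {(j, l). j + l < q}"
        by (rule finite_subset[of _ "{..q} \<times> {..q}"]) auto
    qed (use ab in auto)
    finally show ?thesis .
  qed
  have "(\<Sum>a<q. fact a * fact (q - 1 - a) / fact q * (lift_s bessel * lift_sum (k (q - 1 - a))) $ p $ a) =
    (\<Sum>a<q. \<Sum>(j, l) | j + l < q. e j * e l * Q (j + l) * real ((a choose j) * (q - 1 - a choose l)))"
    by (intro sum.cong T) auto
  also have "\<dots> = (\<Sum>(j, l) | j + l < q. \<Sum>a<q. e j * e l * Q (j + l) * real ((a choose j) * (q - 1 - a choose l)))"
    by (subst sum.swap) (simp add: case_prod_unfold)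
  also have "\<dots> = (\<Sum>(j, l) | j + l < q. e j * e l * Q (j + l) * real (q choose Suc (j + l)))"
  proof (intro sum.cong refl, clarify)
    fix j l assume "j + l < q"
    then have "{..<q} = {..q - 1}" "Suc (q - 1) = q" by auto
    then have "(\<Sum>a<q. (a choose j) * (q - 1 - a choose l)) = (q choose Suc (j + l))"
      using sum_choose_mult_choose[of j "q - 1" l] by simp
    then show "(\<Sum>a<q. e j * e l * Q (j + l) * real ((a choose j) * (q - 1 - a choose l))) =
      e j * e l * Q (j + l) * real (q choose Suc (j + l))"
      by (simp add: sum_distrib_left[symmetric] flip: of_nat_mult of_nat_sum)
  qed
  also have "\<dots> = (\<Sum>(r, j)\<in>Sigma {..<q} (\<lambda>r. {..r}). e j * e (r - j) * Q r * real (q choose Suc r))"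
    by (rule sum.reindex_bij_witness[of _ "\<lambda>(r, j). (j, r - j)" "\<lambda>(j, l). (j + l, j)"]) auto
  also have "\<dots> = (\<Sum>r<q. \<Sum>j\<le>r. e j * e (r - j) * Q r * real (q choose Suc r))"
    by (intro sum.Sigma[symmetric]) auto
  also have "\<dots> = (\<Sum>r<q. - e (r + 2) * Q r * real (q choose Suc r))"
    using bessel_convolution by (intro sum.cong refl) (simp add: e_def sum_distrib_right[symmetric] del: fact_Suc)
  also have "\<dots> = - (\<Sum>r<q. fps_deriv bessel $ (Suc r) * (real (p + (q - Suc r) choose p) * bessel_inv $ (p + (q - Suc r))))"
    unfolding sum_negf[symmetric]
  proof (intro sum.cong refl)
    fix r assume "r \<in> {..<q}"
    then have r: "Suc r \<le> q" by auto
    have n: "p + q - 1 - r = p + (q - Suc r)" using r by auto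
    have b1: "real (q choose Suc r) = fact q / (fact (Suc r) * fact (q - Suc r))"
      using r by (simp add: binomial_fact del: fact_Suc)
    have b2: "real (p + (q - Suc r) choose p) = fact (p + (q - Suc r)) / (fact p * fact (q - Suc r))"
      by (simp add: binomial_fact)
    have f: "fact (r + 2) = real (r + 2) * fact (Suc r)" by simp
    have d: "fps_deriv bessel $ (Suc r) = real (r + 2) * bessel $ (r + 2)" by simp
    show "- e (r + 2) * Q r * real (q choose Suc r) =
      - (fps_deriv bessel $ (Suc r) * (real (p + (q - Suc r) choose p) * bessel_inv $ (p + (q - Suc r))))"
      unfolding n e_def Q_def b1 b2 f d by (simp add: divide_simps del: fact_Suc of_nat_add)
  qed
  \<comment> \<open>The additional term of index 0 on the right vanishes since
    \<open>bessel $ 1\<close> is 0.\<close>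
  also have "\<dots> = - (lift_s (fps_deriv bessel) * lift_sum bessel_inv) $ p $ q"
  proof (cases q)
    case (Suc m)
    then show ?thesis
      unfolding fps_neg_nth lift_s_mult_nth lift_sum_nth
      by (simp add: sum.atMost_Suc_shift lessThan_Suc_atMost del: sum.atMost_Suc)
  qed simp
  finally show ?thesis .
qed

text \<open>The case \<open>p = 0\<close> of \<open>beta_sum\<close>: at \<open>t = 0\<close> the
  factor \<open>bessel\<close> cancels against \<open>bessel_inv\<close>, and the row
  \<open>gf $ (n - 1 - a)\<close> itself remains.\<close>

lemma gf_count_total: "(\<Sum>i<n. gf_count i (n - 1 - i)) = fact n * gf_log $ n"
proof -
  have "gf_count a (n - 1 - a) = fact n * (fact a * fact (n - 1 - a) / fact n *
      (lift_s bessel * lift_sum (bessel_inv * gf $ (n - 1 - a))) $ 0 $ a)" for a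
    using gf_sym[of a "n - 1 - a"] by (simp add: gf_count_def)
  then have "(\<Sum>i<n. gf_count i (n - 1 - i)) =
      fact n * - (lift_s (fps_deriv bessel) * lift_sum bessel_inv) $ 0 $ n"
    by (simp only: sum_distrib_left[symmetric] beta_sum)
  also have "\<dots> = fact n * gf_log $ n" by (simp add: gf_log_def)
  finally show ?thesis .
qed

lemma gf_count_0: "gf_count p 0 = (if p = 0 then 1 else 0)"
proof -
  have "gf $ p $ 0 = (\<Sum>i\<le>p. bessel $ i * bessel_inv $ (p - i))" by (simp add: gf_nth)
  also have "\<dots> = (bessel * bessel_inv) $ p" by (simp add: fps_mult_nth atLeast0AtMost)
  finally show ?thesis by (simp add: gf_count_def bessel_inv_mult)
qed

lemma gf_mult_lift_sum_gf:
  "gf * lift_sum (gf $ b) = lift_t bessel * (lift_s bessel * lift_sum (bessel_inv * gf $ b))"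
proof -
  have "lift_sum bessel_inv * lift_sum bessel = 1"
    by (simp only: lift_sum_mult[symmetric] bessel_inv_mult lift_sum_1)
  then have "lift_sum bessel_inv * (lift_sum bessel * F) = F" for F
    by (simp only: mult.assoc[symmetric] mult_1)
  moreover have "lift_sum (gf $ b) = lift_sum bessel * lift_sum (bessel_inv * gf $ b)"
    by (simp only: lift_sum_mult[symmetric] bessel_cancel)
  ultimately show ?thesis by (simp only: gf_def mult.assoc)
qed

text \<open>The derivative falls either on \<open>g(s)\<close> or on \<open>1 / g(t + s)\<close>.
  The second choice produces the unrestricted sum of the recursion, the first one, by
  \<open>beta_sum\<close>, the sum that is subtracted.\<close>

lemma deriv_s_gf:
  "deriv_s gf = lift_t bessel * (lift_s (fps_deriv bessel) * lift_sum bessel_inv) + gf * lift_sum gf_log"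
  by (simp add: gf_def deriv_s_mult deriv_s_lift_s deriv_s_lift_sum deriv_bessel_inv lift_sum_mult
      algebra_simps)

lemma gf_count_Suc:
  "gf_count p (Suc q) =
     (\<Sum>i\<le>p. \<Sum>j\<le>q. real (p choose i) * real (q choose j) * gf_count i j *
        (\<Sum>l<p + q - i - j. gf_count l (p + q - i - j - 1 - l)))
   - (\<Sum>a<q. \<Sum>i\<le>p. \<Sum>j\<le>a. real (p choose i) * real (a choose j) * gf_count i j *
        gf_count (p + a - i - j) (q - 1 - a))"
proof -
  have all: "(\<Sum>i\<le>p. \<Sum>j\<le>q. real (p choose i) * real (q choose j) * gf_count i j *
        (\<Sum>l<p + q - i - j. gf_count l (p + q - i - j - 1 - l))) =
    fact p * fact q * (gf * lift_sum gf_log) $ p $ q"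
    unfolding fps2_mult_nth sum_distrib_left gf_count_total
  proof (intro sum.cong refl)
    fix i j assume "i \<in> {..p}" "j \<in> {..q}"
    then obtain x y where "p = i + x" "q = j + y" by (auto simp: le_iff_add)
    then show "real (p choose i) * real (q choose j) * gf_count i j * (fact (p + q - i - j) * gf_log $ (p + q - i - j)) =
      fact p * fact q * (gf $ i $ j * lift_sum gf_log $ (p - i) $ (q - j))"
      by (simp add: gf_count_def binomial_fact field_simps)
  qed
  have bad: "(\<Sum>i\<le>p. \<Sum>j\<le>a. real (p choose i) * real (a choose j) * gf_count i j *
        gf_count (p + a - i - j) b) = fact p * fact a * fact b * (gf * lift_sum (gf $ b)) $ p $ a" for a b
    unfolding fps2_mult_nth sum_distrib_left
  proof (intro sum.cong refl)
    fix i j assume "i \<in> {..p}" "j \<in> {..a}"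
    then obtain x y where "p = i + x" "a = j + y" by (auto simp: le_iff_add)
    then show "real (p choose i) * real (a choose j) * gf_count i j * gf_count (p + a - i - j) b =
      fact p * fact a * fact b * (gf $ i $ j * lift_sum (gf $ b) $ (p - i) $ (a - j))"
      by (simp add: gf_count_def binomial_fact field_simps gf_sym[of b])
  qed
  have "(\<Sum>a<q. \<Sum>i\<le>p. \<Sum>j\<le>a. real (p choose i) * real (a choose j) * gf_count i j *
        gf_count (p + a - i - j) (q - 1 - a)) =
    fact p * fact q * (\<Sum>a<q. fact a * fact (q - 1 - a) / fact q * (gf * lift_sum (gf $ (q - 1 - a))) $ p $ a)"
    unfolding bad sum_distrib_left by (intro sum.cong) (simp_all add: field_simps)
  also have "(\<Sum>a<q. fact a * fact (q - 1 - a) / fact q * (gf * lift_sum (gf $ (q - 1 - a))) $ p $ a) =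
    (\<Sum>i\<le>p. bessel $ i * (\<Sum>a<q. fact a * fact (q - 1 - a) / fact q *
      (lift_s bessel * lift_sum (bessel_inv * gf $ (q - 1 - a))) $ (p - i) $ a))"
    unfolding gf_mult_lift_sum_gf lift_t_mult_nth sum_distrib_left
    by (subst sum.swap) (simp only: mult.left_commute)
  also have "\<dots> = - (lift_t bessel * (lift_s (fps_deriv bessel) * lift_sum bessel_inv)) $ p $ q"
    unfolding beta_sum by (simp only: lift_t_mult_nth mult_minus_right sum_negf fps_neg_nth)
  finally show ?thesis
  proof -
    assume bad: "(\<Sum>a<q. \<Sum>i\<le>p. \<Sum>j\<le>a. real (p choose i) * real (a choose j) * gf_count i j *
        gf_count (p + a - i - j) (q - 1 - a)) =
      fact p * fact q * - (lift_t bessel * (lift_s (fps_deriv bessel) * lift_sum bessel_inv)) $ p $ q"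
    have "gf_count p (Suc q) = fact p * fact q * deriv_s gf $ p $ q"
      by (simp add: gf_count_def algebra_simps)
    then show ?thesis unfolding all bad deriv_s_gf by (simp add: algebra_simps)
  qed
qed

lemma gf_count_unique:
  fixes c :: "nat \<Rightarrow> nat \<Rightarrow> real"
  assumes c0: "\<And>p. c p 0 = (if p = 0 then 1 else 0)"
    and cS: "\<And>p q. c p (Suc q) =
     (\<Sum>i\<le>p. \<Sum>j\<le>q. real (p choose i) * real (q choose j) * c i j *
        (\<Sum>l<p + q - i - j. c l (p + q - i - j - 1 - l)))
   - (\<Sum>a<q. \<Sum>i\<le>p. \<Sum>j\<le>a. real (p choose i) * real (a choose j) * c i j *
        c (p + a - i - j) (q - 1 - a))"
  shows "c p q = gf_count p q"
proof (induction "p + q" arbitrary: p q rule: less_induct)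
  case less
  show ?case
  proof (cases q)
    case 0
    then show ?thesis by (simp add: c0 gf_count_0)
  next
    case (Suc r)
    have IH: "c i j = gf_count i j" if "i + j \<le> p + r" for i j
      using less[of i j] that Suc by simp
    show ?thesis unfolding Suc cS gf_count_Suc
      by (intro arg_cong2[where f = "(-)"] sum.cong refl arg_cong2[where f = "(*)"] IH) auto
  qed
qed

text \<open>The two partial derivatives agree on \<open>1 / g(t + s)\<close>, so their difference
  acts only on \<open>g(t)\<close> and \<open>g(s)\<close>. The recursion along a row is linear in
  the earlier rows once the totals are known, hence suitable for evaluation.\<close>

lemma gf_count_step:
  "gf_count (Suc p) q - gf_count p (Suc q) =
     (\<Sum>j\<le>q. real (q choose j) * (fact j * gf_log $ j) * gf_count p (q - j))
   - (\<Sum>j\<le>p. real (p choose j) * (fact j * gf_log $ j) * gf_count (p - j) q)"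
proof -
  have "fps_deriv gf - deriv_s gf = lift_s gf_log * gf - lift_t gf_log * gf"
  proof -
    have "lift_t (fps_deriv bessel) = - lift_t gf_log * lift_t bessel"
      by (simp add: deriv_bessel lift_t_mult lift_t_minus)
    moreover have "lift_s (fps_deriv bessel) = - lift_s gf_log * lift_s bessel"
      by (simp add: deriv_bessel)
    ultimately show ?thesis
      unfolding deriv_s_gf
      by (simp add: gf_def fps_deriv_lift_t fps_deriv_lift_sum deriv_bessel_inv lift_sum_mult algebra_simps
            flip: fps_const_neg)
  qed
  then have "fact p * fact q * (fps_deriv gf - deriv_s gf) $ p $ q =
    fact p * fact q * ((lift_s gf_log * gf) $ p $ q - (lift_t gf_log * gf) $ p $ q)" by simp
  moreover have "fact p * fact q * (fps_deriv gf - deriv_s gf) $ p $ q = gf_count (Suc p) q - gf_count p (Suc q)"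
    by (simp add: gf_count_def algebra_simps flip: fps_of_nat)
  moreover have "fact p * fact q * (lift_s gf_log * gf) $ p $ q =
    (\<Sum>j\<le>q. real (q choose j) * (fact j * gf_log $ j) * gf_count p (q - j))"
    unfolding lift_s_mult_nth sum_distrib_left
    by (intro sum.cong) (auto simp: gf_count_def binomial_fact field_simps)
  moreover have "fact p * fact q * (lift_t gf_log * gf) $ p $ q =
    (\<Sum>j\<le>p. real (p choose j) * (fact j * gf_log $ j) * gf_count (p - j) q)"
    unfolding lift_t_mult_nth sum_distrib_left
    by (intro sum.cong) (auto simp: gf_count_def binomial_fact field_simps)
  ultimately show ?thesis by (simp only: right_diff_distrib)
qed

section \<open>From the series back to the words\<close>

lemma usorted_odd_length: "usorted w \<Longrightarrow> odd (length w)"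
  by (induction rule: usorted.induct) auto

lemma usorted_count_odd:
  assumes "odd (p + q)"
  shows "usorted_count p q = 0"
proof -
  have "w \<notin> usorted_words {..p + q} p" for w
  proof
    assume "w \<in> usorted_words {..p + q} p"
    then have "usorted w" "set w = {..p + q}" by (simp_all add: usorted_words_def)
    then have "length w = Suc (p + q)" using distinct_card[OF usorted_distinct] by fastforce
    then show False using usorted_odd_length[OF \<open>usorted w\<close>] assms by simp
  qed
  then have "usorted_words {..p + q} p = {}" by blast
  then show ?thesis by (simp add: usorted_count_def)
qed

lemma usorted_count_eq_gf_count: "real (usorted_count p q) = gf_count p q"
proof (rule gf_count_unique)
  fix p q
  show "real (usorted_count p 0) = (if p = 0 then 1 else 0)" by (simp add: usorted_count_0)
  have "real (usorted_count p (Suc q)) = real_of_int (int (usorted_count p (Suc q)))" by simp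
  then show "real (usorted_count p (Suc q)) =
     (\<Sum>i\<le>p. \<Sum>j\<le>q. real (p choose i) * real (q choose j) * real (usorted_count i j) *
        (\<Sum>l<p + q - i - j. real (usorted_count l (p + q - i - j - 1 - l))))
   - (\<Sum>a<q. \<Sum>i\<le>p. \<Sum>j\<le>a. real (p choose i) * real (a choose j) * real (usorted_count i j) *
        real (usorted_count (p + a - i - j) (q - 1 - a)))"
    unfolding usorted_count_Suc usorted_total_def by simp
qed

lemma usorted_total_eq: "real (usorted_total n) = fact n * gf_log $ n"
  using gf_count_total[of n] by (simp add: usorted_total_def usorted_count_eq_gf_count)

lemma usorted_count_sym: "usorted_count p q = usorted_count q p"
proof -
  have "real (usorted_count p q) = real (usorted_count q p)"
    by (simp add: usorted_count_eq_gf_count gf_count_def gf_sym[of p q])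
  then show ?thesis by simp
qed

lemma usorted_count_0_left: "usorted_count 0 q = (if q = 0 then 1 else 0)"
  by (simp add: usorted_count_sym[of 0] usorted_count_0)

lemma usorted_total_even: "even n \<Longrightarrow> usorted_total n = 0"
  unfolding usorted_total_def by (intro sum.neutral ballI usorted_count_odd) auto

lemma usorted_count_step:
  "int (usorted_count (Suc p) q) = int (usorted_count p (Suc q)) +
     (\<Sum>j\<le>q. int (q choose j) * int (usorted_total j) * int (usorted_count p (q - j)))
   - (\<Sum>j\<le>p. int (p choose j) * int (usorted_total j) * int (usorted_count (p - j) q))"
proof -
  have "real (usorted_count (Suc p) q) = real (usorted_count p (Suc q)) +
     (\<Sum>j\<le>q. real (q choose j) * real (usorted_total j) * real (usorted_count p (q - j)))
   - (\<Sum>j\<le>p. real (p choose j) * real (usorted_total j) * real (usorted_count (p - j) q))"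
    using gf_count_step[of p q] unfolding usorted_total_eq usorted_count_eq_gf_count by linarith
  then have "real_of_int (int (usorted_count (Suc p) q)) = real_of_int (int (usorted_count p (Suc q)) +
     (\<Sum>j\<le>q. int (q choose j) * int (usorted_total j) * int (usorted_count p (q - j)))
   - (\<Sum>j\<le>p. int (p choose j) * int (usorted_total j) * int (usorted_count (p - j) q)))"
    by simp
  then show ?thesis by (simp only: of_int_eq_iff)
qed

text \<open>The form used for evaluation: the sum runs over odd sizes only, the even totals being 0,
  and every count is written as an entry of row \<open>k - m\<close>. Where truncated subtraction
  distorts an argument, the binomial coefficient in front is 0.\<close>

lemma usorted_count_step':
  assumes "p + q = 2 * k + 1"
  shows "int (usorted_count (Suc p) q) = int (usorted_count p (Suc q)) +
     (\<Sum>m\<le>k. int (usorted_total (2 * m + 1)) *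
        (int (q choose (2 * m + 1)) * int (usorted_count p (2 * (k - m) - p)) -
         int (p choose (2 * m + 1)) * int (usorted_count (p - (2 * m + 1)) (2 * (k - m) - (p - (2 * m + 1))))))"
proof -
  have S: "(\<Sum>j\<le>n. int (n choose j) * int (usorted_total j) * int (F j)) =
      (\<Sum>m\<le>k. int (usorted_total (2 * m + 1)) * (int (n choose (2 * m + 1)) * int (F (2 * m + 1))))"
    if n: "n \<le> 2 * k + 1" for n and F :: "nat \<Rightarrow> nat"
  proof -
    have "(\<Sum>j\<le>n. int (n choose j) * int (usorted_total j) * int (F j)) =
      (\<Sum>j\<le>2 * k + 1. int (n choose j) * int (usorted_total j) * int (F j))"
      using n by (intro sum.mono_neutral_left) auto
    also have "\<dots> = (\<Sum>j\<in>(\<lambda>m. 2 * m + 1) ` {..k}. int (n choose j) * int (usorted_total j) * int (F j))"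
    proof (rule sum.mono_neutral_right)
      show "\<forall>j\<in>{..2 * k + 1} - (\<lambda>m. 2 * m + 1) ` {..k}. int (n choose j) * int (usorted_total j) * int (F j) = 0"
      proof
        fix j assume j: "j \<in> {..2 * k + 1} - (\<lambda>m. 2 * m + 1) ` {..k}"
        have "even j"
        proof (rule ccontr)
          assume "odd j"
          then obtain m where "j = 2 * m + 1" by (elim oddE)
          then show False using j by auto
        qed
        then show "int (n choose j) * int (usorted_total j) * int (F j) = 0" by (simp add: usorted_total_even)
      qed
    qed auto
    also have "\<dots> = (\<Sum>m\<le>k. int (usorted_total (2 * m + 1)) * (int (n choose (2 * m + 1)) * int (F (2 * m + 1))))"
      by (subst sum.reindex) (auto simp: inj_on_def intro!: sum.cong)
    finally show ?thesis .
  qed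
  have "int (q choose (2 * m + 1)) * int (usorted_count p (q - (2 * m + 1))) =
      int (q choose (2 * m + 1)) * int (usorted_count p (2 * (k - m) - p))" for m
  proof (cases "2 * m + 1 \<le> q")
    case True
    then have "q - (2 * m + 1) = 2 * (k - m) - p" using assms by auto
    then show ?thesis by simp
  qed simp
  note eq1 = this
  have "int (p choose (2 * m + 1)) * int (usorted_count (p - (2 * m + 1)) q) =
      int (p choose (2 * m + 1)) * int (usorted_count (p - (2 * m + 1)) (2 * (k - m) - (p - (2 * m + 1))))" for m
  proof (cases "2 * m + 1 \<le> p")
    case True
    then have "q = 2 * (k - m) - (p - (2 * m + 1))" using assms by auto
    then show ?thesis by simp
  qed simp
  note eq2 = this
  have "p \<le> 2 * k + 1" "q \<le> 2 * k + 1" using assms by auto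
  from S[OF this(1), of "\<lambda>j. usorted_count (p - j) q"] S[OF this(2), of "\<lambda>j. usorted_count p (q - j)"]
  show ?thesis
    unfolding usorted_count_step[of p q] eq1 eq2 by (simp only: right_diff_distrib sum_subtractf add_diff_eq)
qed

subsection \<open>The first rows\<close>

definition usorted_row :: "nat \<Rightarrow> int list" where
  "usorted_row k = map (\<lambda>p. int (usorted_count p (2 * k - p))) [0..<2 * k + 1]"

primrec nth_default0 :: "int list \<Rightarrow> nat \<Rightarrow> int" where
  "nth_default0 [] i = 0"
| "nth_default0 (x # xs) i = (case i of 0 \<Rightarrow> x | Suc j \<Rightarrow> nth_default0 xs j)"

lemma nth_default0_eq: "nth_default0 xs i = (if i < length xs then xs ! i else 0)"
  by (induction xs arbitrary: i) (auto split: nat.split)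

primrec pascal :: "nat \<Rightarrow> int list list" where
  "pascal 0 = [[1]]"
| "pascal (Suc n) = (let t = pascal n; r = hd t in map2 (+) (r @ [0]) (0 # r) # t)"

definition row_diff :: "int list list \<Rightarrow> int list list \<Rightarrow> int list \<Rightarrow> nat \<Rightarrow> nat \<Rightarrow> int" where
  "row_diff bs rs us k p =
    (let bq = bs ! (2 * k + 1 - p); bp = bs ! p
     in sum_list (map (\<lambda>m. us ! m * (nth_default0 bq (2 * m + 1) * nth_default0 (rs ! (k - m)) p -
       (if 2 * m + 1 \<le> p then nth_default0 bp (2 * m + 1) * nth_default0 (rs ! (k - m)) (p - (2 * m + 1)) else 0)))
       [0..<Suc k]))"

text \<open>Partial sums with the latest in front. The initial 0 is the first entry of every row
  except row 0.\<close>

primrec half_row :: "(nat \<Rightarrow> int) \<Rightarrow> nat \<Rightarrow> int list" where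
  "half_row f 0 = [0]"
| "half_row f (Suc n) = (let t = half_row f n in (hd t + f n) # t)"

text \<open>By symmetry, only the entries up to the middle are computed; \<open>tl hf\<close>
  reflects them without repeating the middle one.\<close>

primrec rows :: "int list list \<Rightarrow> nat \<Rightarrow> int list list \<times> int list" where
  "rows bs 0 = ([[1]], [1])"
| "rows bs (Suc k) = (let (rs, us) = rows bs k; hf = half_row (row_diff bs rs us k) (Suc k); r = rev hf @ tl hf
    in (rs @ [r], us @ [sum_list r]))"

lemma nth_default0_usorted_row: "nth_default0 (usorted_row k) p = (if p \<le> 2 * k then int (usorted_count p (2 * k - p)) else 0)"
  by (auto simp: nth_default0_eq usorted_row_def nth_append)

lemma pascal_eq: "pascal n = rev (map (\<lambda>i. map (\<lambda>j. int (i choose j)) [0..<Suc i]) [0..<Suc n])"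
proof (induction n)
  case (Suc n)
  define r where "r = map (\<lambda>j. int (n choose j)) [0..<Suc n]"
  have "map2 (+) (r @ [0]) (0 # r) = map (\<lambda>j. int (Suc n choose j)) [0..<Suc (Suc n)]"
  proof (rule nth_equalityI)
    fix i assume "i < length (map2 (+) (r @ [0]) (0 # r))"
    then have i: "i \<le> Suc n" by (simp add: r_def)
    have "(r @ [0]) ! i = int (n choose i)"
      using i by (cases "i = Suc n") (auto simp: r_def nth_append simp del: upt_Suc)
    moreover have "(0 # r) ! i = (if i = 0 then 0 else int (n choose (i - 1)))"
      using i by (cases i) (auto simp: r_def simp del: upt_Suc)
    ultimately show "map2 (+) (r @ [0]) (0 # r) ! i = map (\<lambda>j. int (Suc n choose j)) [0..<Suc (Suc n)] ! i"
      using i by (cases i) (auto simp: r_def simp del: upt_Suc)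
  qed (simp add: r_def)
  moreover have "hd (pascal n) = r" unfolding Suc.IH by (simp add: r_def hd_rev)
  ultimately show ?case using Suc.IH by (simp add: Let_def r_def)
qed simp

lemma usorted_total_odd: "int (usorted_total (2 * k + 1)) = sum_list (usorted_row k)"
  unfolding usorted_total_def usorted_row_def by (simp add: sum_list_map_eq_sum_count interv_sum_list_conv_sum_set_nat atLeast0LessThan)

lemma half_row_eq:
  assumes "\<And>p. p < n \<Longrightarrow> h (Suc p) = h p + f p" "h 0 = 0"
  shows "half_row f n = rev (map h [0..<Suc n])"
  using assms by (induction n) (auto simp: Let_def)

lemma rows_eq:
  assumes "2 * k < N + 1"
  shows "rows (rev (pascal N)) k = (map usorted_row [0..<Suc k], map (\<lambda>m. int (usorted_total (2 * m + 1))) [0..<Suc k])"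
  using assms
proof (induction k)
  case 0
  have "usorted_count 0 0 = 1" by (simp add: usorted_count_0)
  then show ?case by (simp add: usorted_row_def usorted_total_def)
next
  case (Suc k)
  define bs where "bs = rev (pascal N)"
  have bs: "nth_default0 (bs ! i) j = int (i choose j)" if "i \<le> N" for i j
  proof -
    have "bs ! i = map (\<lambda>j. int (i choose j)) [0..<Suc i]"
      unfolding bs_def pascal_eq rev_rev_ident using that by (subst nth_map) (auto simp del: upt_Suc)
    then show ?thesis by (auto simp: nth_default0_eq simp del: upt_Suc)
  qed
  define rs us where "rs = map usorted_row [0..<Suc k]" and "us = map (\<lambda>m. int (usorted_total (2 * m + 1))) [0..<Suc k]"
  define h where "h p = int (usorted_count p (2 * Suc k - p))" for p
  have diff: "h (Suc p) = h p + row_diff bs rs us k p" if "p < Suc k" for p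
  proof -
    define q where "q = 2 * k + 1 - p"
    have pq: "p + q = 2 * k + 1" using that by (simp add: q_def)
    have "int (usorted_total (2 * m + 1)) *
        (int (q choose (2 * m + 1)) * int (usorted_count p (2 * (k - m) - p)) -
         int (p choose (2 * m + 1)) * int (usorted_count (p - (2 * m + 1)) (2 * (k - m) - (p - (2 * m + 1))))) =
      us ! m * (nth_default0 (bs ! q) (2 * m + 1) * nth_default0 (rs ! (k - m)) p -
       (if 2 * m + 1 \<le> p then nth_default0 (bs ! p) (2 * m + 1) * nth_default0 (rs ! (k - m)) (p - (2 * m + 1)) else 0))"
      if m: "m \<le> k" for m
    proof -
      have "us ! m = int (usorted_total (2 * m + 1))" "rs ! (k - m) = usorted_row (k - m)"
        using m by (auto simp: us_def rs_def simp del: upt_Suc)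
      moreover have b: "nth_default0 (bs ! q) j = int (q choose j)" "nth_default0 (bs ! p) j = int (p choose j)" for j
        using bs[of q] bs[of p] Suc.prems pq by auto
      \<comment> \<open>Beyond the end of row \<open>k - m\<close> the list lookup returns 0, which
        agrees with the product because of this factor.\<close>
      have "int (q choose (2 * m + 1)) = 0" if "\<not> p \<le> 2 * (k - m)"
        using that m pq by auto
      then have "nth_default0 (bs ! q) (2 * m + 1) * nth_default0 (usorted_row (k - m)) p =
          int (q choose (2 * m + 1)) * int (usorted_count p (2 * (k - m) - p))"
        by (auto simp: b nth_default0_usorted_row)
      moreover have "int (p choose (2 * m + 1)) = 0" if "\<not> 2 * m + 1 \<le> p"
        using that by simp
      moreover have "p - (2 * m + 1) \<le> 2 * (k - m)" using \<open>p < Suc k\<close> m by auto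
      then have "nth_default0 (bs ! p) (2 * m + 1) * nth_default0 (usorted_row (k - m)) (p - (2 * m + 1)) =
          int (p choose (2 * m + 1)) * int (usorted_count (p - (2 * m + 1)) (2 * (k - m) - (p - (2 * m + 1))))"
        by (simp only: b nth_default0_usorted_row if_True)
      ultimately show ?thesis by (cases "2 * m + 1 \<le> p") simp_all
    qed
    then have "(\<Sum>m\<le>k. int (usorted_total (2 * m + 1)) *
        (int (q choose (2 * m + 1)) * int (usorted_count p (2 * (k - m) - p)) -
         int (p choose (2 * m + 1)) * int (usorted_count (p - (2 * m + 1)) (2 * (k - m) - (p - (2 * m + 1)))))) = row_diff bs rs us k p"
      unfolding row_diff_def Let_def q_def[symmetric] interv_sum_list_conv_sum_set_nat
      by (intro sum.cong) (simp_all only: set_upt atLeast0LessThan lessThan_Suc_atMost atMost_iff)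
    moreover have "h (Suc p) = int (usorted_count (Suc p) q)" "h p = int (usorted_count p (Suc q))"
      using pq by (auto simp: h_def intro!: arg_cong2[where f = usorted_count])
    ultimately show ?thesis using usorted_count_step'[OF pq] by simp
  qed
  define hf where "hf = half_row (row_diff bs rs us k) (Suc k)"
  have hf: "hf = rev (map h [0..<Suc (Suc k)])"
    unfolding hf_def by (rule half_row_eq) (use diff in \<open>auto simp: h_def usorted_count_0_left\<close>)
  have "rev hf @ tl hf = usorted_row (Suc k)"
  proof (rule nth_equalityI)
    fix i assume "i < length (rev hf @ tl hf)"
    then have i: "i \<le> 2 * Suc k" by (simp add: hf)
    show "(rev hf @ tl hf) ! i = usorted_row (Suc k) ! i"
    proof (cases "i \<le> Suc k")
      case True
      then show ?thesis using i by (auto simp: hf nth_append usorted_row_def h_def simp del: upt_Suc)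
    next
      case False
      have "tl hf = rev (map h [0..<Suc k])" unfolding hf by simp
      moreover have "rev (map h [0..<Suc k]) ! (i - Suc (Suc k)) = h (2 * Suc k - i)"
        using i False by (subst rev_nth) (auto simp: Suc_diff_le mult_2 simp del: upt_Suc)
      moreover have "h (2 * Suc k - i) = int (usorted_count i (2 * Suc k - i))"
        using i by (simp add: h_def usorted_count_sym)
      ultimately show ?thesis using i False by (auto simp: hf nth_append usorted_row_def simp del: upt_Suc)
    qed
  qed (simp add: hf usorted_row_def)
  note r = this
  have "2 * k < N + 1" using Suc.prems by simp
  then have "rows bs k = (rs, us)" unfolding bs_def rs_def us_def by (rule Suc.IH)
  then have "rows bs (Suc k) = (rs @ [usorted_row (Suc k)], us @ [sum_list (usorted_row (Suc k))])"
    by (simp only: rows.simps Let_def prod.case hf_def[symmetric] r)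
  then show ?case
    unfolding usorted_total_odd[symmetric] bs_def rs_def us_def by simp
qed

text \<open>
  The last row is needed in a stronger form: divided by \<open>p q\<close>, it is still log-concave.
\<close>

definition row_log_concave :: "int list \<Rightarrow> bool" where
  "row_log_concave r = list_all (\<lambda>i. r ! i * r ! Suc (Suc i) \<le> (r ! Suc i) * (r ! Suc i)) [0..<length r - 2]"

definition row_strongly_log_concave :: "nat \<Rightarrow> int list \<Rightarrow> bool" where
  "row_strongly_log_concave k r = list_all (\<lambda>i.
     let p = int i + 2; q = 2 * int k - p
     in r ! (i + 1) * r ! (i + 3) * (p * q * (p * q)) \<le> r ! (i + 2) * r ! (i + 2) * ((p - 1) * (q + 1) * ((p + 1) * (q - 1))))
     [0..<2 * k - 3]"

definition row_lower_bound :: "nat \<Rightarrow> int \<Rightarrow> int list \<Rightarrow> bool" where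
  "row_lower_bound k b r = list_all (\<lambda>i. b * ((int i + 1) * (2 * int k - 1 - int i)) \<le> r ! (i + 1)) [0..<2 * k - 1]"

lemma first_rows_check:
  "let rs = fst (rows (rev (pascal 26)) 13); r = last rs
   in list_all row_log_concave (tl rs) \<and> row_strongly_log_concave 13 r \<and> row_lower_bound 13 56535215267979888 r"
  by code_simp

subsection \<open>Log-concavity with binomial weights\<close>

definition weighted_coeff :: "nat \<Rightarrow> real poly \<Rightarrow> nat \<Rightarrow> real" where
  "weighted_coeff n f i = fact i * fact (n - i) * coeff f i"

text \<open>\<open>m\<close> is a lower bound for the quotients of the coefficients by
  \<open>n choose i\<close>. It survives multiplication by \<open>1 + X\<close>, and the error terms
  are measured against it.\<close>

definition ultra_log_concave :: "nat \<Rightarrow> real \<Rightarrow> real poly \<Rightarrow> bool" where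
  "ultra_log_concave n m f \<longleftrightarrow>
     (\<forall>i\<le>n. m * fact n \<le> weighted_coeff n f i) \<and> (\<forall>i>n. coeff f i = 0) \<and>
     (\<forall>i. Suc i < n \<longrightarrow> weighted_coeff n f i * weighted_coeff n f (i + 2) \<le> (weighted_coeff n f (Suc i))\<^sup>2)"

text \<open>The two hypotheses imply \<open>a * d \<le> b * c\<close>. Replacing all three mixed
  products in the expansion by their bounds gives the right-hand side minus
  \<open>(b - c)^2\<close>.\<close>

lemma log_concave_step:
  fixes p q a b c d :: real
  assumes "1 \<le> p" "1 \<le> q" "0 \<le> a" "0 < b" "0 < c" "0 \<le> d" "a * c \<le> b\<^sup>2" "b * d \<le> c\<^sup>2"
  shows "((p - 1) * a + (q + 1) * b) * ((p + 1) * c + (q - 1) * d) \<le> (p * b + q * c)\<^sup>2"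
proof -
  have "(a * d) * (b * c) \<le> (b * c) * (b * c)"
    using mult_mono[OF assms(7,8)] assms by (simp add: power2_eq_square mult_ac)
  then have ad: "a * d \<le> b * c" using assms by (simp add: mult_le_cancel_right)
  have "((p - 1) * a + (q + 1) * b) * ((p + 1) * c + (q - 1) * d) =
    (p - 1) * (p + 1) * (a * c) + (p - 1) * (q - 1) * (a * d) + (q + 1) * (p + 1) * (b * c) + (q + 1) * (q - 1) * (b * d)"
    by (simp add: algebra_simps)
  also have "\<dots> \<le> (p - 1) * (p + 1) * b\<^sup>2 + (p - 1) * (q - 1) * (b * c) + (q + 1) * (p + 1) * (b * c) + (q + 1) * (q - 1) * c\<^sup>2"
    using assms ad by (intro add_mono mult_left_mono) auto
  also have "\<dots> = (p * b + q * c)\<^sup>2 - (b - c)\<^sup>2"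
    by (simp add: algebra_simps power2_eq_square)
  also have "\<dots> \<le> (p * b + q * c)\<^sup>2" by simp
  finally show ?thesis .
qed

text \<open>Pascal's rule for the weighted coefficients: the two factors add up to
  \<open>n + 1\<close>, which is why the lower bound by a multiple of a factorial is
  preserved.\<close>

lemma weighted_coeff_mult:
  assumes "i \<le> Suc n" "\<forall>i>n. coeff f i = 0"
  shows "weighted_coeff (Suc n) ([:1, 1:] * f) i =
    real i * weighted_coeff n f (i - 1) + real (Suc n - i) * weighted_coeff n f i"
proof (cases i)
  case 0
  then show ?thesis by (simp add: weighted_coeff_def)
next
  case (Suc k)
  then have k: "k \<le> n" using assms by simp
  have c: "coeff ([:1, 1:] * f) i = coeff f k + coeff f (Suc k)" using Suc by simp
  show ?thesis
  proof (cases "k = n")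
    case True
    then show ?thesis using Suc assms c by (simp add: weighted_coeff_def)
  next
    case False
    then obtain r where r: "n = Suc k + r" using k by (metis le_eq_less_or_eq less_iff_Suc_add add_Suc_shift add_Suc)
    have "fact (Suc n - i) = real (Suc n - i) * fact (n - i)" using Suc r by (simp add: Suc_diff_le)
    moreover have "Suc n - i = n - k" "n - i = r" "n - k = Suc r" using Suc r by auto
    ultimately show ?thesis using c Suc by (simp add: weighted_coeff_def algebra_simps)
  qed
qed

lemma ultra_log_concave_mult:
  assumes f: "ultra_log_concave n m f" and m: "0 < m"
  shows "ultra_log_concave (Suc n) m ([:1, 1:] * f)"
proof -
  define v where "v = weighted_coeff n f"
  have lo: "m * fact n \<le> v i" if "i \<le> n" for i using f that by (auto simp: ultra_log_concave_def v_def)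
  have pos: "0 < v i" if "i \<le> n" for i using lo[OF that] m by (smt (verit) fact_gt_zero mult_pos_pos)
  have hi: "\<forall>i>n. coeff f i = 0" using f by (auto simp: ultra_log_concave_def)
  have lc: "v i * v (i + 2) \<le> (v (Suc i))\<^sup>2" if "Suc i < n" for i
    using f that by (auto simp: ultra_log_concave_def v_def)
  have w: "weighted_coeff (Suc n) ([:1, 1:] * f) i = real i * v (i - 1) + real (Suc n - i) * v i" if "i \<le> Suc n" for i
    using weighted_coeff_mult[OF that hi] by (simp add: v_def)
  have "m * fact (Suc n) \<le> weighted_coeff (Suc n) ([:1, 1:] * f) i" if i: "i \<le> Suc n" for i
  proof -
    have "real i * (m * fact n) \<le> real i * v (i - 1)" using i lo by (intro mult_left_mono) auto
    moreover have "real (Suc n - i) * (m * fact n) \<le> real (Suc n - i) * v i"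
      using i lo by (cases "i = Suc n") (auto intro!: mult_left_mono)
    moreover have "real i * (m * fact n) + real (Suc n - i) * (m * fact n) = m * fact (Suc n)"
      using i by (simp add: of_nat_diff algebra_simps)
    ultimately show ?thesis unfolding w[OF i] by linarith
  qed
  moreover have "coeff ([:1, 1:] * f) i = 0" if "i > Suc n" for i
    using hi that by (cases i) auto
  moreover have "weighted_coeff (Suc n) ([:1, 1:] * f) i * weighted_coeff (Suc n) ([:1, 1:] * f) (i + 2)
      \<le> (weighted_coeff (Suc n) ([:1, 1:] * f) (Suc i))\<^sup>2" if i: "Suc i < Suc n" for i
  proof -
    define p q where "p = real (Suc i)" and "q = real (n - i)"
    \<comment> \<open>At the ends the neighbour outside the range carries the factor
      \<open>p - 1 = 0\<close> or \<open>q - 1 = 0\<close>; setting it to 0 keeps the hypotheses of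
      \<open>log_concave_step\<close> true.\<close>
    define a where "a = (if i = 0 then 0 else v (i - 1))"
    define d where "d = (if n = Suc i then 0 else v (i + 2))"
    have "weighted_coeff (Suc n) ([:1, 1:] * f) i = (p - 1) * a + (q + 1) * v i"
      using i by (subst w) (auto simp: p_def q_def a_def Suc_diff_le)
    moreover have "weighted_coeff (Suc n) ([:1, 1:] * f) (Suc i) = p * v i + q * v (Suc i)"
      using i by (subst w) (auto simp: p_def q_def)
    moreover have "weighted_coeff (Suc n) ([:1, 1:] * f) (i + 2) = (p + 1) * v (Suc i) + (q - 1) * d"
      using i by (subst w) (auto simp: p_def q_def d_def of_nat_diff)
    moreover have "a * v (Suc i) \<le> (v i)\<^sup>2" using lc[of "i - 1"] i by (auto simp: a_def)
    moreover have "v i * d \<le> (v (Suc i))\<^sup>2" using lc[of i] i by (auto simp: d_def)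
    moreover have "0 \<le> a" "0 \<le> d" "0 < v i" "0 < v (Suc i)"
      using pos i by (auto simp: a_def d_def intro!: less_imp_le)
    moreover have "1 \<le> p" "1 \<le> q" using i by (auto simp: p_def q_def)
    ultimately show ?thesis using log_concave_step[of p q a "v i" "v (Suc i)" d] by simp
  qed
  ultimately show ?thesis unfolding ultra_log_concave_def by blast
qed

lemma ultra_log_concave_mult_power:
  "ultra_log_concave n m f \<Longrightarrow> 0 < m \<Longrightarrow> ultra_log_concave (n + r) m ([:1, 1:] ^ r * f)"
proof (induction r)
  case (Suc r)
  then show ?case using ultra_log_concave_mult[of "n + r" m "[:1, 1:] ^ r * f"]
    by (simp only: power_Suc mult.assoc add_Suc_right)
qed simp

lemma ultra_log_concave_smult:
  assumes "ultra_log_concave n m f" "0 < c"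
  shows "ultra_log_concave n (c * m) (smult c f)"
proof -
  have w: "weighted_coeff n (smult c f) i = c * weighted_coeff n f i" for i
    by (simp add: weighted_coeff_def)
  have "c * (m * fact n) \<le> c * weighted_coeff n f i" if "i \<le> n" for i
    using assms that by (intro mult_left_mono) (auto simp: ultra_log_concave_def)
  moreover have "c\<^sup>2 * (weighted_coeff n f i * weighted_coeff n f (i + 2)) \<le> c\<^sup>2 * (weighted_coeff n f (Suc i))\<^sup>2" if "Suc i < n" for i
    using assms that by (intro mult_left_mono) (auto simp: ultra_log_concave_def)
  ultimately show ?thesis
    using assms unfolding ultra_log_concave_def w by (auto simp: power2_eq_square mult_ac)
qed

text \<open>
  Multiplying by \<open>p q\<close> creates enough room for an error of relative size \<open>1 / (2 p q)\<close>.
\<close>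

lemma log_concave_perturb:
  fixes p q \<sigma> M u v w a b c :: real
  assumes pq: "2 \<le> p" "2 \<le> q" and \<sigma>: "0 \<le> \<sigma>" "\<sigma> \<le> 1 / 2"
    and lo: "0 < M" "M \<le> u" "M \<le> v" "M \<le> w" and lc: "u * w \<le> v\<^sup>2"
    and err: "\<bar>a - (p - 1) * (q + 1) * u\<bar> \<le> \<sigma> * M" "\<bar>b - p * q * v\<bar> \<le> \<sigma> * M" "\<bar>c - (p + 1) * (q - 1) * w\<bar> \<le> \<sigma> * M"
    and nonneg: "0 \<le> a" "0 \<le> c"
  shows "a * c \<le> b\<^sup>2"
proof -
  have \<sigma>M: "\<sigma> * M \<le> \<sigma> * u" "\<sigma> * M \<le> \<sigma> * v" "\<sigma> * M \<le> \<sigma> * w" using \<sigma> lo by (auto intro: mult_left_mono)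
  have a: "a \<le> ((p - 1) * (q + 1) + \<sigma>) * u" using err(1) \<sigma>M by (simp add: algebra_simps abs_le_iff)
  have c: "c \<le> ((p + 1) * (q - 1) + \<sigma>) * w" using err(3) \<sigma>M by (simp add: algebra_simps abs_le_iff)
  have b: "(p * q - \<sigma>) * v \<le> b" using err(2) \<sigma>M by (simp add: algebra_simps abs_le_iff)
  have pq4: "4 \<le> p * q" using mult_mono[OF pq] pq by simp
  have nn: "0 \<le> (p - 1) * (q + 1) + \<sigma>" "0 \<le> (p + 1) * (q - 1) + \<sigma>" using pq \<sigma> by auto
  \<comment> \<open>This is the difference of the two sides of \<open>key\<close>. At
    \<open>p = q\<close> it is nonnegative only for \<open>\<sigma> \<le> 1 / 2\<close>.\<close>
  have "0 \<le> (p - q)\<^sup>2 + (2 * (p * q) - 1) * (1 - 2 * \<sigma>)"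
    using pq4 \<sigma> by (intro add_nonneg_nonneg mult_nonneg_nonneg) auto
  then have key: "((p - 1) * (q + 1) + \<sigma>) * ((p + 1) * (q - 1) + \<sigma>) \<le> (p * q - \<sigma>)\<^sup>2"
    by (simp add: algebra_simps power2_eq_square)
  have "a * c \<le> (((p - 1) * (q + 1) + \<sigma>) * u) * (((p + 1) * (q - 1) + \<sigma>) * w)"
    using a c nonneg nn lo by (intro mult_mono) auto
  also have "\<dots> = (((p - 1) * (q + 1) + \<sigma>) * ((p + 1) * (q - 1) + \<sigma>)) * (u * w)" by simp
  also have "\<dots> \<le> (p * q - \<sigma>)\<^sup>2 * v\<^sup>2" using key lc lo by (intro mult_mono) auto
  also have "\<dots> = ((p * q - \<sigma>) * v)\<^sup>2" by (simp add: power_mult_distrib)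
  also have "\<dots> \<le> b\<^sup>2" using b pq4 \<sigma> lo by (intro power_mono) auto
  finally show ?thesis .
qed

subsection \<open>Rows as polynomials\<close>

definition bessel_inv_coeff :: "nat \<Rightarrow> real" where
  "bessel_inv_coeff m = bessel_inv $ (2 * m)"

text \<open>The part of degree \<open>2j\<close> of \<open>g(t) g(s)\<close>, with \<open>s\<close>
  set to 1; in the same way \<open>[:1, 1:]\<close> stands for \<open>t + s\<close>, and
  \<open>row_poly k\<close> for the part of degree \<open>2k\<close> of \<open>gf\<close>.\<close>

definition bessel_row :: "nat \<Rightarrow> real poly" where
  "bessel_row j = (\<Sum>a\<le>j. monom (bessel_coeff a * bessel_coeff (j - a)) (2 * a))"

definition row_poly :: "nat \<Rightarrow> real poly" where
  "row_poly k = (\<Sum>j\<le>k. smult (bessel_inv_coeff (k - j)) (bessel_row j * [:1, 1:] ^ (2 * (k - j))))"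

text \<open>Bounds the coefficients of \<open>bessel_row j\<close> relative to those of
  \<open>(1 + X)^(2j)\<close>. Such a bound carries over to products with powers of
  \<open>1 + X\<close>.\<close>

definition bessel_weight :: "nat \<Rightarrow> real" where
  "bessel_weight j = (\<Sum>a\<le>j. \<bar>bessel_coeff a * bessel_coeff (j - a)\<bar> / real (2 * j choose (2 * a)))"

lemma smult_sum_right: "smult c (sum f A) = (\<Sum>x\<in>A. smult c (f x))"
  by (induction A rule: infinite_finite_induct) (simp_all add: smult_add_right)

lemma coeff_one_plus_X_power: "coeff ([:1, 1:] ^ n :: real poly) i = real (n choose i)"
proof (induction n arbitrary: i)
  case (Suc n)
  then show ?case by (cases i) auto
qed simp

lemma coeff_bessel_row_mult:
  "coeff (bessel_row j * [:1, 1:] ^ n) p =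
    (\<Sum>a\<le>j. bessel_coeff a * bessel_coeff (j - a) * (if 2 * a \<le> p then real (n choose (p - 2 * a)) else 0))"
proof -
  have "coeff (monom c d * [:1, 1:] ^ n) p = c * (if d \<le> p then real (n choose (p - d)) else 0)" for c :: real and d
    by (auto simp: coeff_monom_mult coeff_one_plus_X_power)
  then show ?thesis
    by (simp only: bessel_row_def sum_distrib_right coeff_sum)
qed

text \<open>A single term of Vandermonde's sum is at most the whole sum, so
  \<open>n choose (p - 2 * a)\<close> is at most the quotient of \<open>2 * k choose p\<close> by
  \<open>2 * j choose (2 * a)\<close>.\<close>

lemma coeff_bessel_row_mult_le:
  assumes "n + 2 * j = 2 * k"
  shows "\<bar>coeff (bessel_row j * [:1, 1:] ^ n) p\<bar> \<le> real (2 * k choose p) * bessel_weight j"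
proof -
  have "\<bar>bessel_coeff a * bessel_coeff (j - a) * (if 2 * a \<le> p then real (n choose (p - 2 * a)) else 0)\<bar>
      \<le> real (2 * k choose p) * (\<bar>bessel_coeff a * bessel_coeff (j - a)\<bar> / real (2 * j choose (2 * a)))"
    if a: "a \<le> j" for a
  proof (cases "2 * a \<le> p")
    case True
    have "(2 * j choose (2 * a)) * (n choose (p - 2 * a)) \<le> (\<Sum>i\<le>p. (2 * j choose i) * (n choose (p - i)))"
      by (rule member_le_sum) (use True in auto)
    also have "\<dots> = (2 * j + n choose p)" by (rule vandermonde)
    finally have "real ((2 * j choose (2 * a)) * (n choose (p - 2 * a))) \<le> real (2 * k choose p)"
      using assms by (simp only: of_nat_le_iff add.commute)
    moreover have "0 < real (2 * j choose (2 * a))" using a by simp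
    ultimately have "real (n choose (p - 2 * a)) \<le> real (2 * k choose p) / real (2 * j choose (2 * a))"
      by (simp add: pos_le_divide_eq mult.commute)
    then have "\<bar>bessel_coeff a * bessel_coeff (j - a)\<bar> * real (n choose (p - 2 * a)) \<le>
        \<bar>bessel_coeff a * bessel_coeff (j - a)\<bar> * (real (2 * k choose p) / real (2 * j choose (2 * a)))"
      by (intro mult_left_mono) auto
    then show ?thesis using True by (simp add: abs_mult mult_ac)
  qed simp
  then have "\<bar>coeff (bessel_row j * [:1, 1:] ^ n) p\<bar> \<le>
    (\<Sum>a\<le>j. real (2 * k choose p) * (\<bar>bessel_coeff a * bessel_coeff (j - a)\<bar> / real (2 * j choose (2 * a))))"
    unfolding coeff_bessel_row_mult by (intro order.trans[OF sum_abs] sum_mono) auto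
  then show ?thesis by (simp add: bessel_weight_def sum_distrib_left)
qed

lemma coeff_row_poly:
  assumes "p + q = 2 * k"
  shows "coeff (row_poly k) p = gf $ p $ q"
proof -
  define T where "T i j = bessel $ i * bessel $ j * (real (p + q - (i + j) choose (p - i)) * bessel_inv $ (p + q - (i + j)))" for i j
  have odd: "bessel $ i = 0" if "odd i" for i using that by (simp add: bessel_def)
  then have T0: "T i j = 0" if "odd i \<or> odd j" for i j using that by (auto simp: T_def)
  have even: "bessel $ (2 * a) = bessel_coeff a" for a by (simp add: bessel_def)
  have "gf $ p $ q = (\<Sum>(i, j)\<in>{..p} \<times> {..q}. T i j)"
    by (simp add: gf_nth T_def sum.cartesian_product)
  also have "\<dots> = (\<Sum>(i, j)\<in>{(i, j). i \<le> p \<and> j \<le> q \<and> even i \<and> even j}. T i j)"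
    by (rule sum.mono_neutral_right) (auto intro!: T0)
  also have "\<dots> = (\<Sum>(n, a)\<in>{(n, a). a \<le> n \<and> 2 * a \<le> p \<and> 2 * (n - a) \<le> q}. T (2 * a) (2 * (n - a)))"
    by (rule sum.reindex_bij_witness[of _ "\<lambda>(n, a). (2 * a, 2 * (n - a))" "\<lambda>(i, j). (i div 2 + j div 2, i div 2)"])
       (auto elim!: evenE)
  also have "\<dots> = (\<Sum>(n, a)\<in>{(n, a). a \<le> n \<and> 2 * a \<le> p \<and> 2 * (n - a) \<le> q}.
      bessel_coeff a * bessel_coeff (n - a) * (real (2 * (k - n) choose (p - 2 * a)) * bessel_inv_coeff (k - n)))"
  proof (intro sum.cong refl, clarify)
    fix n a assume "a \<le> n" "2 * a \<le> p" "2 * (n - a) \<le> q"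
    then have "p + q - (2 * a + 2 * (n - a)) = 2 * (k - n)" using assms by auto
    then show "T (2 * a) (2 * (n - a)) =
      bessel_coeff a * bessel_coeff (n - a) * (real (2 * (k - n) choose (p - 2 * a)) * bessel_inv_coeff (k - n))"
      by (simp add: T_def even bessel_inv_coeff_def)
  qed
  also have "\<dots> = (\<Sum>(n, a)\<in>Sigma {..k} (\<lambda>n. {..n}).
      bessel_inv_coeff (k - n) * (bessel_coeff a * bessel_coeff (n - a) * (if 2 * a \<le> p then real (2 * (k - n) choose (p - 2 * a)) else 0)))"
    by (rule sum.mono_neutral_cong_left) (use assms in \<open>auto split: if_splits\<close>)
  also have "\<dots> = coeff (row_poly k) p"
    by (subst sum.Sigma[symmetric]) (auto simp: row_poly_def coeff_sum coeff_bessel_row_mult sum_distrib_left)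
  finally show ?thesis ..
qed

text \<open>Both forms are combinations of the same polynomials
  \<open>bessel_row j * (1 + X)^(2(k - j))\<close>; only the coefficients of the reciprocal series
  differ, and terms with \<open>j > J\<close> are missing from the second form.\<close>

lemma coeff_row_poly_diff_le:
  assumes "J \<le> k"
  shows "\<bar>coeff (row_poly k - smult c ([:1, 1:] ^ (2 * (k - J)) * row_poly J)) p\<bar> \<le>
    real (2 * k choose p) * (\<Sum>j\<le>k. bessel_weight j *
      \<bar>bessel_inv_coeff (k - j) - (if j \<le> J then c * bessel_inv_coeff (J - j) else 0)\<bar>)"
proof -
  define E where "E j = bessel_inv_coeff (k - j) - (if j \<le> J then c * bessel_inv_coeff (J - j) else 0)" for j
  have "smult c ([:1, 1:] ^ (2 * (k - J)) * row_poly J) =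
    (\<Sum>j\<le>J. smult (c * bessel_inv_coeff (J - j)) (bessel_row j * ([:1, 1:] ^ (2 * (k - J)) * [:1, 1:] ^ (2 * (J - j)))))"
    by (simp add: row_poly_def sum_distrib_left smult_sum_right mult_ac)
  also have "\<dots> = (\<Sum>j\<le>J. smult (c * bessel_inv_coeff (J - j)) (bessel_row j * [:1, 1:] ^ (2 * (k - j))))"
    using assms by (intro sum.cong refl) (simp add: power_add[symmetric] diff_mult_distrib2)
  also have "\<dots> = (\<Sum>j\<le>k. smult (if j \<le> J then c * bessel_inv_coeff (J - j) else 0) (bessel_row j * [:1, 1:] ^ (2 * (k - j))))"
    using assms by (intro sum.mono_neutral_cong_left) auto
  finally have "row_poly k - smult c ([:1, 1:] ^ (2 * (k - J)) * row_poly J) =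
    (\<Sum>j\<le>k. smult (E j) (bessel_row j * [:1, 1:] ^ (2 * (k - j))))"
    by (simp add: row_poly_def E_def sum_subtractf[symmetric] smult_diff_left)
  then have "\<bar>coeff (row_poly k - smult c ([:1, 1:] ^ (2 * (k - J)) * row_poly J)) p\<bar> =
    \<bar>\<Sum>j\<le>k. E j * coeff (bessel_row j * [:1, 1:] ^ (2 * (k - j))) p\<bar>"
    by (simp add: coeff_sum)
  also have "\<dots> \<le> (\<Sum>j\<le>k. \<bar>E j\<bar> * (real (2 * k choose p) * bessel_weight j))"
    by (intro order.trans[OF sum_abs] sum_mono)
       (auto simp: abs_mult intro!: mult_left_mono coeff_bessel_row_mult_le)
  also have "\<dots> = real (2 * k choose p) * (\<Sum>j\<le>k. bessel_weight j * \<bar>E j\<bar>)"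
    by (simp add: sum_distrib_left mult_ac)
  finally show ?thesis by (simp add: E_def)
qed

text \<open>Row \<open>k\<close> is compared with \<open>c (t + s)^(2k - 2J)\<close> times row
  \<open>J\<close>. Row \<open>J\<close> is divisible by \<open>t s\<close>: \<open>t\<close> is
  split off by \<open>pCons\<close>, and \<open>s\<close> shows in the degree \<open>2J - 2\<close>
  of \<open>V\<close>. Hence the comparison row has entries \<open>i j v(i - 1)\<close> with
  log-concave \<open>v\<close>, as \<open>log_concave_perturb\<close> requires. The factor
  \<open>2k (2k - 1)\<close> is the quotient of \<open>(2k)!\<close>, which scales the error, by
  \<open>(2k - 2)!\<close>, which scales the lower bound of \<open>v\<close>.\<close>

lemma gf_count_log_concave:
  assumes V: "row_poly J = pCons 0 V" "ultra_log_concave (2 * J - 2) m V" "0 < m" "1 \<le> J" "J \<le> k"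
    and c: "0 < c"
    and E: "real (2 * k * (2 * k - 1)) * (\<Sum>j\<le>k. bessel_weight j *
      \<bar>bessel_inv_coeff (k - j) - (if j \<le> J then c * bessel_inv_coeff (J - j) else 0)\<bar>) \<le> c * m / 2"
    and pq: "2 \<le> p" "2 \<le> q" "p + q = 2 * k"
    and nonneg: "0 \<le> gf_count (p - 1) (q + 1)" "0 \<le> gf_count (p + 1) (q - 1)"
  shows "gf_count (p - 1) (q + 1) * gf_count (p + 1) (q - 1) \<le> (gf_count p q)\<^sup>2"
proof -
  define e where "e = (\<Sum>j\<le>k. bessel_weight j *
      \<bar>bessel_inv_coeff (k - j) - (if j \<le> J then c * bessel_inv_coeff (J - j) else 0)\<bar>)"
  define W where "W = smult c ([:1, 1:] ^ (2 * (k - J)) * V)"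
  have "2 * J - 2 + 2 * (k - J) = 2 * k - 2" using V by simp
  then have W: "ultra_log_concave (2 * k - 2) (c * m) W"
    using ultra_log_concave_smult[OF ultra_log_concave_mult_power[OF V(2,3), of "2 * (k - J)"] c] by (simp add: W_def)
  define v where "v = weighted_coeff (2 * k - 2) W"
  define M where "M = c * m * fact (2 * k - 2)"
  define \<sigma> where "\<sigma> = real (2 * k * (2 * k - 1)) * e / (c * m)"
  have cm: "0 < c * m" using c V by simp
  have e0: "0 \<le> e" unfolding e_def bessel_weight_def by (intro sum_nonneg mult_nonneg_nonneg) auto
  have \<sigma>: "0 \<le> \<sigma>" "\<sigma> \<le> 1 / 2"
  proof -
    show "0 \<le> \<sigma>" using e0 cm by (simp add: \<sigma>_def)
    show "\<sigma> \<le> 1 / 2" unfolding \<sigma>_def pos_divide_le_eq[OF cm] using E by (simp add: e_def)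
  qed
  have lo: "M \<le> v i" if "i \<le> 2 * k - 2" for i
    using W that by (auto simp: ultra_log_concave_def v_def M_def)
  have lc: "v (i - 1) * v (i + 1) \<le> (v i)\<^sup>2" if "0 < i" "i < 2 * k - 2" for i
    using W that by (cases i) (auto simp: ultra_log_concave_def v_def)
  have err: "\<bar>gf_count i j - real i * real j * v (i - 1)\<bar> \<le> \<sigma> * M" if ij: "0 < i" "0 < j" "i + j = 2 * k" for i j
  proof -
    have "row_poly k - smult c ([:1, 1:] ^ (2 * (k - J)) * row_poly J) = row_poly k - pCons 0 W"
      by (simp add: V(1) W_def)
    then have "\<bar>coeff (row_poly k - pCons 0 W) i\<bar> \<le> real (2 * k choose i) * e"
      using coeff_row_poly_diff_le[OF V(5), of c i] by (simp only: e_def)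
    moreover have "coeff (row_poly k - pCons 0 W) i = gf $ i $ j - coeff W (i - 1)"
      using coeff_row_poly[OF ij(3)] ij(1) by (cases i) auto
    ultimately have f1: "fact i * fact j * \<bar>gf $ i $ j - coeff W (i - 1)\<bar> \<le> fact i * fact j * (real (2 * k choose i) * e)"
      by (intro mult_left_mono) auto
    \<comment> \<open>The binomial coefficient in the error bound makes the absolute error uniform
      along the row.\<close>
    have f2: "fact i * fact j * real (2 * k choose i) = fact (2 * k)"
      using ij by (subst binomial_fact) (auto simp: diff_add_inverse simp flip: ij(3))
    have f3: "fact (2 * k) = real (2 * k * (2 * k - 1)) * fact (2 * k - 2)"
    proof -
      have "2 * k = Suc (Suc (2 * k - 2))" using ij by simp
      then have "fact (2 * k) = real (Suc (Suc (2 * k - 2))) * (real (Suc (2 * k - 2)) * fact (2 * k - 2))"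
        by (metis fact_Suc)
      moreover have "Suc (Suc (2 * k - 2)) = 2 * k" "Suc (2 * k - 2) = 2 * k - 1" using ij by simp_all
      ultimately show ?thesis by (simp only: of_nat_mult mult.assoc)
    qed
    have f4: "fact i * fact j * (gf $ i $ j - coeff W (i - 1)) = gf_count i j - real i * real j * v (i - 1)"
    proof -
      obtain i' j' where s: "i = Suc i'" "j = Suc j'" using ij by (metis gr0_implies_Suc)
      then have "2 * k - 2 - (i - 1) = j'" using ij by simp
      then show ?thesis using s by (simp add: gf_count_def v_def weighted_coeff_def algebra_simps)
    qed
    have f5: "\<sigma> * M = real (2 * k * (2 * k - 1)) * e * fact (2 * k - 2)"
      using cm V(3) c by (simp add: \<sigma>_def M_def)
    have "\<bar>gf_count i j - real i * real j * v (i - 1)\<bar> = fact i * fact j * \<bar>gf $ i $ j - coeff W (i - 1)\<bar>"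
      unfolding f4[symmetric] by (simp add: abs_mult)
    also have "\<dots> \<le> (fact i * fact j * real (2 * k choose i)) * e" using f1 by (simp only: mult.assoc)
    also have "\<dots> = \<sigma> * M" unfolding f2 f3 f5 by simp
    finally show ?thesis .
  qed
  have r: "real (p - 1) = real p - 1" "real (q - 1) = real q - 1" using pq by auto
  show ?thesis
  proof (rule log_concave_perturb[of "real p" "real q" \<sigma> M "v (p - 2)" "v (p - 1)" "v p"])
    show "v (p - 2) * v p \<le> (v (p - 1))\<^sup>2"
      using lc[of "p - 1"] pq by (simp add: numeral_2_eq_2)
    show "\<bar>gf_count (p - 1) (q + 1) - (real p - 1) * (real q + 1) * v (p - 2)\<bar> \<le> \<sigma> * M"
      using err[of "p - 1" "q + 1"] pq r by (simp add: numeral_2_eq_2 add.commute)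
    show "\<bar>gf_count (p + 1) (q - 1) - (real p + 1) * (real q - 1) * v p\<bar> \<le> \<sigma> * M"
      using err[of "p + 1" "q - 1"] pq r by (simp add: add.commute)
    show "\<bar>gf_count p q - real p * real q * v (p - 1)\<bar> \<le> \<sigma> * M"
      using err[of p q] pq by simp
    show "0 < M" using cm by (simp add: M_def)
  qed (use \<sigma> lo pq nonneg in auto)
qed

subsection \<open>Numerical bounds for the reciprocal series\<close>

text \<open>
  \<open>zeta\<close> approximates the smallest zero of \<open>\<Sum>a. bessel_coeff a * y ^ a\<close> (in the variable \<open>y = x\<^sup>2\<close>),
  so that the coefficients of the reciprocal, scaled by \<open>zeta ^ m\<close>, are almost constant from some
  point on. The tables contain \<open>10 ^ 12 * scaled_bessel i\<close> and \<open>10 ^ 9 * scaled_inv m\<close>, rounded, the second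
  one being continued by the limit value.
\<close>

definition zeta :: real where
  "zeta = 3670492661 / 10 ^ 9"

definition scaled_inv :: "nat \<Rightarrow> real" where
  "scaled_inv m = bessel_inv_coeff m * zeta ^ m"

definition scaled_bessel :: "nat \<Rightarrow> real" where
  "scaled_bessel a = zeta ^ a / (fact a * fact (Suc a))"

definition bessel_table :: "nat \<Rightarrow> int" where
  "bessel_table i = nth_default0 [1000000000000, 1835246330500, 1122709697871, 343408142206, 63023853285,
     7710953032, 673880869, 44169193, 2251704, 91832, 3064, 85, 2] i"

definition limit_table :: int where
  "limit_table = 2482871935"

definition inv_table :: "nat \<Rightarrow> int" where
  "inv_table m = (if m < 15 then nth_default0 [1000000000, 1835246331, 2245419396, 2403856995, 2457930278,
     2475215923, 2480555480, 2482176116, 2482663673, 2482809711, 2482853361, 2482866395, 2482870285,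
     2482871445, 2482871792] m else limit_table)"

text \<open>Numerator and denominator of \<open>scaled_bessel i\<close>, left unreduced so that only
  integers are multiplied.\<close>

primrec bessel_fraction :: "nat \<Rightarrow> int \<times> int" where
  "bessel_fraction 0 = (1, 1)"
| "bessel_fraction (Suc i) = (case bessel_fraction i of (x, y) \<Rightarrow>
     (x * 3670492661, y * (1000000000 * ((int i + 1) * (int i + 2)))))"

lemma bessel_table_check:
  "list_all (\<lambda>i. case bessel_fraction i of (x, y) \<Rightarrow> \<bar>x * 1000000000000 - bessel_table i * y\<bar> \<le> y) [0..<14]"
  by code_simp

text \<open>In units of \<open>10^-21\<close>. The second sum pays for rounding in
  \<open>bessel_table\<close>, one unit per entry. The bound means \<open>16 / 10^8\<close>;
  multiplied by the a priori bound 5/2 for \<open>scaled_inv\<close> it becomes the accuracy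
  \<open>4 / 10^7\<close> of \<open>scaled_inv_approx\<close>.\<close>

lemma residual_check:
  "sum_list (map (\<lambda>n. \<bar>sum_list (map (\<lambda>i. (if even i then 1 else - 1) * bessel_table i * inv_table (n - i)) [0..<Suc n])\<bar> +
     sum_list (map (\<lambda>i. inv_table (n - i)) [0..<Suc n])) [1..<54]) \<le> 160000000000000"
  by code_simp

text \<open>An upper bound for \<open>bessel_weight j * zeta ^ j\<close> in units of
  \<open>10^-24\<close>: the tables are increased by their error 1 and the quotients rounded up. For
  \<open>j > 13\<close> the binomial coefficients are replaced by the lower bound 1, which saves
  evaluating them.\<close>

definition weight_table :: "nat \<Rightarrow> int" where
  "weight_table j = sum_list (map (\<lambda>a. (bessel_table a + 1) * (bessel_table (j - a) + 1) div
     (if j \<le> 13 then nth_default0 (hd (pascal (2 * j))) (2 * a) else 1) + 1) [0..<Suc j])"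

text \<open>In units of \<open>10^-33\<close>, so the bound means \<open>8 / 10^5\<close>. The
  summand 800 is twice the accuracy \<open>4 / 10^7\<close> of the table, in units of
  \<open>10^-9\<close>.\<close>

lemma error_check:
  "sum_list (map (\<lambda>j. weight_table j * (limit_table - (if j \<le> 13 then inv_table (13 - j) else 0) + 800)) [0..<54])
     \<le> 8 * 10 ^ 28"
  by code_simp

lemma inv_table_mono_check: "list_all (\<lambda>i. 0 < inv_table i \<and> inv_table i \<le> inv_table (Suc i)) [0..<15]"
  by code_simp

section \<open>From the integer checks to real bounds\<close>

lemma bessel_inv_recurrence:
  "(\<Sum>i\<le>n. bessel_coeff i * bessel_inv_coeff (n - i)) = (if n = 0 then 1 else 0)"
proof -
  have odd: "bessel $ i = 0" if "odd i" for i using that by (simp add: bessel_def)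
  have "(bessel * bessel_inv) $ (2 * n) = (\<Sum>i\<le>2 * n. bessel $ i * bessel_inv $ (2 * n - i))"
    by (simp add: fps_mult_nth atLeast0AtMost)
  also have "\<dots> = (\<Sum>i\<in>(*) 2 ` {..n}. bessel $ i * bessel_inv $ (2 * n - i))"
  proof (rule sum.mono_neutral_right)
    show "\<forall>i\<in>{..2 * n} - (*) 2 ` {..n}. bessel $ i * bessel_inv $ (2 * n - i) = 0"
    proof
      fix i assume i: "i \<in> {..2 * n} - (*) 2 ` {..n}"
      have "odd i"
      proof
        assume "even i"
        then obtain m where "i = 2 * m" by (elim evenE)
        then show False using i by auto
      qed
      then show "bessel $ i * bessel_inv $ (2 * n - i) = 0" using odd by simp
    qed
  qed auto
  also have "\<dots> = (\<Sum>i\<le>n. bessel_coeff i * bessel_inv_coeff (n - i))"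
    by (subst sum.reindex)
       (auto simp: inj_on_def bessel_def bessel_inv_coeff_def diff_mult_distrib2 intro!: sum.cong)
  finally show ?thesis by (simp add: bessel_inv_mult split: if_splits)
qed

lemma zeta_pos: "0 < zeta"
  by (simp add: zeta_def)

lemma bessel_coeff_zeta: "bessel_coeff a * zeta ^ a = (if even a then 1 else - 1) * scaled_bessel a"
  by (simp add: bessel_coeff_def scaled_bessel_def)

lemma abs_bessel_coeff_zeta: "\<bar>bessel_coeff a\<bar> * zeta ^ a = scaled_bessel a"
  by (simp add: bessel_coeff_def scaled_bessel_def abs_divide power_abs abs_mult)

lemma scaled_bessel_nonneg: "0 \<le> scaled_bessel a"
  using zeta_pos by (simp add: scaled_bessel_def)

lemma scaled_bessel_Suc: "scaled_bessel (Suc i) = scaled_bessel i * (zeta / ((real i + 1) * (real i + 2)))"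
proof -
  have "fact (Suc (Suc i)) = (real i + 2) * fact (Suc i)" "fact (Suc i) = (real i + 1) * fact i"
    by (simp_all add: algebra_simps)
  then show ?thesis unfolding scaled_bessel_def by (simp add: field_simps del: fact_Suc)
qed

lemma scaled_bessel_table: "\<bar>scaled_bessel i * 10 ^ 12 - of_int (bessel_table i)\<bar> \<le> 1"
proof -
  have small: "\<bar>scaled_bessel i * 10 ^ 12 - of_int (bessel_table i)\<bar> \<le> 1" if "i < 14" for i
  proof -
    have frac: "0 < snd (bessel_fraction i) \<and>
        scaled_bessel i = of_int (fst (bessel_fraction i)) / of_int (snd (bessel_fraction i))" for i
    proof (induction i)
      case (Suc i)
      then show ?case
        by (auto simp: scaled_bessel_Suc zeta_def case_prod_unfold intro!: mult_pos_pos)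
    qed (simp add: scaled_bessel_def)
    obtain x y where xy: "bessel_fraction i = (x, y)" by (cases "bessel_fraction i")
    then have y: "0 < y" and s: "scaled_bessel i = of_int x / of_int y" using frac[of i] by auto
    have "\<bar>x * 1000000000000 - bessel_table i * y\<bar> \<le> y"
      using bessel_table_check that xy by (auto simp: list_all_iff split: prod.splits)
    then have "real_of_int \<bar>x * 1000000000000 - bessel_table i * y\<bar> \<le> real_of_int y" by (simp only: of_int_le_iff)
    then have "\<bar>real_of_int x * 10 ^ 12 - of_int (bessel_table i) * of_int y\<bar> \<le> of_int y" by simp
    moreover have "scaled_bessel i * 10 ^ 12 - of_int (bessel_table i) =
        (real_of_int x * 10 ^ 12 - of_int (bessel_table i) * of_int y) / of_int y"
      using y by (simp add: s field_simps)
    ultimately show ?thesis using y by (simp add: abs_divide)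
  qed
  have table_0: "bessel_table i = 0" if "13 \<le> i" for i
    using that by (simp add: bessel_table_def nth_default0_eq)
  show ?thesis
  proof (cases "i < 14")
    case False
    \<comment> \<open>Index 13 is checked although its table value is 0; as the terms decrease, it
      covers the whole tail.\<close>
    have dec: "scaled_bessel (Suc i) \<le> scaled_bessel i" if "1 \<le> i" for i
    proof -
      have "(1 + 1) * (1 + 2) \<le> (real i + 1) * (real i + 2)" using that by (intro mult_mono) auto
      then have "zeta / ((real i + 1) * (real i + 2)) \<le> 1" by (simp add: zeta_def)
      then show ?thesis unfolding scaled_bessel_Suc using scaled_bessel_nonneg by (rule mult_left_le)
    qed
    have "scaled_bessel i \<le> scaled_bessel 13"
    proof -
      have "13 \<le> i" using False by simp
      then show ?thesis
        by (induction i rule: dec_induct) (auto intro: order.trans[OF dec])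
    qed
    moreover have "scaled_bessel 13 * 10 ^ 12 \<le> 1" using small[of 13] table_0[of 13] by (simp add: abs_le_iff)
    ultimately show ?thesis using scaled_bessel_nonneg[of i] table_0[of i] False by auto
  qed (rule small)
qed

definition inv_approx :: "nat \<Rightarrow> real" where
  "inv_approx m = of_int (inv_table m) / 10 ^ 9"

lemma inv_approx_mono: "i \<le> j \<Longrightarrow> inv_approx i \<le> inv_approx j"
proof (rule lift_Suc_mono_le)
  fix n show "inv_approx n \<le> inv_approx (Suc n)"
  proof (cases "n < 15")
    case True
    then have "inv_table n \<le> inv_table (Suc n)" using inv_table_mono_check by (auto simp: list_all_iff)
    then show ?thesis by (simp add: inv_approx_def divide_right_mono)
  qed (simp add: inv_approx_def inv_table_def)
qed

lemma inv_approx_pos: "0 < inv_approx i"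
proof -
  have "0 < inv_table 0" using inv_table_mono_check by (auto simp: list_all_iff)
  then have "0 < inv_approx 0" by (simp add: inv_approx_def)
  then show ?thesis using inv_approx_mono[of 0 i] by simp
qed

lemma inv_approx_le: "inv_approx i \<le> of_int limit_table / 10 ^ 9"
  using inv_approx_mono[of i "max i 15"] by (simp add: inv_approx_def inv_table_def)

definition residual :: "nat \<Rightarrow> real" where
  "residual n = (\<Sum>i\<le>n. (if even i then 1 else - 1) * scaled_bessel i * inv_approx (n - i))"

text \<open>An a posteriori estimate: with the exact reciprocal \<open>K\<close> of \<open>G\<close>
  and the approximation \<open>Y\<close>, the product \<open>G * Y\<close> is the residual, so
  \<open>Y = residual * K\<close>. The residual starts with 1, hence its other coefficients alone
  produce the error.\<close>

lemma inv_approx_eq: "inv_approx n = (\<Sum>i\<le>n. residual i * scaled_inv (n - i))"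
proof -
  define G where "G = Abs_fps (\<lambda>i. (if even i then 1 else - 1) * scaled_bessel i)"
  define K where "K = Abs_fps scaled_inv"
  define Y where "Y = Abs_fps inv_approx"
  have GY: "(G * Y) $ i = residual i" for i
    by (simp add: G_def Y_def residual_def fps_mult_nth atLeast0AtMost)
  have "G * K = 1"
  proof (rule fps_ext)
    fix n
    have "(G * K) $ n = (\<Sum>i\<le>n. (bessel_coeff i * bessel_inv_coeff (n - i)) * (zeta ^ i * zeta ^ (n - i)))"
      unfolding G_def K_def fps_mult_nth atLeast0AtMost fps_nth_Abs_fps bessel_coeff_zeta[symmetric] scaled_inv_def
      by (simp only: mult_ac)
    also have "\<dots> = (\<Sum>i\<le>n. (bessel_coeff i * bessel_inv_coeff (n - i)) * zeta ^ n)"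
      by (intro sum.cong) (auto simp: power_add[symmetric])
    also have "\<dots> = 1 $ n" by (simp add: sum_distrib_right[symmetric] bessel_inv_recurrence)
    finally show "(G * K) $ n = 1 $ n" .
  qed
  then have "Y = (G * Y) * K" by (simp add: mult_ac)
  then have "Y $ n = ((G * Y) * K) $ n" by (rule arg_cong)
  also have "\<dots> = (\<Sum>i\<le>n. (G * Y) $ i * K $ (n - i))" by (simp add: fps_mult_nth[of "G * Y"] atLeast0AtMost)
  finally show ?thesis by (simp add: GY) (simp add: Y_def K_def)
qed

lemma sum_residual_le: "(\<Sum>n = 1..<54. \<bar>residual n\<bar>) \<le> 16 / 10 ^ 8"
proof -
  have r: "\<bar>residual n\<bar> \<le> (of_int \<bar>\<Sum>i\<le>n. (if even i then 1 else - 1) * bessel_table i * inv_table (n - i)\<bar> +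
      of_int (\<Sum>i\<le>n. inv_table (n - i))) / 10 ^ 21" for n
  proof -
    define s where "s i = (if even i then 1 else - 1 :: real)" for i :: nat
    define e where "e i = scaled_bessel i * 10 ^ 12 - of_int (bessel_table i)" for i
    have e: "\<bar>e i\<bar> \<le> 1" for i using scaled_bessel_table by (simp add: e_def)
    have "residual n * 10 ^ 21 = (\<Sum>i\<le>n. s i * of_int (bessel_table i) * of_int (inv_table (n - i))) +
        (\<Sum>i\<le>n. s i * e i * of_int (inv_table (n - i)))"
      unfolding residual_def sum_distrib_right sum.distrib[symmetric]
      by (intro sum.cong) (auto simp: s_def e_def inv_approx_def field_simps)
    moreover have "\<bar>\<Sum>i\<le>n. s i * e i * of_int (inv_table (n - i))\<bar> \<le> (\<Sum>i\<le>n. of_int (inv_table (n - i)))"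
    proof (rule order.trans[OF sum_abs], rule sum_mono)
      fix i
      have "0 < real_of_int (inv_table (n - i))" using inv_approx_pos[of "n - i"] by (simp add: inv_approx_def zero_less_divide_iff)
      then show "\<bar>s i * e i * of_int (inv_table (n - i))\<bar> \<le> of_int (inv_table (n - i))"
        using mult_right_mono[OF e[of i], of "of_int (inv_table (n - i))"] by (simp add: abs_mult s_def)
    qed
    moreover have "(\<Sum>i\<le>n. s i * of_int (bessel_table i) * of_int (inv_table (n - i))) =
        real_of_int (\<Sum>i\<le>n. (if even i then 1 else - 1) * bessel_table i * inv_table (n - i))"
      unfolding of_int_sum by (intro sum.cong) (auto simp: s_def)
    ultimately have "\<bar>residual n * 10 ^ 21\<bar> \<le> of_int \<bar>\<Sum>i\<le>n. (if even i then 1 else - 1) * bessel_table i * inv_table (n - i)\<bar> +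
      of_int (\<Sum>i\<le>n. inv_table (n - i))"
      by (simp only: of_int_abs of_int_sum)
    then show ?thesis by (simp add: abs_mult pos_le_divide_eq)
  qed
  have "(\<Sum>n = 1..<54. \<bar>residual n\<bar>) \<le> (\<Sum>n = 1..<54. (of_int \<bar>\<Sum>i\<le>n. (if even i then 1 else - 1) * bessel_table i * inv_table (n - i)\<bar> +
      of_int (\<Sum>i\<le>n. inv_table (n - i))) / 10 ^ 21)"
    by (intro sum_mono r)
  also have "\<dots> = real_of_int (\<Sum>n = 1..<54. \<bar>\<Sum>i\<le>n. (if even i then 1 else - 1) * bessel_table i * inv_table (n - i)\<bar> +
      (\<Sum>i\<le>n. inv_table (n - i))) / 10 ^ 21"
    by (simp only: of_int_sum of_int_add sum_divide_distrib)
  also have "\<dots> \<le> real_of_int 160000000000000 / 10 ^ 21"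
  proof (intro divide_right_mono)
    have "(\<Sum>n = 1..<54. \<bar>\<Sum>i\<le>n. (if even i then 1 else - 1) * bessel_table i * inv_table (n - i)\<bar> +
      (\<Sum>i\<le>n. inv_table (n - i))) \<le> 160000000000000"
      using residual_check
      by (simp only: interv_sum_list_conv_sum_set_nat set_upt atLeast0LessThan lessThan_Suc_atMost)
    then show "real_of_int (\<Sum>n = 1..<54. \<bar>\<Sum>i\<le>n. (if even i then 1 else - 1) * bessel_table i * inv_table (n - i)\<bar> +
      (\<Sum>i\<le>n. inv_table (n - i))) \<le> real_of_int 160000000000000"
      by (simp only: of_int_le_iff)
  qed simp
  finally show ?thesis by simp
qed

text \<open>The induction hypothesis serves only to bound the earlier exact values by 5/2. The error
  is then at most 5/2 times the sum of all residuals, so it does not accumulate.\<close>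

lemma scaled_inv_approx: "n < 54 \<Longrightarrow> \<bar>scaled_inv n - inv_approx n\<bar> \<le> 4 / 10 ^ 7"
proof (induction n rule: less_induct)
  case (less n)
  have r0: "residual 0 = 1"
    by (simp add: residual_def scaled_bessel_def inv_approx_def inv_table_def)
  have "{..n} = insert 0 {1..<Suc n}" by auto
  then have "inv_approx n = scaled_inv n + (\<Sum>i = 1..<Suc n. residual i * scaled_inv (n - i))"
    using inv_approx_eq[of n] by (simp add: r0)
  then have "\<bar>scaled_inv n - inv_approx n\<bar> \<le> (\<Sum>i = 1..<Suc n. \<bar>residual i * scaled_inv (n - i)\<bar>)"
    using sum_abs[of "\<lambda>i. residual i * scaled_inv (n - i)" "{1..<Suc n}"] by linarith
  also have "\<dots> \<le> (\<Sum>i = 1..<Suc n. \<bar>residual i\<bar> * (5 / 2))"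
  proof (rule sum_mono)
    fix i assume i: "i \<in> {1..<Suc n}"
    then have "\<bar>scaled_inv (n - i) - inv_approx (n - i)\<bar> \<le> 4 / 10 ^ 7" using less by auto
    moreover have "inv_approx (n - i) \<le> 2 + 483 / 1000"
      using inv_approx_le[of "n - i"] by (simp add: limit_table_def)
    moreover have "4 / 10 ^ 7 \<le> (1 / 1000 :: real)" by simp
    ultimately have "\<bar>scaled_inv (n - i)\<bar> \<le> 5 / 2"
      using inv_approx_pos[of "n - i"] by linarith
    then show "\<bar>residual i * scaled_inv (n - i)\<bar> \<le> \<bar>residual i\<bar> * (5 / 2)"
      by (simp only: abs_mult) (intro mult_left_mono, auto)
  qed
  also have "\<dots> \<le> (\<Sum>i = 1..<54. \<bar>residual i\<bar> * (5 / 2))"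
    using less.prems by (intro sum_mono2) auto
  also have "\<dots> \<le> 16 / 10 ^ 8 * (5 / 2)"
    unfolding sum_distrib_right[symmetric] by (intro mult_right_mono sum_residual_le) simp
  finally show ?case by simp
qed

lemma bessel_weight_le: "bessel_weight j * zeta ^ j \<le> of_int (weight_table j) / 10 ^ 24"
proof -
  define d where "d a = (if j \<le> 13 then nth_default0 (hd (pascal (2 * j))) (2 * a) else 1)" for a
  have d: "1 \<le> d a" "real_of_int (d a) \<le> real (2 * j choose (2 * a))" if "a \<le> j" for a
  proof -
    have "hd (pascal (2 * j)) = map (\<lambda>i. int (2 * j choose i)) [0..<Suc (2 * j)]"
      unfolding pascal_eq by (simp add: hd_rev)
    then have n: "nth_default0 (hd (pascal (2 * j))) (2 * a) = int (2 * j choose (2 * a))"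
      using that by (auto simp: nth_default0_eq simp del: upt_Suc)
    have c: "1 \<le> (2 * j choose (2 * a))" using that by (simp add: Suc_le_eq)
    have "d a = int (2 * j choose (2 * a)) \<or> d a = 1"
      unfolding d_def n by (cases "j \<le> 13") simp_all
    then show "1 \<le> d a" "real_of_int (d a) \<le> real (2 * j choose (2 * a))"
      using c by (metis of_nat_1 of_nat_le_iff order_refl, metis c of_int_1 of_int_of_nat_eq of_nat_1 of_nat_le_iff order_refl)
  qed
  have "bessel_weight j * zeta ^ j = (\<Sum>a\<le>j. scaled_bessel a * scaled_bessel (j - a) / real (2 * j choose (2 * a)))"
    unfolding bessel_weight_def sum_distrib_right
  proof (intro sum.cong refl)
    fix a assume "a \<in> {..j}"
    then have "zeta ^ j = zeta ^ a * zeta ^ (j - a)" by (simp add: power_add[symmetric])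
    then show "\<bar>bessel_coeff a * bessel_coeff (j - a)\<bar> / real (2 * j choose (2 * a)) * zeta ^ j =
      scaled_bessel a * scaled_bessel (j - a) / real (2 * j choose (2 * a))"
      by (simp add: abs_bessel_coeff_zeta[symmetric] abs_mult)
  qed
  also have "\<dots> \<le> (\<Sum>a\<le>j. real_of_int ((bessel_table a + 1) * (bessel_table (j - a) + 1) div d a + 1) / 10 ^ 24)"
  proof (rule sum_mono)
    fix a assume a: "a \<in> {..j}"
    define x where "x = (bessel_table a + 1) * (bessel_table (j - a) + 1)"
    have sb: "scaled_bessel i * 10 ^ 12 \<le> of_int (bessel_table i + 1)" for i
      using scaled_bessel_table[of i] by (simp add: abs_le_iff)
    have "(scaled_bessel a * 10 ^ 12) * (scaled_bessel (j - a) * 10 ^ 12) \<le>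
        of_int (bessel_table a + 1) * of_int (bessel_table (j - a) + 1)"
      using scaled_bessel_nonneg by (intro mult_mono' sb) auto
    then have "scaled_bessel a * scaled_bessel (j - a) * 10 ^ 24 \<le> of_int x" by (simp add: x_def)
    moreover have "0 \<le> scaled_bessel a * scaled_bessel (j - a) * 10 ^ 24" using scaled_bessel_nonneg by simp
    ultimately have "scaled_bessel a * scaled_bessel (j - a) * 10 ^ 24 / real (2 * j choose (2 * a)) \<le> of_int x / of_int (d a)"
      using d[of a] a by (intro frac_le) auto
    also have "\<dots> \<le> of_int (x div d a + 1)"
      using real_of_int_floor_add_one_ge[of "of_int x / of_int (d a)"] by (simp add: floor_divide_of_int_eq)
    finally show "scaled_bessel a * scaled_bessel (j - a) / real (2 * j choose (2 * a)) \<le>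
        real_of_int ((bessel_table a + 1) * (bessel_table (j - a) + 1) div d a + 1) / 10 ^ 24"
      by (simp add: x_def pos_le_divide_eq)
  qed
  also have "\<dots> = of_int (weight_table j) / 10 ^ 24"
    unfolding weight_table_def d_def interv_sum_list_conv_sum_set_nat
    by (simp only: set_upt atLeast0LessThan lessThan_Suc_atMost of_int_sum sum_divide_distrib)
  finally show ?thesis .
qed

text \<open>The differences are bounded uniformly in \<open>k\<close>, so that one check with the
  limit value covers the whole range.\<close>

lemma scaled_error_le:
  assumes "13 \<le> k" "k < 54"
  shows "(\<Sum>j\<le>k. bessel_weight j * zeta ^ j * \<bar>scaled_inv (k - j) - (if j \<le> 13 then scaled_inv (13 - j) else 0)\<bar>) \<le> 8 / 10 ^ 5"
proof -
  define d where "d j = limit_table - (if j \<le> 13 then inv_table (13 - j) else 0) + 800" for j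
  have w0: "0 \<le> bessel_weight j * zeta ^ j" for j
    using zeta_pos unfolding bessel_weight_def by (intro mult_nonneg_nonneg sum_nonneg) auto
  have W0: "0 \<le> real_of_int (weight_table j) / 10 ^ 24" for j
    using order.trans[OF w0 bessel_weight_le] .
  have d: "\<bar>scaled_inv (k - j) - (if j \<le> 13 then scaled_inv (13 - j) else 0)\<bar> \<le> of_int (d j) / 10 ^ 9" if "j \<le> k" for j
  proof (cases "j \<le> 13")
    case True
    \<comment> \<open>Monotonicity places the value at \<open>k - j\<close> between the one at
      \<open>13 - j\<close> and the limit, so their distance is at most that of the end
      points.\<close>
    have "inv_approx (13 - j) \<le> inv_approx (k - j)" using assms by (intro inv_approx_mono) auto
    moreover have "of_int (d j) / 10 ^ 9 = of_int limit_table / 10 ^ 9 - inv_approx (13 - j) + 8 / 10 ^ 7"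
      using True by (simp add: d_def inv_approx_def field_simps)
    moreover have "\<bar>scaled_inv (k - j) - inv_approx (k - j)\<bar> \<le> 4 / 10 ^ 7"
        "\<bar>scaled_inv (13 - j) - inv_approx (13 - j)\<bar> \<le> 4 / 10 ^ 7"
      by (rule scaled_inv_approx, use assms in simp)+
    ultimately show ?thesis
      using inv_approx_le[of "k - j"] True unfolding abs_le_iff by (simp only: if_True) linarith
  next
    case False
    have "of_int (d j) / 10 ^ 9 = of_int limit_table / 10 ^ 9 + 8 / (10 ^ 7 :: real)"
      using False by (simp add: d_def field_simps)
    moreover have "\<bar>scaled_inv (k - j) - inv_approx (k - j)\<bar> \<le> 4 / 10 ^ 7"
      by (rule scaled_inv_approx) (use assms in simp)
    ultimately show ?thesis
      using inv_approx_le[of "k - j"] inv_approx_pos[of "k - j"] False unfolding abs_le_iff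
      by (simp only: if_False) linarith
  qed
  have d0: "0 \<le> real_of_int (d j) / 10 ^ 9" for j
    using inv_approx_le[of "13 - j"] by (auto simp: d_def inv_approx_def limit_table_def)
  have "(\<Sum>j\<le>k. bessel_weight j * zeta ^ j * \<bar>scaled_inv (k - j) - (if j \<le> 13 then scaled_inv (13 - j) else 0)\<bar>)
    \<le> (\<Sum>j\<le>k. of_int (weight_table j) / 10 ^ 24 * (of_int (d j) / 10 ^ 9))"
    by (intro sum_mono mult_mono bessel_weight_le d W0) auto
  also have "\<dots> \<le> (\<Sum>j<54. of_int (weight_table j) / 10 ^ 24 * (of_int (d j) / 10 ^ 9))"
    using assms by (intro sum_mono2 mult_nonneg_nonneg W0 d0) auto
  also have "\<dots> = real_of_int (\<Sum>j<54. weight_table j * d j) / 10 ^ 33"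
    by (simp add: sum_divide_distrib)
  also have "\<dots> \<le> real_of_int (8 * 10 ^ 28) / 10 ^ 33"
  proof (intro divide_right_mono)
    have "(\<Sum>j<54. weight_table j * d j) \<le> 8 * 10 ^ 28"
      using error_check unfolding d_def
      by (simp only: interv_sum_list_conv_sum_set_nat set_upt atLeast0LessThan)
    then show "real_of_int (\<Sum>j<54. weight_table j * d j) \<le> real_of_int (8 * 10 ^ 28)"
      by (simp only: of_int_le_iff)
  qed simp
  finally show ?thesis by simp
qed

text \<open>The inequality of \<open>scale_bound\<close> cleared of denominators:
  \<open>17808 / 10^4\<close> is \<open>2 * 11130 * 8 / 10^5\<close>, the second factor is
  \<open>24!\<close>, and \<open>10^117\<close> is the denominator of
  \<open>zeta ^ 13\<close>.\<close>

lemma scale_check: "17808 * 620448401733239439360000 * 10 ^ 117 \<le> (10 ^ 4 * 3670492661 ^ 13 * 56535215267979888 :: int)"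
  by code_simp

lemma fact24: "fact 24 = (620448401733239439360000 :: real)"
  by (simp add: fact_numeral)

lemma scale_bound: "11130 * (8 / 10 ^ 5) \<le> zeta ^ 13 * (56535215267979888 / fact 24) / 2"
proof -
  have "real_of_int (17808 * 620448401733239439360000 * 10 ^ 117) \<le> real_of_int (10 ^ 4 * 3670492661 ^ 13 * 56535215267979888)"
    using scale_check by (simp only: of_int_le_iff)
  then have "17808 * 620448401733239439360000 * 10 ^ 117 \<le> (10 ^ 4 * 3670492661 ^ 13 * 56535215267979888 :: real)"
    by (simp only: of_int_mult of_int_power of_int_numeral)
  moreover have "zeta ^ 13 = 3670492661 ^ 13 / 10 ^ 117"
    by (simp only: zeta_def power_divide power_mult[symmetric]) simp
  moreover have "17808 / 10 ^ 4 \<le> x / z * (y / w)" if "17808 * w * z \<le> 10 ^ 4 * x * y" "0 < z" "0 < w" for x y z w :: real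
    using that by (simp add: field_simps)
  ultimately have "17808 / 10 ^ 4 \<le> zeta ^ 13 * (56535215267979888 / fact 24)"
    unfolding fact24 by (simp only: zero_less_numeral zero_less_power)
  then show ?thesis by simp
qed
subsection \<open>Conclusion\<close>

lemma coeff_row_poly_eq_0:
  assumes "2 * k < p"
  shows "coeff (row_poly k) p = 0"
proof -
  have "2 * (k - j) < p - 2 * a" if "a \<le> j" "j \<le> k" for a j
    using assms that by linarith
  then show ?thesis
    by (auto simp: row_poly_def coeff_sum coeff_bessel_row_mult intro!: sum.neutral)
qed

lemma usorted_row_nth: "i \<le> 2 * k \<Longrightarrow> usorted_row k ! i = int (usorted_count i (2 * k - i))"
  by (simp add: usorted_row_def del: upt_Suc)

text \<open>
  The constant is the integer part of the smallest quotient of an entry of row 13 by the weight \<open>p q\<close>.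
\<close>

lemma row_13:
  obtains V where "row_poly 13 = pCons 0 V" "ultra_log_concave 24 (56535215267979888 / fact 24) V"
proof -
  have rows: "rows (rev (pascal 26)) 13 = (map usorted_row [0..<Suc 13], map (\<lambda>m. int (usorted_total (2 * m + 1))) [0..<Suc 13])"
    by (rule rows_eq) simp
  have "last (map usorted_row [0..<Suc 13]) = usorted_row 13"
    by (simp only: upt_Suc_append le0 map_append list.map last_snoc)
  then have slc: "row_strongly_log_concave 13 (usorted_row 13)" and lb: "row_lower_bound 13 56535215267979888 (usorted_row 13)"
    using first_rows_check unfolding rows Let_def fst_conv by metis+
  obtain a V where V: "row_poly 13 = pCons a V" by (rule pCons_cases)
  have c: "coeff (row_poly 13) p = real (usorted_count p (26 - p)) / (fact p * fact (26 - p))" if "p \<le> 26" for p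
    using coeff_row_poly[of p "26 - p" 13] that by (simp add: usorted_count_eq_gf_count gf_count_def)
  have "a = 0" using c[of 0] V by (simp add: usorted_count_0_left)
  have cV: "coeff V i = coeff (row_poly 13) (Suc i)" for i using V by simp
  \<comment> \<open>Dividing the form by \<open>t s\<close> replaces the weight \<open>p! q!\<close>
    by \<open>(p - 1)! (q - 1)!\<close>. So the weighted coefficients of \<open>V\<close> are the
    entries of the row divided by \<open>p q\<close>, where \<open>p = i + 1\<close> and
    \<open>q = 25 - i\<close>.\<close>
  have w: "weighted_coeff 24 V i * ((real i + 1) * (25 - real i)) = real_of_int (usorted_row 13 ! (i + 1))" if i: "i \<le> 24" for i
  proof -
    have "26 - Suc i = Suc (24 - i)" using i by simp
    then have "coeff V i = real (usorted_count (Suc i) (25 - i)) / ((real i + 1) * fact i * ((25 - real i) * fact (24 - i)))"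
      unfolding cV using c[of "Suc i"] i by (simp add: of_nat_diff algebra_simps)
    moreover have "25 - real i \<noteq> 0" "real i + 1 \<noteq> 0" using i by auto
    ultimately show ?thesis
      using usorted_row_nth[of "Suc i" 13] i by (simp add: weighted_coeff_def)
  qed
  have pos: "0 < (real i + 1) * (25 - real i)" if "i \<le> 24" for i using that by simp
  have "ultra_log_concave 24 (56535215267979888 / fact 24) V"
    unfolding ultra_log_concave_def
  proof (intro conjI allI impI)
    fix i :: nat assume i: "i \<le> 24"
    have "56535215267979888 * ((int i + 1) * (2 * int 13 - 1 - int i)) \<le> usorted_row 13 ! (i + 1)"
      using lb i by (simp add: row_lower_bound_def list_all_iff)
    then have "real_of_int (56535215267979888 * ((int i + 1) * (2 * int 13 - 1 - int i))) \<le> real_of_int (usorted_row 13 ! (i + 1))"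
      by (simp only: of_int_le_iff)
    then have "56535215267979888 * ((real i + 1) * (25 - real i)) \<le> weighted_coeff 24 V i * ((real i + 1) * (25 - real i))"
      unfolding w[OF i] by simp
    then show "56535215267979888 / fact 24 * fact 24 \<le> weighted_coeff 24 V i"
      using pos[OF i] by (simp only: mult_le_cancel_right_pos) simp
  next
    fix i :: nat assume "24 < i"
    then consider "i = 25" | "25 < i" by linarith
    then show "coeff V i = 0"
    proof cases
      \<comment> \<open>The last entry of the row vanishes, which is the divisibility by
        \<open>s\<close>.\<close>
      case 1
      then show ?thesis unfolding cV using c[of 26] by (simp add: usorted_count_0)
    next
      case 2
      then show ?thesis unfolding cV by (intro coeff_row_poly_eq_0) simp
    qed
  next
    fix i :: nat assume i: "Suc i < 24"
    define P Q where "P = real i + 2" and "Q = 24 - real i"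
    define x y z where "x = weighted_coeff 24 V i" and "y = weighted_coeff 24 V (Suc i)" and "z = weighted_coeff 24 V (i + 2)"
    have shift: "P - 1 = real i + 1" "Q + 1 = 25 - real i" "P = real (Suc i) + 1" "Q = 25 - real (Suc i)"
        "P + 1 = real (i + 2) + 1" "Q - 1 = 25 - real (i + 2)"
      by (simp_all add: P_def Q_def)
    have idx: "i + 2 = Suc i + 1" "i + 3 = i + 2 + 1" by simp_all
    have X: "real_of_int (usorted_row 13 ! (i + 1)) = x * ((P - 1) * (Q + 1))"
      unfolding shift(1,2) x_def using w[of i] i by simp
    have Y: "real_of_int (usorted_row 13 ! (i + 2)) = y * (P * Q)"
      unfolding y_def idx(1) using w[of "Suc i"] i unfolding shift(3,4)[symmetric] by simp
    have Z: "real_of_int (usorted_row 13 ! (i + 3)) = z * ((P + 1) * (Q - 1))"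
      unfolding z_def idx(2) using w[of "i + 2"] i unfolding shift(5,6)[symmetric] by simp
    define p q where "p = int i + 2" and "q = 2 * int 13 - p"
    have PQ: "real_of_int p = P" "real_of_int q = Q" by (simp_all add: P_def Q_def p_def q_def)
    have "usorted_row 13 ! (i + 1) * usorted_row 13 ! (i + 3) * (p * q * (p * q)) \<le>
        usorted_row 13 ! (i + 2) * usorted_row 13 ! (i + 2) * ((p - 1) * (q + 1) * ((p + 1) * (q - 1)))"
      using slc i unfolding row_strongly_log_concave_def list_all_iff Let_def p_def q_def by auto
    then have "real_of_int (usorted_row 13 ! (i + 1) * usorted_row 13 ! (i + 3) * (p * q * (p * q))) \<le>
        real_of_int (usorted_row 13 ! (i + 2) * usorted_row 13 ! (i + 2) * ((p - 1) * (q + 1) * ((p + 1) * (q - 1))))"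
      by (simp only: of_int_le_iff)
    then have "x * ((P - 1) * (Q + 1)) * (z * ((P + 1) * (Q - 1))) * (P * Q * (P * Q)) \<le>
        y * (P * Q) * (y * (P * Q)) * ((P - 1) * (Q + 1) * ((P + 1) * (Q - 1)))"
      by (simp only: of_int_mult of_int_add of_int_diff of_int_1 X Y Z PQ)
    then have "(x * z) * ((P - 1) * (Q + 1) * ((P + 1) * (Q - 1)) * (P * Q * (P * Q))) \<le>
        y\<^sup>2 * ((P - 1) * (Q + 1) * ((P + 1) * (Q - 1)) * (P * Q * (P * Q)))"
      by (simp only: power2_eq_square mult_ac)
    moreover have "0 < (P - 1) * (Q + 1) * ((P + 1) * (Q - 1)) * (P * Q * (P * Q))"
      using i by (intro mult_pos_pos) (auto simp: P_def Q_def)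
    ultimately show "x * z \<le> y\<^sup>2" by (simp only: mult_le_cancel_right_pos)
  qed
  then show ?thesis using that V \<open>a = 0\<close> by blast
qed

lemma usorted_count_log_concave_small:
  assumes "1 \<le> p" "1 \<le> q" "p + q = 2 * k" "k \<le> 13"
  shows "usorted_count (p - 1) (q + 1) * usorted_count (p + 1) (q - 1) \<le> (usorted_count p q)\<^sup>2"
proof -
  have rows: "rows (rev (pascal 26)) 13 = (map usorted_row [0..<Suc 13], map (\<lambda>m. int (usorted_total (2 * m + 1))) [0..<Suc 13])"
    by (rule rows_eq) simp
  have tl: "tl (map usorted_row [0..<Suc 13]) = map usorted_row [1..<Suc 13]"
    by (simp only: map_tl[symmetric] tl_upt One_nat_def)
  have all: "list_all row_log_concave (map usorted_row [1..<Suc 13])"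
    using first_rows_check unfolding rows Let_def fst_conv tl by (rule conjunct1)
  have "k \<in> {1..<Suc 13}" using assms by auto
  then have "usorted_row k \<in> set (map usorted_row [1..<Suc 13])" unfolding set_map set_upt by (rule imageI)
  with all have "row_log_concave (usorted_row k)" unfolding list_all_iff by (rule bspec)
  moreover have "p - 1 \<in> set [0..<length (usorted_row k) - 2]" using assms by (simp add: usorted_row_def)
  ultimately have "usorted_row k ! (p - 1) * usorted_row k ! Suc (Suc (p - 1)) \<le> usorted_row k ! Suc (p - 1) * usorted_row k ! Suc (p - 1)"
    unfolding row_log_concave_def list_all_iff by blast
  moreover have "Suc (p - 1) = p" "2 * k - (p - 1) = q + 1" "Suc (2 * k) - p = q + 1" "2 * k - Suc p = q - 1" "2 * k - p = q" "Suc p \<le> 2 * k"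
    using assms by auto
  ultimately have "int (usorted_count (p - 1) (q + 1) * usorted_count (p + 1) (q - 1)) \<le> int ((usorted_count p q)\<^sup>2)"
    by (simp add: usorted_row_nth power2_eq_square)
  then show ?thesis by (simp only: of_nat_le_iff)
qed

lemma usorted_count_log_concave:
  assumes "1 \<le> p" "1 \<le> q" "p + q = 2 * k" "k \<le> 53"
  shows "usorted_count (p - 1) (q + 1) * usorted_count (p + 1) (q - 1) \<le> (usorted_count p q)\<^sup>2"
proof -
  \<comment> \<open>If \<open>p\<close> or \<open>q\<close> is 1, one neighbour is an end of the row
    and vanishes.\<close>
  consider "k \<le> 13" | "p = 1" | "q = 1" | "13 < k" "2 \<le> p" "2 \<le> q" using assms by linarith
  then show ?thesis
  proof cases
    case 1
    then show ?thesis using usorted_count_log_concave_small assms by blast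
  next
    case 4
    \<comment> \<open>The coefficients of the reciprocal series behave like a constant times
      \<open>zeta ^ (- m)\<close>; with this \<open>c\<close>,
      \<open>c * bessel_inv_coeff (13 - j)\<close> approximates
      \<open>bessel_inv_coeff (k - j)\<close>.\<close>
    define c where "c = 1 / zeta ^ (k - 13)"
    define m :: real where "m = 56535215267979888 / fact 24"
    define S where "S = (\<Sum>j\<le>k. bessel_weight j *
      \<bar>bessel_inv_coeff (k - j) - (if j \<le> 13 then c * bessel_inv_coeff (13 - j) else 0)\<bar>)"
    obtain V where V: "row_poly 13 = pCons 0 V" "ultra_log_concave (2 * 13 - 2) m V"
      using row_13 by (auto simp: m_def)
    have c: "0 < c" using zeta_pos by (simp add: c_def)
    \<comment> \<open>Splitting \<open>zeta ^ k\<close> between the weight and the difference leaves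
      only scaled quantities, and \<open>c\<close> disappears.\<close>
    have "S * zeta ^ k = (\<Sum>j\<le>k. bessel_weight j * zeta ^ j *
        \<bar>scaled_inv (k - j) - (if j \<le> 13 then scaled_inv (13 - j) else 0)\<bar>)"
      unfolding S_def sum_distrib_right
    proof (intro sum.cong refl)
      fix j assume j: "j \<in> {..k}"
      have z: "zeta ^ k = zeta ^ j * zeta ^ (k - j)" using j by (simp add: power_add[symmetric])
      have "(if j \<le> 13 then c * bessel_inv_coeff (13 - j) else 0) * zeta ^ (k - j) =
          (if j \<le> 13 then scaled_inv (13 - j) else 0)"
      proof (cases "j \<le> 13")
        case True
        then have "zeta ^ (k - j) = zeta ^ (k - 13) * zeta ^ (13 - j)" using 4 by (simp add: power_add[symmetric])
        then show ?thesis using True zeta_pos by (simp add: c_def scaled_inv_def)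
      qed simp
      then have "scaled_inv (k - j) - (if j \<le> 13 then scaled_inv (13 - j) else 0) =
          (bessel_inv_coeff (k - j) - (if j \<le> 13 then c * bessel_inv_coeff (13 - j) else 0)) * zeta ^ (k - j)"
        by (simp only: left_diff_distrib scaled_inv_def)
      then show "bessel_weight j * \<bar>bessel_inv_coeff (k - j) - (if j \<le> 13 then c * bessel_inv_coeff (13 - j) else 0)\<bar> * zeta ^ k =
          bessel_weight j * zeta ^ j * \<bar>scaled_inv (k - j) - (if j \<le> 13 then scaled_inv (13 - j) else 0)\<bar>"
        using zeta_pos by (simp only: z abs_mult) simp
    qed
    then have S: "S * zeta ^ k \<le> 8 / 10 ^ 5" using scaled_error_le[of k] 4 assms by simp
    \<comment> \<open>The values at \<open>k = 53\<close>; their product is the 11130 of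
      \<open>scale_bound\<close>.\<close>
    have "2 * k * (2 * k - 1) \<le> 106 * 105" using assms by (intro mult_mono) auto
    then have "real (2 * k * (2 * k - 1)) \<le> real (106 * 105)" by (simp only: of_nat_le_iff)
    then have "real (2 * k * (2 * k - 1)) \<le> 11130" by simp
    moreover have S0: "0 \<le> S * zeta ^ k" using zeta_pos unfolding S_def bessel_weight_def
      by (intro mult_nonneg_nonneg sum_nonneg) auto
    ultimately have "real (2 * k * (2 * k - 1)) * (S * zeta ^ k) \<le> 11130 * (8 / 10 ^ 5)"
      using S by (intro mult_mono) auto
    also have "\<dots> \<le> zeta ^ 13 * m / 2"
      unfolding m_def by (rule scale_bound)
    also have "\<dots> = (c * m / 2) * zeta ^ k"
    proof -
      have "zeta ^ k = zeta ^ (k - 13) * zeta ^ 13" using 4 by (simp add: power_add[symmetric])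
      then show ?thesis using zeta_pos by (simp add: c_def)
    qed
    finally have E: "real (2 * k * (2 * k - 1)) * S \<le> c * m / 2"
      using zeta_pos by (simp only: mult.assoc[symmetric] mult_le_cancel_right_pos zero_less_power)
    have "gf_count (p - 1) (q + 1) * gf_count (p + 1) (q - 1) \<le> (gf_count p q)\<^sup>2"
    proof (rule gf_count_log_concave[OF V _ _ _ c E[unfolded S_def] _ _ assms(3)])
      show "0 \<le> gf_count (p - 1) (q + 1)" "0 \<le> gf_count (p + 1) (q - 1)"
        by (simp_all flip: usorted_count_eq_gf_count)
    qed (use 4 in \<open>auto simp: m_def\<close>)
    then have "real (usorted_count (p - 1) (q + 1) * usorted_count (p + 1) (q - 1)) \<le> real ((usorted_count p q)\<^sup>2)"
      by (simp add: usorted_count_eq_gf_count)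
    then show ?thesis by (simp only: of_nat_le_iff)
  qed (simp_all add: usorted_count_0 usorted_count_0_left)
qed

theorem proposition1p2:
  fixes k l :: nat
  assumes "k \<le> 53" and "2 \<le> l" and "l \<le> 2 * k"
  shows "uniq_sorted_count (k + 1) (l - 1) * uniq_sorted_count (k + 1) (l + 1)
           \<le> (uniq_sorted_count (k + 1) l)\<^sup>2"
proof -
  define p q where "p = l - 1" and "q = 2 * k + 1 - l"
  have pq: "1 \<le> p" "1 \<le> q" "p + q = 2 * k" using assms by (auto simp: p_def q_def)
  have "uniq_sorted_count (k + 1) (l - 1) = usorted_count (p - 1) (q + 1)"
    using assms by (subst uniq_sorted_count_eq) (auto simp: p_def q_def Suc_diff_le)
  moreover have "uniq_sorted_count (k + 1) (l + 1) = usorted_count (p + 1) (q - 1)"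
    using assms by (subst uniq_sorted_count_eq) (auto simp: p_def q_def)
  moreover have "uniq_sorted_count (k + 1) l = usorted_count p q"
    using assms by (subst uniq_sorted_count_eq) (auto simp: p_def q_def)
  ultimately show ?thesis using usorted_count_log_concave[OF pq assms(1)] by simp
qed

end
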